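(* Let $\vec p_1=(p_{1,1},\dots,p_{1,n})$ and $\vec p_2=(p_{2,1},\dots,p_{2,n})$ satisfy $1<\vec p_1,\vec p_2<\infty$. For $j=1,2$, let either $1<\frac{n}{\sum_{i=1}^n 1/p_{j,i}}<t_j<r_j<\infty$ or $1<\frac{n}{\sum_{i=1}^n 1/p_{j,i}}\le t_j<r_j=\infty$. Let $0<\alpha<n$ and $\frac1{t_2}=\frac1{t_1}-\frac\alpha n$. Assume that $t_1\vec p_2=t_2\vec p_1$ and $t_1r_2=t_2r_1$. Then there is a constant $C>0$ such that for all $f\in M_{\vec p_1}^{t_1,r_1}$ $$\|I_\alpha f\|_{M_{\vec p_2}^{t_2,r_2}}\le C\|f\|_{M_{\vec p_1}^{t_1,r_1}}.$$
   Context: Functions are complex-valued and measurable on $\mathbb R^n$. Inequalities for vectors and multiplication of a vector by a scalar are componentwise. Mixed Lebesgue norm: for $\vec p=(p_1,\dots,p_n)$, $$\|f\|_{L^{\vec p}}=\Big(\int_{\mathbb R}\cdots\Big(\int_{\mathbb R}|f(x_1,\dots,x_n)|^{p_1}dx_1\Big)^{p_2/p_1}\cdots dx_n\Big)^{1/p_n}.$$ $\mathcal D$ is the family of all dyadic cubes $\prod_{i=1}^n[2^{-j}m_i,2^{-j}(m_i+1))$, $j\in\mathbb Z$, $m\in\mathbb Z^n$. Mixed Bourgain-Morrey space: $M_{\vec p}^{t,r}$ is the set of measurable $f$ with $$\|f\|_{M_{\vec p}^{t,r}}=\Big(\sum_{Q\in\mathcal D}|Q|^{\frac rt-\frac rn\sum_{i=1}^n\frac1{p_i}}\|f\chi_Q\|_{L^{\vec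 p}}^r\Big)^{1/r}<\infty$$ (supremum over $Q\in\mathcal D$ of $|Q|^{\frac1t-\frac1n\sum_i\frac1{p_i}}\|f\chi_Q\|_{L^{\vec p}}$ if $r=\infty$). Fractional integral operator: $I_\alpha f(x)=\int_{\mathbb R^n}\frac{f(y)}{|x-y|^{n-\alpha}}\,dy$. *)

theory Defs
  imports "HOL-Analysis.Analysis"
begin

text \<open>
  Real powers of extended nonnegative reals. The definition is meant for exponents
  \<open>a > 0\<close> only, where \<open>0\<^sup>a = 0\<close> and \<open>\<infinity>\<^sup>a = \<infinity>\<close>.
\<close>

definition ennpowr :: "ennreal \<Rightarrow> real \<Rightarrow> ennreal" where
  "ennpowr x a = (if x = \<infinity> then \<infinity> else ennreal (enn2real x powr a))"

text \<open>
  The space of dimension \<open>n\<close> is \<open>real ^ 'n\<close> with \<open>n = CARD('n)\<close>. The linear order on the index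
  type fixes the order of the coordinates \<open>x\<^sub>1, \<dots>, x\<^sub>n\<close>, on which mixed norms depend.
  \<open>partial_Lp q i g\<close> takes the \<open>L\<^sup>q\<close> norm of \<open>g\<close> in the \<open>i\<close>-th variable; the result, as a
  function of all variables, no longer depends on the \<open>i\<close>-th one.
\<close>

definition partial_Lp ::
  "real \<Rightarrow> 'n::finite \<Rightarrow> (real ^ 'n \<Rightarrow> ennreal) \<Rightarrow> real ^ 'n \<Rightarrow> ennreal" where
  "partial_Lp q i g x =
     ennpowr (\<integral>\<^sup>+ s. ennpowr (g (\<chi> k. if k = i then s else x $ k)) q \<partial>lborel) (1 / q)"

text \<open>
  The mixed norm takes the \<open>L\<close>-norm with exponent \<open>p $ i\<close> in each variable, the first variable
  innermost. (The exponent \<open>p\<^sub>2 / p\<^sub>1\<close> of the usual formula is the outer exponent \<open>1 / p\<^sub>1\<close> of one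
  step followed by the inner exponent \<open>p\<^sub>2\<close> of the next.) After all steps the function is constant;
  its value is read off at \<open>0\<close>. For Lebesgue measurable \<open>f\<close> a slice may fail to be measurable on a
  null set of the remaining variables, which does not affect the value.
\<close>

definition mixed_norm ::
  "real ^ 'n::{finite,linorder} \<Rightarrow> (real ^ 'n::{finite,linorder} \<Rightarrow> complex) \<Rightarrow> ennreal" where
  "mixed_norm p f =
     fold (\<lambda>i. partial_Lp (p $ i) i) (sorted_list_of_set UNIV) (\<lambda>x. ennreal (norm (f x))) 0"

definition dyadic_cube :: "int \<Rightarrow> int ^ 'n \<Rightarrow> (real ^ 'n::finite) set" where
  "dyadic_cube j m =
     {x. \<forall>i. 2 powi (- j) * of_int (m $ i) \<le> x $ i \<and> x $ i < 2 powi (- j) * (of_int (m $ i) + 1)}"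

definition dyadic_cubes :: "(real ^ 'n::finite) set set" where
  "dyadic_cubes = {dyadic_cube j m | j m. True}"

text \<open>
  The exponent \<open>r\<close> is an extended real. The sum over the dyadic cubes is an unordered sum in
  \<open>ennreal\<close>, hence always defined.
\<close>

definition bourgain_morrey_norm ::
  "real ^ 'n::{finite,linorder} \<Rightarrow> real \<Rightarrow> ereal \<Rightarrow> (real ^ 'n::{finite,linorder} \<Rightarrow> complex) \<Rightarrow> ennreal" where
  "bourgain_morrey_norm p t r f =
     (if r = \<infinity> then
        (SUP Q\<in>dyadic_cubes.
           ennreal (measure lebesgue Q powr (1 / t - 1 / real CARD('n) * (\<Sum>i\<in>UNIV. 1 / p $ i)))
             * mixed_norm p (\<lambda>x. f x * indicator Q x))
      else
        let s = real_of_ereal r in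
        ennpowr
          (\<Sum>\<^sub>\<infinity>Q\<in>dyadic_cubes.
             ennreal (measure lebesgue Q powr (s / t - s / real CARD('n) * (\<Sum>i\<in>UNIV. 1 / p $ i)))
               * ennpowr (mixed_norm p (\<lambda>x. f x * indicator Q x)) s)
          (1 / s))"

definition bourgain_morrey ::
  "real ^ 'n::{finite,linorder} \<Rightarrow> real \<Rightarrow> ereal \<Rightarrow> (real ^ 'n::{finite,linorder} \<Rightarrow> complex) set" where
  "bourgain_morrey p t r =
     {f. f \<in> borel_measurable lebesgue \<and> bourgain_morrey_norm p t r f < \<infinity>}"

definition frac_integrand ::
  "real \<Rightarrow> (real ^ 'n::finite \<Rightarrow> complex) \<Rightarrow> real ^ 'n \<Rightarrow> real ^ 'n \<Rightarrow> complex" where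
  "frac_integrand \<alpha> f x y = f y / of_real (norm (x - y) powr (real CARD('n) - \<alpha>))"

text \<open>
  The Bochner integral has the value \<open>0\<close> at points \<open>x\<close> where the integrand is not integrable, so
  statements about \<open>frac_integral\<close> need a separate claim of integrability for almost every \<open>x\<close>.
\<close>

definition frac_integral ::
  "real \<Rightarrow> (real ^ 'n::finite \<Rightarrow> complex) \<Rightarrow> real ^ 'n \<Rightarrow> complex" where
  "frac_integral \<alpha> f x = (\<integral>y. frac_integrand \<alpha> f x y \<partial>lebesgue)"

end

theory Submission
  imports Defs
begin

text \<open>
  Write \<open>\<theta> = t1 / t2\<close>. On a dyadic cube \<open>Q\<close>, the Riesz potential of \<open>|f|\<close> splits into the dyadic scales
  below and above the side of \<open>Q\<close>. At small scales, Hedberg's argument balances the average of \<open>|f|\<close>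
  against the Morrey bound \<open>N\<close> of the averages and yields \<open>N\<^bsup>1 - \<theta>\<^esup> (M f)\<^bsup>\<theta>\<^esup>\<close>, where \<open>M\<close> is a maximal
  function of the restriction of \<open>f\<close> to the neighbours of \<open>Q\<close>. Since \<open>p1 = \<theta> p2\<close>, the mixed norm of this
  is controlled by the bound for \<open>M\<close> on \<open>L\<^bsup>p1\<^esup>\<close>. The large scales are constant on \<open>Q\<close> and form a
  geometric series over the ancestors of \<open>Q\<close>, whose sum over all \<open>Q\<close> converges because \<open>t2 < r2\<close>.

  \<open>M\<close> is dominated by iterated one-dimensional maximal functions, so what is needed is a maximal
  inequality in one variable \<open>y\<close> for functions with values in a mixed-norm space of other variables. If the
  exponent of \<open>y\<close> is that of the last inner variable, Tonelli's theorem reduces it to fewer inner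
  variables. Other exponents are reached by a good-\<open>\<lambda>\<close> inequality along dyadic partitions, and centred
  intervals are covered by cells of two dyadic grids shifted by a third.
\<close>

section \<open>Powers and integral inequalities\<close>

text \<open>Mixed norms are not symmetric in the coordinates, and Tonelli exchanges two of them only
  when their exponents coincide. This obstructs iterating the scalar maximal theorem: in an outer
  coordinate the maximal operator acts on functions with values in a mixed norm. The good-\<lambda>
  step carries a bound at one exponent p0 to every q > 1. It absorbs half of the left-hand side,
  which must be finite beforehand; hence all maximal functions run over finitely many scales, with
  constants uniform in their number, and monotone convergence removes the restriction. The ratio
  \<theta> is common to t, p and r. So the \<theta>-th power turns norms, cube weights and l^r sums
  of the source space into those of the target space. For large scales the balance is a count: a
  cube has 2^(nK) descendants K levels below, while the r2-th power of the contribution from K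
  levels above decays like 2^(-nK r2/t2). All estimates concern nonnegative functions with values in
  \<open>ennreal\<close>; finiteness of the resulting norm gives the integrability for almost every
  x.\<close>

lemma ennpowr_ennreal: "0 \<le> r \<Longrightarrow> ennpowr (ennreal r) a = ennreal (r powr a)"
  by (simp add: ennpowr_def)

lemma ennpowr_top [simp]: "ennpowr top a = top"
  by (simp add: ennpowr_def)

lemma ennpowr_0 [simp]: "ennpowr 0 a = 0"
  by (simp add: ennpowr_def)

lemma ennpowr_1 [simp]: "ennpowr 1 a = 1"
  by (simp add: ennpowr_def)

lemma ennpowr_one [simp]: "ennpowr x 1 = x"
  by (cases x) (auto simp: ennpowr_ennreal)

lemma ennpowr_mono: "x \<le> y \<Longrightarrow> 0 \<le> a \<Longrightarrow> ennpowr x a \<le> ennpowr y a"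
  by (cases x; cases y) (auto simp: ennpowr_ennreal top_unique intro!: ennreal_leI powr_mono2)

lemma ennpowr_mult: "0 < a \<Longrightarrow> ennpowr (x * y) a = ennpowr x a * ennpowr y a"
  by (cases x; cases y)
     (auto simp: ennpowr_ennreal powr_mult ennreal_mult[symmetric] ennreal_mult_top ennreal_top_mult
        ennreal_eq_0_iff ennreal_mult_eq_top_iff)

lemma ennpowr_ennpowr: "ennpowr (ennpowr x a) b = ennpowr x (a * b)"
  by (cases x) (auto simp: ennpowr_ennreal powr_powr)

lemma ennpowr_inverse [simp]:
  "a \<noteq> 0 \<Longrightarrow> ennpowr (ennpowr x a) (1 / a) = x" "a \<noteq> 0 \<Longrightarrow> ennpowr (ennpowr x (1 / a)) a = x"
  by (simp_all add: ennpowr_ennpowr)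

lemma ennpowr_add: "0 < a \<Longrightarrow> 0 < b \<Longrightarrow> ennpowr x (a + b) = ennpowr x a * ennpowr x b"
  by (cases x) (auto simp: ennpowr_ennreal powr_add ennreal_mult[symmetric])

lemma ennpowr_eq_0_iff [simp]: "ennpowr x a = 0 \<longleftrightarrow> x = 0"
  by (cases x) (auto simp: ennpowr_ennreal ennreal_eq_0_iff)

lemma ennpowr_eq_top_iff [simp]: "ennpowr x a = top \<longleftrightarrow> x = top"
  by (cases x) (auto simp: ennpowr_ennreal)

lemma ennpowr_less_top_iff [simp]: "ennpowr x a < top \<longleftrightarrow> x < top"
  by (simp add: less_top[symmetric])

lemma ennpowr_le_iff_le_root: "0 < a \<Longrightarrow> ennpowr x a \<le> y \<longleftrightarrow> x \<le> ennpowr y (1 / a)"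
  using ennpowr_mono[of "ennpowr x a" y "1 / a"] ennpowr_mono[of x "ennpowr y (1 / a)" a]
  by auto

lemma ennpowr_root_le_iff: "0 < a \<Longrightarrow> ennpowr x (1 / a) \<le> y \<longleftrightarrow> x \<le> ennpowr y a"
  using ennpowr_le_iff_le_root[of "1 / a" x y] by simp

lemma ennpowr_le_iff: "0 < a \<Longrightarrow> ennpowr x a \<le> ennpowr y a \<longleftrightarrow> x \<le> y"
  by (simp add: ennpowr_le_iff_le_root)

lemma ennpowr_SUP: "0 < a \<Longrightarrow> ennpowr (SUP i\<in>I. f i) a = (SUP i\<in>I. ennpowr (f i) a)"
proof (rule antisym)
  assume a: "0 < a"
  show "ennpowr (SUP i\<in>I. f i) a \<le> (SUP i\<in>I. ennpowr (f i) a)"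
    unfolding ennpowr_le_iff_le_root[OF a]
    by (intro SUP_least, subst ennpowr_le_iff_le_root[OF a, symmetric]) (auto intro: SUP_upper)
  show "(SUP i\<in>I. ennpowr (f i) a) \<le> ennpowr (SUP i\<in>I. f i) a"
    using a by (intro SUP_least ennpowr_mono SUP_upper) auto
qed

lemma borel_measurable_ennpowr [measurable (raw)]:
  assumes [measurable]: "f \<in> borel_measurable M"
  shows "(\<lambda>x. ennpowr (f x) a) \<in> borel_measurable M"
proof -
  have "(\<lambda>x. enn2real (f x) powr a) \<in> borel_measurable M"
    using powr_real_measurable[of "\<lambda>x. enn2real (f x)" M "\<lambda>x. a"] by measurable
  moreover have "{x \<in> space M. f x = \<infinity>} \<in> sets M"
    using borel_measurable_eq[OF assms, of "\<lambda>_. \<infinity>"] by simp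
  ultimately show ?thesis
    unfolding ennpowr_def by (intro measurable_If) auto
qed

lemma ennpowr_max: "0 < a \<Longrightarrow> ennpowr (max x y) a = max (ennpowr x a) (ennpowr y a)"
  by (simp add: max_def ennpowr_le_iff)

lemma ennpowr_add_le:
  assumes a: "0 < a"
  shows "ennpowr (x + y) a \<le> ennpowr 2 a * (ennpowr x a + ennpowr y a)"
proof -
  have "x + y \<le> 2 * max x y"
    by (metis add_mono max.cobounded1 max.cobounded2 mult_2)
  then have "ennpowr (x + y) a \<le> ennpowr 2 a * max (ennpowr x a) (ennpowr y a)"
    using a by (metis ennpowr_max ennpowr_mono ennpowr_mult less_imp_le)
  also have "\<dots> \<le> ennpowr 2 a * (ennpowr x a + ennpowr y a)"
    by (intro mult_left_mono) auto
  finally show ?thesis .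
qed

lemma ennpowr_sum_le:
  assumes a: "0 < a" and S: "finite S"
  shows "ennpowr (\<Sum>i\<in>S. f i) a \<le> ennpowr (of_nat (card S)) a * (\<Sum>i\<in>S. ennpowr (f i) a)"
proof (cases "S = {}")
  case False
  define m where "m = Max (f ` S)"
  have m: "f i \<le> m" if "i \<in> S" for i
    using that S by (simp add: m_def)
  obtain i where i: "i \<in> S" "m = f i"
    using Max_in[of "f ` S"] S False unfolding m_def by blast
  have "(\<Sum>i\<in>S. f i) \<le> of_nat (card S) * m"
    using sum_bounded_above[of S f m] m by auto
  then have "ennpowr (\<Sum>i\<in>S. f i) a \<le> ennpowr (of_nat (card S)) a * ennpowr m a"
    using a by (metis ennpowr_mono ennpowr_mult less_imp_le)
  also have "\<dots> \<le> ennpowr (of_nat (card S)) a * (\<Sum>i\<in>S. ennpowr (f i) a)"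
    using i S by (intro mult_left_mono) (auto intro: member_le_sum)
  finally show ?thesis .
qed auto

section \<open>Jensen, Hoelder and Minkowski inequalities for \<open>ennreal\<close>-valued
  functions\<close>

lemma ennreal_Youngs_inequality:
  assumes q: "1 \<le> q" and c: "0 \<le> c"
  shows "g * ennreal (c powr (q - 1)) \<le> ennreal (1 / q) * ennpowr g q + ennreal ((1 - 1 / q) * c powr q)"
proof (cases g)
  case (real r)
  show ?thesis
  \<comment> \<open>The conjugate exponent \<open>q / (q - 1)\<close> is available only for q >
    1.\<close>
  proof (cases "q = 1")
    case True
    then show ?thesis using real c by (simp add: ennpowr_ennreal ennreal_mult[symmetric])
  next
    case False
    then have q1: "1 < q" using q by simp
    have "r * c powr (q - 1) \<le> (1 / q) * r powr q + (1 - 1 / q) * (c powr (q - 1)) powr (q / (q - 1))"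
      using Youngs_inequality[of q "q / (q - 1)" r "c powr (q - 1)"] q1 real c
      by (simp add: field_simps)
    also have "(c powr (q - 1)) powr (q / (q - 1)) = c powr q"
      using q1 by (simp add: powr_powr)
    finally have "r * c powr (q - 1) \<le> (1 / q) * r powr q + (1 - 1 / q) * c powr q" .
    then show ?thesis using real c q1
      by (simp add: ennpowr_ennreal ennreal_mult[symmetric] ennreal_plus[symmetric] del: ennreal_plus)
  qed
next
  case top
  then show ?thesis using q by (simp add: ennreal_mult_top)
qed

text \<open>Jensen's inequality for a weight of mass at most 1. Young's inequality is applied with c
  equal to the integral on the left: integrating \<open>g x * ennreal (c powr (q - 1))\<close>
  against w gives c^q, and the term (1 - 1/q) c^q on the right is absorbed because c is
  finite.\<close>

lemma ennpowr_nn_integral_le: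
  assumes q: "1 \<le> q" and [measurable]: "g \<in> borel_measurable M" "w \<in> borel_measurable M"
    and w: "(\<integral>\<^sup>+x. w x \<partial>M) \<le> 1"
  shows "ennpowr (\<integral>\<^sup>+x. g x * w x \<partial>M) q \<le> (\<integral>\<^sup>+x. ennpowr (g x) q * w x \<partial>M)"
proof (cases "\<integral>\<^sup>+x. g x * w x \<partial>M")
  case (real c)
  let ?I = "\<integral>\<^sup>+x. ennpowr (g x) q * w x \<partial>M"
  have "ennreal (c powr q) = (\<integral>\<^sup>+x. g x * w x \<partial>M) * ennreal (c powr (q - 1))"
    using real q by (simp add: ennreal_mult[symmetric] powr_mult_base)
  also have "\<dots> = (\<integral>\<^sup>+x. g x * ennreal (c powr (q - 1)) * w x \<partial>M)"
    by (subst nn_integral_multc[symmetric]) (auto simp: ac_simps)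
  also have "\<dots> \<le> (\<integral>\<^sup>+x. (ennreal (1 / q) * ennpowr (g x) q + ennreal ((1 - 1 / q) * c powr q)) * w x \<partial>M)"
    using ennreal_Youngs_inequality[OF q real(1)]
    by (intro nn_integral_mono mult_right_mono) auto
  also have "\<dots> = ennreal (1 / q) * ?I + ennreal ((1 - 1 / q) * c powr q) * (\<integral>\<^sup>+x. w x \<partial>M)"
    by (simp add: distrib_right nn_integral_add nn_integral_cmult mult.assoc)
  also have "\<dots> \<le> ennreal (1 / q) * ?I + ennreal ((1 - 1 / q) * c powr q)"
    using mult_left_mono[OF w, of "ennreal ((1 - 1 / q) * c powr q)"] by (intro add_left_mono) auto
  finally have *: "ennreal (c powr q) \<le> ennreal (1 / q) * ?I + ennreal ((1 - 1 / q) * c powr q)" .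
  have "ennreal (c powr q) \<le> ?I"
  proof (cases ?I)
    case (real i)
    then have "ennreal (c powr q) \<le> ennreal (1 / q * i + (1 - 1 / q) * c powr q)"
      using * q by (simp add: ennreal_mult[symmetric] ennreal_plus[symmetric] del: ennreal_plus)
    then have "c powr q \<le> 1 / q * i + (1 - 1 / q) * c powr q"
      using q real by (subst (asm) ennreal_le_iff) auto
    then have "c powr q \<le> i"
      using q by (simp add: field_simps)
    then show ?thesis using real by (simp add: ennreal_leI)
  qed auto
  then show ?thesis using real by (simp add: ennpowr_ennreal)
next
  case top
  \<comment> \<open>With an infinite integral nothing can be absorbed; instead g \<le> 1 + g^q
    forces the right-hand side to be infinite.\<close>
  have "g x * w x \<le> w x + ennpowr (g x) q * w x" for x
  proof -
    have "g x \<le> 1 + ennpowr (g x) q"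
    proof (cases "g x \<le> 1")
      case False
      then have "g x \<le> ennpowr (g x) q"
      proof (cases "g x")
        case (real r)
        then have "1 \<le> r" using False by (metis ennreal_1 ennreal_leI linear)
        then have "r powr 1 \<le> r powr q" using q by (intro powr_mono) auto
        then show ?thesis using real \<open>1 \<le> r\<close> by (simp add: ennpowr_ennreal ennreal_leI)
      qed auto
      then show ?thesis by (simp add: add_increasing)
    qed (simp add: add_increasing2)
    then show ?thesis using mult_right_mono[of "g x" "1 + ennpowr (g x) q" "w x"] by (simp add: distrib_right)
  qed
  then have "top \<le> (\<integral>\<^sup>+x. w x + ennpowr (g x) q * w x \<partial>M)"
    unfolding top[symmetric] by (rule nn_integral_mono)
  also have "\<dots> = (\<integral>\<^sup>+x. w x \<partial>M) + (\<integral>\<^sup>+x. ennpowr (g x) q * w x \<partial>M)"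
    by (simp add: nn_integral_add)
  finally have "(\<integral>\<^sup>+x. ennpowr (g x) q * w x \<partial>M) = top"
    using w by (auto simp: top_unique)
  then show ?thesis by simp
qed

text \<open>Hoelder's inequality, obtained from Jensen's by dividing the weight by its mass.\<close>

lemma ennpowr_nn_integral_le_weighted:
  assumes q: "1 \<le> q" and [measurable]: "g \<in> borel_measurable M" "w \<in> borel_measurable M"
    and w: "(\<integral>\<^sup>+x. w x \<partial>M) \<noteq> top"
  shows "ennpowr (\<integral>\<^sup>+x. g x * w x \<partial>M) q
    \<le> ennpowr (\<integral>\<^sup>+x. w x \<partial>M) (q - 1) * (\<integral>\<^sup>+x. ennpowr (g x) q * w x \<partial>M)"
proof -
  define c where "c = (\<integral>\<^sup>+x. w x \<partial>M)"
  show ?thesis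
  proof (cases "c = 0")
    case True
    then have "AE x in M. w x = 0" by (simp add: c_def nn_integral_0_iff_AE)
    then have "(\<integral>\<^sup>+x. g x * w x \<partial>M) = 0"
      by (subst nn_integral_0_iff_AE) auto
    then show ?thesis by simp
  next
    case False
    obtain r where r: "c = ennreal r" "0 < r"
      using w False unfolding c_def[symmetric] by (cases c) (auto simp: ennreal_eq_0_iff less_le)
    have "(\<integral>\<^sup>+x. w x * ennreal (1 / r) \<partial>M) = 1"
      using r by (simp add: nn_integral_multc c_def[symmetric] ennreal_mult[symmetric])
    then have "ennpowr (\<integral>\<^sup>+x. g x * (w x * ennreal (1 / r)) \<partial>M) q
      \<le> (\<integral>\<^sup>+x. ennpowr (g x) q * (w x * ennreal (1 / r)) \<partial>M)"
      by (intro ennpowr_nn_integral_le q) auto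
    then have "ennpowr (ennreal r) q * ennpowr ((\<integral>\<^sup>+x. g x * w x \<partial>M) * ennreal (1 / r)) q
      \<le> ennpowr (ennreal r) q * ((\<integral>\<^sup>+x. ennpowr (g x) q * w x \<partial>M) * ennreal (1 / r))"
      by (intro mult_left_mono) (simp_all add: nn_integral_multc mult.assoc[symmetric])
    also have "ennpowr (ennreal r) q * ennpowr ((\<integral>\<^sup>+x. g x * w x \<partial>M) * ennreal (1 / r)) q =
      ennpowr ((\<integral>\<^sup>+x. g x * w x \<partial>M) * (ennreal (1 / r) * ennreal r)) q"
      using q by (simp add: ennpowr_mult[symmetric] ac_simps)
    also have "ennreal (1 / r) * ennreal r = 1"
      using r by (simp add: ennreal_mult[symmetric])
    also have "ennpowr (ennreal r) q * ((\<integral>\<^sup>+x. ennpowr (g x) q * w x \<partial>M) * ennreal (1 / r)) =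
      (ennpowr (ennreal r) q * ennreal (1 / r)) * (\<integral>\<^sup>+x. ennpowr (g x) q * w x \<partial>M)"
      by (simp add: ac_simps)
    also have "ennpowr (ennreal r) q * ennreal (1 / r) = ennpowr c (q - 1)"
      using r by (simp add: ennpowr_ennreal ennreal_mult[symmetric] powr_diff)
    finally show ?thesis by (simp add: c_def)
  qed
qed

lemma ennreal_mult_inverse_le_1: "x * inverse x \<le> (1::ennreal)"
proof (cases "x = 0 \<or> x = top")
  case False
  then show ?thesis
    by (metis divide_ennreal_def ennreal_divide_self less_top order_refl)
qed auto

text \<open>The argument avoids duality. Let m y be the L^q norm of the slice of F at y and c the
  integral of m. Hoelder's inequality with weight m, applied to F / m, gives a factor c^(q-1); after
  integration in s each y contributes at most m y, so the total is c^q.\<close>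

theorem Minkowski_integral_inequality:
  assumes M: "sigma_finite_measure M1" "sigma_finite_measure M2"
    and q: "1 \<le> q" and F[measurable]: "case_prod F \<in> borel_measurable (M1 \<Otimes>\<^sub>M M2)"
  shows "ennpowr (\<integral>\<^sup>+s. ennpowr (\<integral>\<^sup>+y. F s y \<partial>M2) q \<partial>M1) (1 / q)
       \<le> (\<integral>\<^sup>+y. ennpowr (\<integral>\<^sup>+s. ennpowr (F s y) q \<partial>M1) (1 / q) \<partial>M2)"
proof -
  interpret M1: sigma_finite_measure M1 by fact
  interpret M2: sigma_finite_measure M2 by fact
  interpret P: pair_sigma_finite M1 M2 ..
  define m where "m y = ennpowr (\<integral>\<^sup>+s. ennpowr (F s y) q \<partial>M1) (1 / q)" for y
  have m_meas[measurable]: "m \<in> borel_measurable M2"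
    unfolding m_def by measurable
  define c where "c = (\<integral>\<^sup>+y. m y \<partial>M2)"
  have mq: "ennpowr (m y) q = (\<integral>\<^sup>+s. ennpowr (F s y) q \<partial>M1)" for y
    using q by (simp add: m_def)
  show ?thesis
  proof (cases "c = top")
    case True then show ?thesis by (simp add: c_def m_def)
  next
    case False
    have fin: "AE y in M2. m y \<noteq> top"
      using False nn_integral_PInf_AE[OF m_meas] unfolding c_def by auto
    \<comment> \<open>Division by m is legitimate: a slice with m y = 0 vanishes almost everywhere,
      and m y = top happens only on a null set.\<close>
    have "AE y in M2. AE s in M1. F s y = F s y * inverse (m y) * m y"
      using fin AE_space
    proof eventually_elim
      case (elim y)
      then have [measurable]: "(\<lambda>s. F s y) \<in> borel_measurable M1" by measurable
      show ?case
      proof (cases "m y = 0")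
        case True
        then have "(\<integral>\<^sup>+s. ennpowr (F s y) q \<partial>M1) = 0" using mq[of y] by simp
        then have "AE s in M1. F s y = 0" by (simp add: nn_integral_0_iff_AE)
        then show ?thesis by eventually_elim simp
      next
        case False
        then have "inverse (m y) * m y = 1"
          using elim by (metis divide_ennreal_def ennreal_divide_self less_top mult.commute not_gr_zero)
        then show ?thesis by (simp add: mult.assoc)
      qed
    qed
    then have AEF: "AE s in M1. AE y in M2. F s y = F s y * inverse (m y) * m y"
      by (subst P.AE_commute) measurable
    have "(\<integral>\<^sup>+s. ennpowr (\<integral>\<^sup>+y. F s y \<partial>M2) q \<partial>M1)
        \<le> (\<integral>\<^sup>+s. ennpowr c (q - 1) * (\<integral>\<^sup>+y. ennpowr (F s y * inverse (m y)) q * m y \<partial>M2) \<partial>M1)"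
    proof (rule nn_integral_mono_AE, use AEF AE_space in eventually_elim)
      case (elim s)
      then have [measurable]: "(\<lambda>y. F s y) \<in> borel_measurable M2" by measurable
      have "(\<integral>\<^sup>+y. F s y \<partial>M2) = (\<integral>\<^sup>+y. F s y * inverse (m y) * m y \<partial>M2)"
        using elim(1) by (rule nn_integral_cong_AE)
      then show ?case using False q unfolding c_def
        by (simp only:) (intro ennpowr_nn_integral_le_weighted; measurable)
    qed
    also have "\<dots> = ennpowr c (q - 1) * (\<integral>\<^sup>+y. \<integral>\<^sup>+s. ennpowr (F s y * inverse (m y)) q * m y \<partial>M1 \<partial>M2)"
      by (subst nn_integral_cmult) (measurable, subst P.Fubini', measurable)
    also have "\<dots> \<le> ennpowr c (q - 1) * (\<integral>\<^sup>+y. m y \<partial>M2)"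
    proof (intro mult_left_mono nn_integral_mono)
      fix y assume "y \<in> space M2"
      then have [measurable]: "(\<lambda>s. F s y) \<in> borel_measurable M1" by measurable
      have "(\<integral>\<^sup>+s. ennpowr (F s y * inverse (m y)) q * m y \<partial>M1) =
          (\<integral>\<^sup>+s. ennpowr (F s y) q * (ennpowr (inverse (m y)) q * m y) \<partial>M1)"
        using q by (simp add: ennpowr_mult mult.assoc)
      also have "\<dots> = (\<integral>\<^sup>+s. ennpowr (F s y) q \<partial>M1) * (ennpowr (inverse (m y)) q * m y)"
        by (rule nn_integral_multc) measurable
      also have "\<dots> = ennpowr (m y * inverse (m y)) q * m y"
        using q by (simp add: mq[symmetric] ennpowr_mult mult.assoc)
      also have "\<dots> \<le> 1 * m y"
        using q ennpowr_mono[OF ennreal_mult_inverse_le_1[of "m y"], of q] by (intro mult_right_mono) auto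
      finally show "(\<integral>\<^sup>+s. ennpowr (F s y * inverse (m y)) q * m y \<partial>M1) \<le> m y" by simp
    qed auto
    also have "ennpowr c (q - 1) * (\<integral>\<^sup>+y. m y \<partial>M2) = ennpowr c q"
      using q False unfolding c_def[symmetric]
      by (cases c) (auto simp: ennpowr_ennreal ennreal_mult[symmetric] powr_mult_base mult.commute)
    finally show ?thesis
      using q by (subst ennpowr_root_le_iff) (auto simp: c_def m_def)
  qed
qed

section \<open>Maximal functions along nested partitions of the line\<close>

text \<open>The derivative of u^p on the positive half-line. The indicator makes it vanish for u
  \<le> 0, so estimates of level sets are needed at positive levels only.\<close>

definition layer_weight :: "real \<Rightarrow> real \<Rightarrow> ennreal" where
  "layer_weight p u = ennreal (p * u powr (p - 1)) * indicator {0<..} u"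

lemma borel_measurable_layer_weight [measurable]: "layer_weight p \<in> borel_measurable borel"
  unfolding layer_weight_def by measurable

lemma nn_integral_layer_weight:
  assumes p: "0 < p"
  shows "(\<integral>\<^sup>+u. layer_weight p u * indicator {u. ennreal u < x} u \<partial>lborel) = ennpowr x p"
proof -
  have fin: "(\<integral>\<^sup>+u. layer_weight p u * indicator {u. ennreal u < ennreal r} u \<partial>lborel) = ennreal (r powr p)"
    if r: "0 \<le> r" for r
  proof -
    have "((\<lambda>u. p * u powr (p - 1)) has_integral p * (r powr (p - 1 + 1) / (p - 1 + 1))) {0..r}"
      using p r by (intro has_integral_mult_right has_integral_powr_from_0) auto
    then have eq: "(\<integral>\<^sup>+u. ennreal (p * u powr (p - 1)) * indicator {0..r} u \<partial>lborel) = ennreal (r powr p)"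
      using p nn_integral_has_integral_lebesgue'[of "{0..r}" "\<lambda>u. p * u powr (p - 1)"] by simp
    have "AE u in lborel. layer_weight p u * indicator {u. ennreal u < ennreal r} u =
      ennreal (p * u powr (p - 1)) * indicator {0..r} u"
      using AE_lborel_singleton[of 0] AE_lborel_singleton[of r]
      by eventually_elim (auto simp: layer_weight_def indicator_def ennreal_less_iff)
    then have "(\<integral>\<^sup>+u. layer_weight p u * indicator {u. ennreal u < ennreal r} u \<partial>lborel) =
        (\<integral>\<^sup>+u. ennreal (p * u powr (p - 1)) * indicator {0..r} u \<partial>lborel)"
      by (rule nn_integral_cong_AE)
    then show ?thesis using eq by simp
  qed
  show ?thesis
  proof (cases x)
    case (real r)
    then show ?thesis using fin[of r] by (simp add: ennpowr_ennreal)
  next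
    case top
    have *: "y \<le> (\<integral>\<^sup>+u. layer_weight p u * indicator {u. ennreal u < x} u \<partial>lborel)" if y: "y \<noteq> top" for y
    proof -
      obtain r where r: "y = ennreal r" "0 \<le> r" using y by (cases y) (auto simp: top_unique)
      have "y = (\<integral>\<^sup>+u. layer_weight p u * indicator {u. ennreal u < ennreal (r powr (1 / p))} u \<partial>lborel)"
        using r p fin[of "r powr (1 / p)"] by (simp add: powr_powr)
      also have "\<dots> \<le> (\<integral>\<^sup>+u. layer_weight p u * indicator {u. ennreal u < x} u \<partial>lborel)"
        using top by (intro nn_integral_mono mult_left_mono) (auto simp: indicator_def)
      finally show ?thesis .
    qed
    have "(\<integral>\<^sup>+u. layer_weight p u * indicator {u. ennreal u < x} u \<partial>lborel) = top"
      (is "?X = _")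
    proof (rule ccontr)
      assume "?X \<noteq> top"
      moreover from this have "?X + 1 \<le> ?X" by (intro *) simp
      ultimately show False by (cases ?X) (auto simp flip: ennreal_plus ennreal_1)
    qed
    then show ?thesis using top by simp
  qed
qed

lemma layer_cake:
  assumes p: "0 < p" and M: "sigma_finite_measure M" and [measurable]: "f \<in> borel_measurable M"
  shows "(\<integral>\<^sup>+y. ennpowr (f y) p \<partial>M) =
    (\<integral>\<^sup>+u. layer_weight p u * (\<integral>\<^sup>+y. indicator {y. ennreal u < f y} y \<partial>M) \<partial>lborel)"
proof -
  interpret M: sigma_finite_measure M by fact
  interpret P: pair_sigma_finite M lborel ..
  have [measurable]: "(\<lambda>(y, u). layer_weight p u * indicator {u. ennreal u < f y} u)
      \<in> borel_measurable (M \<Otimes>\<^sub>M lborel)"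
    by (simp add: indicator_def) measurable
  have "(\<integral>\<^sup>+y. ennpowr (f y) p \<partial>M) =
      (\<integral>\<^sup>+y. \<integral>\<^sup>+u. layer_weight p u * indicator {u. ennreal u < f y} u \<partial>lborel \<partial>M)"
    using p by (simp add: nn_integral_layer_weight)
  also have "\<dots> = (\<integral>\<^sup>+u. \<integral>\<^sup>+y. layer_weight p u * indicator {u. ennreal u < f y} u \<partial>M \<partial>lborel)"
    by (rule P.Fubini'[symmetric]) measurable
  also have "\<dots> = (\<integral>\<^sup>+u. layer_weight p u * (\<integral>\<^sup>+y. indicator {u. ennreal u < f y} u \<partial>M) \<partial>lborel)"
    by (intro nn_integral_cong nn_integral_cmult) (simp add: indicator_def)
  also have "\<dots> = (\<integral>\<^sup>+u. layer_weight p u * (\<integral>\<^sup>+y. indicator {y. ennreal u < f y} y \<partial>M) \<partial>lborel)"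
    by (intro nn_integral_cong arg_cong2[where f=times] refl) (simp split: split_indicator)
  finally show ?thesis .
qed

text \<open>A sequence of partitions of the line, level 0 being the coarsest, recorded by cell
  indices and lengths alone, so that both shifted grids are instances. Halving of the lengths gives
  the doubling property on which the stopping argument rests.\<close>

locale dyadic_filtration =
  fixes idx :: "nat \<Rightarrow> real \<Rightarrow> int" and len :: "nat \<Rightarrow> real"
  assumes idx_measurable [measurable]: "\<And>k. idx k \<in> measurable borel (count_space UNIV)"
    and len_pos: "0 < len k"
    and len_Suc: "len k = 2 * len (Suc k)"
    and emeasure_cell: "emeasure lborel {s. idx k s = idx k y} = ennreal (len k)"
    and nested: "idx (Suc k) s = idx (Suc k) y \<Longrightarrow> idx k s = idx k y"
begin

definition cond_avg :: "nat \<Rightarrow> (real \<Rightarrow> ennreal) \<Rightarrow> real \<Rightarrow> ennreal" where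
  "cond_avg k f y = (\<integral>\<^sup>+s. indicator {s. idx k s = idx k y} s * ennreal (1 / len k) * f s \<partial>lborel)"

text \<open>The finite range of levels makes the a priori finiteness in the good-\<lambda> argument
  available; the strong type constants do not depend on L.\<close>

definition max_avg :: "nat \<Rightarrow> (real \<Rightarrow> ennreal) \<Rightarrow> real \<Rightarrow> ennreal" where
  "max_avg L f y = (SUP k\<in>{..L}. cond_avg k f y)"

lemma nested_le: "j \<le> k \<Longrightarrow> idx k s = idx k y \<Longrightarrow> idx j s = idx j y"
  by (induction k) (auto simp: le_Suc_eq dest: nested)

lemma sets_cell [measurable, simp]: "{s. idx k s = c} \<in> sets borel"
  using measurable_sets[OF idx_measurable[of k], of "{c}"] by (simp add: vimage_def)

lemma measurable_cell [measurable]: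
  assumes [measurable]: "f \<in> borel_measurable M" "g \<in> borel_measurable M"
  shows "Measurable.pred M (\<lambda>x. idx k (f x) = idx k (g x))"
proof -
  have "(\<lambda>x. idx k (f x)) \<in> measurable M (count_space UNIV)" "(\<lambda>x. idx k (g x)) \<in> measurable M (count_space UNIV)"
    by measurable
  then show ?thesis by measurable
qed

lemma borel_measurable_cond_avg_param [measurable (raw)]:
  assumes [measurable]: "(\<lambda>(s, z). F s z) \<in> borel_measurable (borel \<Otimes>\<^sub>M Z)" "y \<in> borel_measurable Z"
  shows "(\<lambda>z. cond_avg k (\<lambda>s. F s z) (y z)) \<in> borel_measurable Z"
proof -
  have [measurable]: "(\<lambda>(z, s). F s z) \<in> borel_measurable (Z \<Otimes>\<^sub>M borel)"
    by measurable
  show ?thesis unfolding cond_avg_def indicator_def mem_Collect_eq by measurable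
qed

lemma borel_measurable_max_avg_param [measurable (raw)]:
  assumes [measurable]: "(\<lambda>(s, z). F s z) \<in> borel_measurable (borel \<Otimes>\<^sub>M Z)" "y \<in> borel_measurable Z"
  shows "(\<lambda>z. max_avg k (\<lambda>s. F s z) (y z)) \<in> borel_measurable Z"
  unfolding max_avg_def by measurable

lemma borel_measurable_cond_avg [measurable]:
  assumes [measurable]: "f \<in> borel_measurable borel"
  shows "cond_avg k f \<in> borel_measurable borel"
proof -
  have [measurable]: "(\<lambda>(s, z). f s) \<in> borel_measurable (borel \<Otimes>\<^sub>M (borel :: real measure))"
    by measurable
  show ?thesis by (rule borel_measurable_cond_avg_param[where F="\<lambda>s _. f s" and y="\<lambda>y. y"]) measurable
qed

lemma borel_measurable_max_avg [measurable]:
  assumes [measurable]: "f \<in> borel_measurable borel"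
  shows "max_avg k f \<in> borel_measurable borel"
proof -
  have "max_avg k f = (\<lambda>y. SUP j\<in>{..k}. cond_avg j f y)" by (simp add: max_avg_def fun_eq_iff)
  then show ?thesis by simp
qed

lemma cond_avg_mono: "(\<And>s. f s \<le> g s) \<Longrightarrow> cond_avg k f y \<le> cond_avg k g y"
  unfolding cond_avg_def by (intro nn_integral_mono mult_left_mono) auto

lemma cond_avg_cell: "idx k s = idx k y \<Longrightarrow> cond_avg k f s = cond_avg k f y"
  unfolding cond_avg_def by simp

lemma max_avg_cell: "idx k s = idx k y \<Longrightarrow> max_avg k f s = max_avg k f y"
  unfolding max_avg_def by (intro SUP_cong refl cond_avg_cell) (auto intro: nested_le)

lemma cond_avg_cong_cell: "(\<And>s. idx k s = idx k y \<Longrightarrow> f s = g s) \<Longrightarrow> cond_avg k f y = cond_avg k g y"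
  unfolding cond_avg_def by (intro nn_integral_cong) (auto simp: indicator_def)

lemma cond_avg_le_max_avg: "k \<le> L \<Longrightarrow> cond_avg k f y \<le> max_avg L f y"
  unfolding max_avg_def by (intro SUP_upper) auto

lemma max_avg_Suc: "max_avg (Suc L) f y = max (max_avg L f y) (cond_avg (Suc L) f y)"
  by (simp add: max_avg_def atMost_Suc sup_max max.commute)

lemma nn_integral_cell_inverse:
  "(\<integral>\<^sup>+s. indicator {s. idx k u = idx k s} s * ennreal (1 / len k) \<partial>lborel) = 1"
proof -
  have "{s. idx k u = idx k s} = {s. idx k s = idx k u}" by auto
  then show ?thesis
    using len_pos[of k] by (simp add: nn_integral_multc emeasure_cell ennreal_mult[symmetric])
qed

lemma cond_avg_const: "cond_avg k (\<lambda>_. c) y = c"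
proof -
  have "{s. idx k s = idx k y} = {s. idx k y = idx k s}" by auto
  then show ?thesis
    unfolding cond_avg_def by (subst nn_integral_multc) (measurable, simp add: nn_integral_cell_inverse)
qed

text \<open>Averaging is self-adjoint by Tonelli, and it leaves w unchanged because w is constant on
  the cells of level k.\<close>

lemma nn_integral_cond_avg_weight:
  assumes [measurable]: "f \<in> borel_measurable borel" "w \<in> borel_measurable borel"
    and w: "\<And>s y. idx k s = idx k y \<Longrightarrow> w s = w y"
  shows "(\<integral>\<^sup>+y. w y * cond_avg k f y \<partial>lborel) = (\<integral>\<^sup>+y. w y * f y \<partial>lborel)"
proof -
  have "(\<integral>\<^sup>+y. w y * cond_avg k f y \<partial>lborel) =
      (\<integral>\<^sup>+y. \<integral>\<^sup>+s. w y * (indicator {s. idx k s = idx k y} s * ennreal (1 / len k) * f s) \<partial>lborel \<partial>lborel)"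
    unfolding cond_avg_def by (intro nn_integral_cong nn_integral_cmult[symmetric]) measurable
  also have "\<dots> = (\<integral>\<^sup>+s. \<integral>\<^sup>+y. w y * (indicator {s. idx k s = idx k y} s * ennreal (1 / len k) * f s) \<partial>lborel \<partial>lborel)"
    unfolding indicator_def mem_Collect_eq by (rule lborel_pair.Fubini') measurable
  also have "\<dots> = (\<integral>\<^sup>+s. \<integral>\<^sup>+y. (w s * f s) * (indicator {y. idx k s = idx k y} y * ennreal (1 / len k)) \<partial>lborel \<partial>lborel)"
    by (intro nn_integral_cong) (auto simp: indicator_def ac_simps dest: w)
  also have "\<dots> = (\<integral>\<^sup>+s. (w s * f s) * 1 \<partial>lborel)"
    by (intro nn_integral_cong, subst nn_integral_cmult) (measurable, simp add: nn_integral_cell_inverse)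
  finally show ?thesis by simp
qed

text \<open>The normalised indicator of a coarse cell is constant on finer cells, hence an
  admissible weight in \<open>nn_integral_cond_avg_weight\<close>.\<close>

lemma cond_avg_tower:
  assumes [measurable]: "f \<in> borel_measurable borel" and jk: "j \<le> k"
  shows "cond_avg j (cond_avg k f) y = cond_avg j f y"
  unfolding cond_avg_def[of j]
  by (rule nn_integral_cond_avg_weight) (measurable, auto simp: indicator_def dest: nested_le[OF jk])

lemma cond_avg_Suc_le:
  assumes [measurable]: "f \<in> borel_measurable borel"
  shows "cond_avg (Suc k) f y \<le> 2 * cond_avg k f y"
proof -
  have "cond_avg (Suc k) f y \<le> (\<integral>\<^sup>+s. 2 * (indicator {s. idx k s = idx k y} s * ennreal (1 / len k) * f s) \<partial>lborel)"
    unfolding cond_avg_def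
  proof (intro nn_integral_mono)
    fix s
    have "ennreal (1 / len (Suc k)) = 2 * ennreal (1 / len k)"
      using len_pos[of k] len_pos[of "Suc k"]
      by (subst ennreal_numeral[symmetric], subst ennreal_mult[symmetric]) (auto simp: len_Suc[of k])
    then show "indicator {s. idx (Suc k) s = idx (Suc k) y} s * ennreal (1 / len (Suc k)) * f s
      \<le> 2 * (indicator {s. idx k s = idx k y} s * ennreal (1 / len k) * f s)"
      by (auto simp: indicator_def mult.assoc dest: nested)
  qed
  also have "\<dots> = 2 * cond_avg k f y"
    unfolding cond_avg_def by (rule nn_integral_cmult) measurable
  finally show ?thesis .
qed

section \<open>Doob's maximal inequalities\<close>

lemma cond_avg_add:
  assumes [measurable]: "f \<in> borel_measurable borel" "g \<in> borel_measurable borel"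
  shows "cond_avg k (\<lambda>s. f s + g s) y = cond_avg k f y + cond_avg k g y"
  unfolding cond_avg_def distrib_left by (intro nn_integral_add) measurable

text \<open>In the induction, the points that exceed c for the first time at level L + 1 form a
  union of cells of that level, on each of which the average of f exceeds c. Summing over the
  disjoint first-exceedance sets costs no constant.\<close>

lemma max_avg_weak_type:
  assumes [measurable]: "f \<in> borel_measurable borel"
  shows "c * (\<integral>\<^sup>+y. indicator {y. c < max_avg L f y} y \<partial>lborel)
    \<le> (\<integral>\<^sup>+y. indicator {y. c < max_avg L f y} y * f y \<partial>lborel)"
proof -
  have step: "c * (\<integral>\<^sup>+y. indicator A y \<partial>lborel) \<le> (\<integral>\<^sup>+y. indicator A y * f y \<partial>lborel)"
    if A[measurable]: "A \<in> sets borel" and Ac: "\<And>y. y \<in> A \<Longrightarrow> c < cond_avg k f y"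
      and Ak: "\<And>s y. idx k s = idx k y \<Longrightarrow> s \<in> A \<longleftrightarrow> y \<in> A" for A k
  proof -
    have "c * (\<integral>\<^sup>+y. indicator A y \<partial>lborel) = (\<integral>\<^sup>+y. c * indicator A y \<partial>lborel)"
      by (rule nn_integral_cmult[symmetric]) measurable
    also have "\<dots> \<le> (\<integral>\<^sup>+y. indicator A y * cond_avg k f y \<partial>lborel)"
      using Ac by (intro nn_integral_mono) (auto simp: indicator_def less_imp_le)
    also have "\<dots> = (\<integral>\<^sup>+y. indicator A y * f y \<partial>lborel)"
    proof (rule nn_integral_cond_avg_weight)
      show "indicator A s = (indicator A y :: ennreal)" if "idx k s = idx k y" for s y
        using Ak[OF that] by (simp add: indicator_def)
    qed measurable
    finally show ?thesis .
  qed
  show ?thesis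
  proof (induction L)
    case 0
    show ?case
    proof (rule step[of _ 0])
      show "s \<in> {y. c < max_avg 0 f y} \<longleftrightarrow> y \<in> {y. c < max_avg 0 f y}" if "idx 0 s = idx 0 y" for s y
        using max_avg_cell[OF that] by simp
      show "c < cond_avg 0 f y" if "y \<in> {y. c < max_avg 0 f y}" for y
        using that by (simp add: max_avg_def)
    qed measurable
  next
    case (Suc L)
    let ?A = "{y. c < max_avg L f y}" and ?B = "{y. \<not> c < max_avg L f y \<and> c < cond_avg (Suc L) f y}"
    have AB: "indicator {y. c < max_avg (Suc L) f y} y = (indicator ?A y + indicator ?B y :: ennreal)" for y
      by (auto simp: indicator_def max_avg_Suc less_max_iff_disj)
    have A_sets [measurable]: "?A \<in> sets borel" by measurable
    have "{y \<in> space borel. \<not> c < max_avg L f y \<and> c < cond_avg (Suc L) f y} \<in> sets borel"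
      by measurable
    then have B_sets [measurable]: "?B \<in> sets borel" by simp
    have "c * (\<integral>\<^sup>+y. indicator ?B y \<partial>lborel) \<le> (\<integral>\<^sup>+y. indicator ?B y * f y \<partial>lborel)"
    proof (rule step[of _ "Suc L"])
      show "s \<in> ?B \<longleftrightarrow> y \<in> ?B" if "idx (Suc L) s = idx (Suc L) y" for s y
        using cond_avg_cell[OF that] max_avg_cell[OF nested[OF that]] by simp
    qed (rule B_sets, simp)
    with Suc show ?case unfolding AB
      by (simp add: nn_integral_add distrib_left distrib_right add_mono del: nn_integral_indicator)
  qed
qed

text \<open>The part of f below c has averages at most c.\<close>

lemma max_avg_truncate:
  assumes [measurable]: "f \<in> borel_measurable borel"
  shows "max_avg L f y \<le> max_avg L (\<lambda>s. f s * indicator {s. c < f s} s) y + c"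
proof -
  have "cond_avg k f y \<le> max_avg L (\<lambda>s. f s * indicator {s. c < f s} s) y + c" if "k \<le> L" for k
  proof -
    have "cond_avg k f y \<le> cond_avg k (\<lambda>s. f s * indicator {s. c < f s} s + c) y"
      by (rule cond_avg_mono) (auto simp: indicator_def)
    also have "\<dots> = cond_avg k (\<lambda>s. f s * indicator {s. c < f s} s) y + c"
      by (subst cond_avg_add) (auto simp: cond_avg_const)
    finally show ?thesis using cond_avg_le_max_avg[OF that] by (meson add_right_mono order_trans)
  qed
  then show ?thesis unfolding max_avg_def[of L f] by (intro SUP_least) auto
qed

text \<open>The level set at u is estimated through the part of f above u / 2. This leaves f alone
  on the right-hand side, so no division by a possibly infinite norm of the maximal function occurs.
  Integrating the weight of exponent p - 1 up to 2 f gives (2 f)^(p-1), the origin of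
  \<open>2 powr (p - 1)\<close>.\<close>

theorem max_avg_strong_type:
  assumes p: "1 < p" and [measurable]: "f \<in> borel_measurable borel"
  shows "(\<integral>\<^sup>+y. ennpowr (max_avg L f y) p \<partial>lborel)
    \<le> ennreal (2 * p / (p - 1) * 2 powr (p - 1)) * (\<integral>\<^sup>+y. ennpowr (f y) p \<partial>lborel)"
proof -
  have level: "(\<integral>\<^sup>+y. indicator {y. ennreal u < max_avg L f y} y \<partial>lborel)
      \<le> ennreal (2 / u) * (\<integral>\<^sup>+y. f y * indicator {y. ennreal u < 2 * f y} y \<partial>lborel)"
    if l: "0 < u" for u
  proof -
    let ?c = "ennreal (u / 2)" and ?g = "\<lambda>s. f s * indicator {s. ennreal (u / 2) < f s} s"
    have half: "ennreal u = ?c + ?c" using l by (simp flip: ennreal_plus)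
    have "(\<integral>\<^sup>+y. indicator {y. ennreal u < max_avg L f y} y \<partial>lborel)
       \<le> (\<integral>\<^sup>+y. indicator {y. ?c < max_avg L ?g y} y \<partial>lborel)"
    proof (intro nn_integral_mono)
      fix y
      have "?c < max_avg L ?g y" if "ennreal u < max_avg L f y"
      proof (rule ccontr)
        assume "\<not> ?thesis"
        then have "max_avg L f y \<le> ?c + ?c"
          using max_avg_truncate[of f L y ?c] by (meson add_right_mono assms(2) not_less order_trans)
        then show False using that half by simp
      qed
      then show "indicator {y. ennreal u < max_avg L f y} y \<le> (indicator {y. ?c < max_avg L ?g y} y :: ennreal)"
        by (auto simp: indicator_def)
    qed
    also have "\<dots> = ennreal (2 / u) * (?c * (\<integral>\<^sup>+y. indicator {y. ?c < max_avg L ?g y} y \<partial>lborel))"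
      using l by (simp add: mult.assoc[symmetric] ennreal_mult[symmetric])
    also have "\<dots> \<le> ennreal (2 / u) * (\<integral>\<^sup>+y. indicator {y. ?c < max_avg L ?g y} y * ?g y \<partial>lborel)"
      by (intro mult_left_mono max_avg_weak_type) auto
    also have "\<dots> \<le> ennreal (2 / u) * (\<integral>\<^sup>+y. ?g y \<partial>lborel)"
      by (intro mult_left_mono nn_integral_mono) (auto simp: indicator_def)
    also have "{s. ?c < f s} = {y. ennreal u < 2 * f y}"
      using l
      apply (auto)
      subgoal for s by (cases "f s") (auto simp: ennreal_less_iff ennreal_mult_top simp flip: ennreal_numeral ennreal_mult)
      subgoal for s by (cases "f s") (auto simp: ennreal_less_iff ennreal_mult_top simp flip: ennreal_numeral ennreal_mult)
      done
    finally show ?thesis .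
  qed
  have "(\<integral>\<^sup>+y. ennpowr (max_avg L f y) p \<partial>lborel) =
      (\<integral>\<^sup>+u. layer_weight p u * (\<integral>\<^sup>+y. indicator {y. ennreal u < max_avg L f y} y \<partial>lborel) \<partial>lborel)"
    using p by (intro layer_cake) (auto intro: sigma_finite_lborel)
  also have "\<dots> \<le> (\<integral>\<^sup>+u. ennreal (2 * p / (p - 1)) * layer_weight (p - 1) u *
      (\<integral>\<^sup>+y. f y * indicator {y. ennreal u < 2 * f y} y \<partial>lborel) \<partial>lborel)"
  proof (intro nn_integral_mono)
    fix u :: real
    show "layer_weight p u * (\<integral>\<^sup>+y. indicator {y. ennreal u < max_avg L f y} y \<partial>lborel)
      \<le> ennreal (2 * p / (p - 1)) * layer_weight (p - 1) u *
        (\<integral>\<^sup>+y. f y * indicator {y. ennreal u < 2 * f y} y \<partial>lborel)"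
    proof (cases "0 < u")
      case True
      \<comment> \<open>The weak type factor 2 / u lowers the exponent of the weight from p to p -
        1; p / (p - 1) renormalises the density.\<close>
      have "layer_weight p u * ennreal (2 / u) = ennreal (2 * p / (p - 1)) * layer_weight (p - 1) u"
        using True p by (simp add: layer_weight_def ennreal_mult[symmetric] powr_diff powr_one field_simps power2_eq_square)
      then show ?thesis
        using mult_left_mono[OF level[OF True], of "layer_weight p u"] by (simp add: mult.assoc[symmetric])
    qed (simp add: layer_weight_def)
  qed
  also have "\<dots> = (\<integral>\<^sup>+u. \<integral>\<^sup>+y. ennreal (2 * p / (p - 1)) * layer_weight (p - 1) u *
       (f y * indicator {y. ennreal u < 2 * f y} y) \<partial>lborel \<partial>lborel)"
    by (intro nn_integral_cong nn_integral_cmult[symmetric]) measurable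
  also have "\<dots> = (\<integral>\<^sup>+y. \<integral>\<^sup>+u. ennreal (2 * p / (p - 1)) * layer_weight (p - 1) u *
       (f y * indicator {y. ennreal u < 2 * f y} y) \<partial>lborel \<partial>lborel)"
    unfolding indicator_def mem_Collect_eq by (rule lborel_pair.Fubini') measurable
  also have "\<dots> = (\<integral>\<^sup>+y. \<integral>\<^sup>+u. ennreal (2 * p / (p - 1)) * f y *
      (layer_weight (p - 1) u * indicator {u. ennreal u < 2 * f y} u) \<partial>lborel \<partial>lborel)"
    by (intro nn_integral_cong) (auto simp: indicator_def ac_simps)
  also have "\<dots> = (\<integral>\<^sup>+y. ennreal (2 * p / (p - 1)) * f y * ennpowr (2 * f y) (p - 1) \<partial>lborel)"
    using p by (intro nn_integral_cong, subst nn_integral_cmult)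
      (auto simp: nn_integral_layer_weight)
  also have "\<dots> = (\<integral>\<^sup>+y. ennreal (2 * p / (p - 1) * 2 powr (p - 1)) * ennpowr (f y) p \<partial>lborel)"
  proof (intro nn_integral_cong)
    fix y
    have "ennpowr (f y) p = f y * ennpowr (f y) (p - 1)"
      using p ennpowr_add[of 1 "p - 1" "f y"] by simp
    moreover have "ennpowr 2 (p - 1) = ennreal (2 powr (p - 1))"
      using ennpowr_ennreal[of 2 "p - 1"] by simp
    ultimately show "ennreal (2 * p / (p - 1)) * f y * ennpowr (2 * f y) (p - 1) =
        ennreal (2 * p / (p - 1) * 2 powr (p - 1)) * ennpowr (f y) p"
      using p by (subst ennreal_mult) (simp_all add: ennpowr_mult mult.assoc mult.left_commute)
  qed
  also have "\<dots> = ennreal (2 * p / (p - 1) * 2 powr (p - 1)) * (\<integral>\<^sup>+y. ennpowr (f y) p \<partial>lborel)"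
    by (rule nn_integral_cmult) measurable
  finally show ?thesis .
qed

end

section \<open>The good-\<open>\<lambda>\<close> inequality for function norms\<close>

text \<open>What the good-\<lambda> argument uses of a mixed norm in the variables z with the
  remaining coordinates frozen. Subadditivity is absent because it is a consequence of
  \<open>norm_integral\<close>. The scalar in \<open>norm_cmult\<close> may be infinite.\<close>

locale function_norm =
  fixes Z :: "'z measure" and N :: "('z \<Rightarrow> ennreal) \<Rightarrow> ennreal"
  assumes space_Z [simp]: "space Z = UNIV"
    and norm_mono: "(\<And>z. f z \<le> g z) \<Longrightarrow> N f \<le> N g"
    and norm_cmult: "f \<in> borel_measurable Z \<Longrightarrow> N (\<lambda>z. c * f z) = c * N f"
    and borel_measurable_norm:
      "(\<lambda>(y, z). F y z) \<in> borel_measurable (borel \<Otimes>\<^sub>M Z) \<Longrightarrow> (\<lambda>y::real. N (F y)) \<in> borel_measurable borel"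
    and norm_integral:
      "(\<lambda>(y, z). F y z) \<in> borel_measurable (borel \<Otimes>\<^sub>M Z) \<Longrightarrow>
        N (\<lambda>z. \<integral>\<^sup>+y. F y z \<partial>lborel) \<le> (\<integral>\<^sup>+y. N (F y) \<partial>(lborel :: real measure))"
begin

lemma norm_zero [simp]: "N (\<lambda>_. 0) = 0"
  using norm_cmult[of "\<lambda>_. 0" 0] by simp

text \<open>Realise the two summands as slices over \<open>[0, 1)\<close> and \<open>[1, 2)\<close> of one function.\<close>

lemma norm_add:
  assumes [measurable]: "f \<in> borel_measurable Z" "g \<in> borel_measurable Z"
  shows "N (\<lambda>z. f z + g z) \<le> N f + N g"
proof -
  let ?F = "\<lambda>(y::real) z. indicator {0..<1} y * f z + indicator {1..<2} y * g z"
  have F: "(\<lambda>(y, z). ?F y z) \<in> borel_measurable (borel \<Otimes>\<^sub>M Z)"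
    by measurable
  have one: "(\<integral>\<^sup>+y. indicator {a..<a + 1} y * c \<partial>lborel) = c" for a :: real and c
    by (subst nn_integral_multc) auto
  have "f z + g z = (\<integral>\<^sup>+y. ?F y z \<partial>lborel)" for z
    using one[of 0 "f z"] one[of 1 "g z"] by (subst nn_integral_add) auto
  then have "N (\<lambda>z. f z + g z) \<le> (\<integral>\<^sup>+y. N (?F y) \<partial>lborel)"
    using norm_integral[OF F] by simp
  also have "\<dots> = (\<integral>\<^sup>+y. indicator {0..<1::real} y * N f + indicator {1..<2} y * N g \<partial>lborel)"
    by (intro nn_integral_cong) (auto simp: indicator_def)
  also have "\<dots> = N f + N g"
    using one[of 0 "N f"] one[of 1 "N g"] by (subst nn_integral_add) auto
  finally show ?thesis .
qed

lemma norm_sum: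
  assumes "finite S" and f: "\<And>i. i \<in> S \<Longrightarrow> f i \<in> borel_measurable Z"
  shows "N (\<lambda>z. \<Sum>i\<in>S. f i z) \<le> (\<Sum>i\<in>S. N (f i))"
  using assms
proof (induction S rule: finite_induct)
  case (insert i S)
  have "N (\<lambda>z. \<Sum>j\<in>insert i S. f j z) = N (\<lambda>z. f i z + (\<Sum>j\<in>S. f j z))"
    using insert by simp
  also have "\<dots> \<le> N (f i) + N (\<lambda>z. \<Sum>j\<in>S. f j z)"
    using insert by (intro norm_add) auto
  also have "\<dots> \<le> N (f i) + (\<Sum>j\<in>S. N (f j))"
    using insert by (intro add_left_mono) auto
  finally show ?case using insert by simp
qed simp

end

locale dyadic_function_norm = dyadic_filtration idx len + function_norm Z N
  for idx len and Z :: "'z measure" and N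
begin

lemma measurable_slice:
  assumes "(\<lambda>(y, z). F y z) \<in> borel_measurable (borel \<Otimes>\<^sub>M Z)"
  shows "F y \<in> borel_measurable Z" "(\<lambda>y :: real. F y z) \<in> borel_measurable borel"
  using measurable_compose[OF measurable_Pair1' assms, of y]
    measurable_compose[OF measurable_Pair2' assms, of z] by simp_all

lemma norm_cond_avg_le:
  assumes F[measurable]: "(\<lambda>(y, z). F y z) \<in> borel_measurable (borel \<Otimes>\<^sub>M Z)"
  shows "N (\<lambda>z. cond_avg k (\<lambda>s. F s z) y) \<le> cond_avg k (\<lambda>s. N (F s)) y"
proof -
  have "N (\<lambda>z. cond_avg k (\<lambda>s. F s z) y)
      \<le> (\<integral>\<^sup>+s. N (\<lambda>z. indicator {s. idx k s = idx k y} s * ennreal (1 / len k) * F s z) \<partial>lborel)"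
    unfolding cond_avg_def by (intro norm_integral) measurable
  also have "\<dots> = (\<integral>\<^sup>+s. indicator {s. idx k s = idx k y} s * ennreal (1 / len k) * N (F s) \<partial>lborel)"
    by (intro nn_integral_cong norm_cmult measurable_slice[OF F])
  finally show ?thesis by (simp add: cond_avg_def)
qed

context
  fixes F :: "real \<Rightarrow> 'z \<Rightarrow> ennreal"
  assumes F [measurable]: "(\<lambda>(y, z). F y z) \<in> borel_measurable (borel \<Otimes>\<^sub>M Z)"
begin

lemmas F_slice [measurable] = measurable_slice[OF F]

lemma norm_F_measurable [measurable]: "(\<lambda>y. N (F y)) \<in> borel_measurable borel"
  by (rule borel_measurable_norm[OF F])

text \<open>The function \<open>F\<close>, averaged over the cell at the first level above \<open>k\<close> at which the average of
  \<open>N F\<close> exceeds \<open>c\<close>, or at level \<open>k + d\<close> if there is no such level.\<close>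

primrec stopped :: "ennreal \<Rightarrow> nat \<Rightarrow> nat \<Rightarrow> real \<Rightarrow> 'z \<Rightarrow> ennreal" where
  "stopped c 0 k y z = cond_avg k (\<lambda>s. F s z) y"
| "stopped c (Suc d) k y z =
     (if c < cond_avg (Suc k) (\<lambda>s. N (F s)) y then cond_avg (Suc k) (\<lambda>s. F s z) y
      else stopped c d (Suc k) y z)"

lemma cond_avg_F_measurable [measurable]:
  "(\<lambda>(y, z). cond_avg k (\<lambda>s. F s z) y) \<in> borel_measurable (borel \<Otimes>\<^sub>M Z)"
proof -
  have "(\<lambda>(s, p). F s (snd p)) \<in> borel_measurable (borel \<Otimes>\<^sub>M ((borel :: real measure) \<Otimes>\<^sub>M Z))"
    by measurable
  from borel_measurable_cond_avg_param[OF this, of fst] show ?thesis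
    by (simp add: case_prod_beta)
qed

lemma max_avg_F_measurable [measurable]:
  "(\<lambda>(y, z). max_avg k (\<lambda>s. F s z) y) \<in> borel_measurable (borel \<Otimes>\<^sub>M Z)"
proof -
  have "(\<lambda>(s, p). F s (snd p)) \<in> borel_measurable (borel \<Otimes>\<^sub>M ((borel :: real measure) \<Otimes>\<^sub>M Z))"
    by measurable
  from borel_measurable_max_avg_param[OF this, of fst] show ?thesis
    by (simp add: case_prod_beta)
qed

lemma stopped_measurable [measurable]:
  "(\<lambda>(y, z). stopped c d k y z) \<in> borel_measurable (borel \<Otimes>\<^sub>M Z)"
proof (induction d arbitrary: k)
  case 0
  show ?case using cond_avg_F_measurable by simp
next
  case (Suc d)
  note [measurable] = Suc
  have "(\<lambda>x. c < cond_avg (Suc k) (\<lambda>s. N (F s)) (fst x)) \<in> measurable (borel \<Otimes>\<^sub>M Z) (count_space UNIV)"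
    by measurable
  then show ?case unfolding stopped.simps case_prod_beta
    using cond_avg_F_measurable[of "Suc k"] Suc[of "Suc k"]
    by (intro measurable_If) (auto simp: case_prod_beta pred_def)
qed

text \<open>When a cell is selected, its parent still has an average of N F at most c, and halving a
  cell at most doubles the average. Without any selection the average at the last level is itself at
  most c.\<close>

lemma norm_stopped_le:
  "cond_avg k (\<lambda>s. N (F s)) y \<le> c \<Longrightarrow> N (stopped c d k y) \<le> 2 * c"
proof (induction d arbitrary: k)
  case 0
  have eq: "stopped c 0 k y = (\<lambda>z. cond_avg k (\<lambda>s. F s z) y)" by auto
  have "N (stopped c 0 k y) \<le> cond_avg k (\<lambda>s. N (F s)) y"
    unfolding eq by (rule norm_cond_avg_le[OF F])
  also have "\<dots> \<le> 2 * c" using 0 by (metis add_increasing mult_2 zero_le)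
  finally show ?case .
next
  case (Suc d)
  show ?case
  proof (cases "c < cond_avg (Suc k) (\<lambda>s. N (F s)) y")
    case True
    then have eq: "stopped c (Suc d) k y = (\<lambda>z. cond_avg (Suc k) (\<lambda>s. F s z) y)" by auto
    have "N (stopped c (Suc d) k y) \<le> cond_avg (Suc k) (\<lambda>s. N (F s)) y"
      unfolding eq by (rule norm_cond_avg_le[OF F])
    also have "\<dots> \<le> 2 * cond_avg k (\<lambda>s. N (F s)) y" by (rule cond_avg_Suc_le) measurable
    also have "\<dots> \<le> 2 * c" using Suc.prems by (rule mult_left_mono) simp
    finally show ?thesis .
  next
    case False
    then have "stopped c (Suc d) k y = stopped c d (Suc k) y" by auto
    then show ?thesis using False Suc.IH[of "Suc k"] by simp
  qed
qed

text \<open>Stopping replaces F by its averages over cells contained in a cell of level k, which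
  preserves the average over the larger cell by the tower property.\<close>

lemma cond_avg_stopped:
  "cond_avg k (\<lambda>s. stopped c d k s z) y = cond_avg k (\<lambda>s. F s z) y"
proof (induction d arbitrary: k y)
  case 0
  show ?case by (simp add: cond_avg_tower)
next
  case (Suc d)
  note [measurable] = measurable_slice(2)[OF stopped_measurable]
  have "cond_avg (Suc k) (\<lambda>s. stopped c (Suc d) k s z) u = cond_avg (Suc k) (\<lambda>s. F s z) u" for u
  proof (cases "c < cond_avg (Suc k) (\<lambda>s. N (F s)) u")
    case True
    then have "cond_avg (Suc k) (\<lambda>s. stopped c (Suc d) k s z) u =
        cond_avg (Suc k) (cond_avg (Suc k) (\<lambda>s. F s z)) u"
      by (intro cond_avg_cong_cell) (auto dest: cond_avg_cell[of _ _ _ "\<lambda>s. N (F s)"])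
    then show ?thesis by (simp add: cond_avg_tower)
  next
    case False
    then have "cond_avg (Suc k) (\<lambda>s. stopped c (Suc d) k s z) u =
        cond_avg (Suc k) (\<lambda>s. stopped c d (Suc k) s z) u"
      by (intro cond_avg_cong_cell) (auto dest: cond_avg_cell[of _ _ _ "\<lambda>s. N (F s)"])
    then show ?thesis by (simp add: Suc)
  qed
  then have eq: "cond_avg (Suc k) (\<lambda>s. stopped c (Suc d) k s z) = cond_avg (Suc k) (\<lambda>s. F s z)"
    by auto
  have "cond_avg k (\<lambda>s. stopped c (Suc d) k s z) y =
      cond_avg k (cond_avg (Suc k) (\<lambda>s. stopped c (Suc d) k s z)) y"
    by (rule cond_avg_tower[symmetric]) (rule measurable_slice(2)[OF stopped_measurable], simp)
  also have "\<dots> = cond_avg k (\<lambda>s. F s z) y"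
    unfolding eq by (rule cond_avg_tower) (rule F_slice, simp)
  finally show ?case .
qed

text \<open>As long as no average of N F on the way down to level m exceeds c, no stopping occurs on
  the level m cell of y. Inside that cell the construction behaves as if started at level m, where
  \<open>cond_avg_stopped\<close> applies.\<close>

lemma cond_avg_stopped_above:
  assumes "k \<le> m" "m \<le> k + d" "\<And>i. k < i \<Longrightarrow> i \<le> m \<Longrightarrow> cond_avg i (\<lambda>s. N (F s)) y \<le> c"
  shows "cond_avg m (\<lambda>s. stopped c d k s z) y = cond_avg m (\<lambda>s. F s z) y"
  using assms
proof (induction d arbitrary: k)
  case 0
  then have "m = k" by simp
  then show ?case using cond_avg_stopped[where d=0] by simp
next
  case (Suc d)
  show ?case
  proof (cases "m = k")
    case True
    then show ?thesis using cond_avg_stopped[where d="Suc d"] by simp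
  next
    case False
    then have "Suc k \<le> m" using Suc.prems by simp
    have "cond_avg (Suc k) (\<lambda>s. N (F s)) s \<le> c" if "idx m s = idx m y" for s
      using cond_avg_cell[OF nested_le[OF \<open>Suc k \<le> m\<close> that], of "\<lambda>s. N (F s)"]
        Suc.prems(3)[of "Suc k"] \<open>Suc k \<le> m\<close> by simp
    then have "cond_avg m (\<lambda>s. stopped c (Suc d) k s z) y = cond_avg m (\<lambda>s. stopped c d (Suc k) s z) y"
      by (intro cond_avg_cong_cell) (auto simp: not_less[symmetric])
    also have "\<dots> = cond_avg m (\<lambda>s. F s z) y"
      using Suc.prems \<open>Suc k \<le> m\<close> by (intro Suc.IH) auto
    finally show ?thesis .
  qed
qed

text \<open>The cut-off makes this function bounded by 2 c in norm and supported in a level set of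
  the maximal function, so that its p0-th power integral is controlled by the measure of that set.
  The condition at level 0 replaces the missing parent of the coarsest cells.\<close>

definition stopped_part :: "nat \<Rightarrow> ennreal \<Rightarrow> ennreal \<Rightarrow> real \<Rightarrow> 'z \<Rightarrow> ennreal" where
  "stopped_part L c l y z =
     indicator {y. cond_avg 0 (\<lambda>s. N (F s)) y \<le> c \<and> l < N (\<lambda>z. max_avg L (\<lambda>s. F s z) y)} y
       * stopped c L 0 y z"

lemma norm_max_avg_measurable [measurable]:
  "(\<lambda>y. N (\<lambda>z. max_avg L (\<lambda>s. F s z) y)) \<in> borel_measurable borel"
  by (rule borel_measurable_norm) measurable

lemma stopped_part_measurable [measurable]:
  "(\<lambda>(y, z). stopped_part L c l y z) \<in> borel_measurable (borel \<Otimes>\<^sub>M Z)"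
proof -
  have "{y \<in> space borel. cond_avg 0 (\<lambda>s. N (F s)) y \<le> c \<and> l < N (\<lambda>z. max_avg L (\<lambda>s. F s z) y)} \<in> sets borel"
    by measurable
  then have [measurable]: "{y. cond_avg 0 (\<lambda>s. N (F s)) y \<le> c \<and> l < N (\<lambda>z. max_avg L (\<lambda>s. F s z) y)} \<in> sets borel"
    by simp
  show ?thesis unfolding stopped_part_def by measurable
qed

lemma norm_stopped_part_le:
  "N (stopped_part L c l y) \<le> 2 * c * indicator {y. l < N (\<lambda>z. max_avg L (\<lambda>s. F s z) y)} y"
proof -
  have eq: "stopped_part L c l y =
    (\<lambda>z. indicator {y. cond_avg 0 (\<lambda>s. N (F s)) y \<le> c \<and> l < N (\<lambda>z. max_avg L (\<lambda>s. F s z) y)} y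
       * stopped c L 0 y z)"
    by (simp add: stopped_part_def fun_eq_iff)
  have "N (stopped_part L c l y) = indicator {y. cond_avg 0 (\<lambda>s. N (F s)) y \<le> c \<and> l < N (\<lambda>z. max_avg L (\<lambda>s. F s z) y)} y
       * N (stopped c L 0 y)"
    unfolding eq by (intro norm_cmult measurable_slice[OF stopped_measurable])
  also have "\<dots> \<le> 2 * c * indicator {y. l < N (\<lambda>z. max_avg L (\<lambda>s. F s z) y)} y"
    using norm_stopped_le[of 0 y c L] by (auto simp: indicator_def)
  finally show ?thesis .
qed

text \<open>Before the first level \<open>k\<close> at which the maximal function over levels \<open>\<le> k\<close> has norm \<open>> l\<close>,
  the averages contribute at most \<open>l\<close>. From level \<open>k\<close> on, the averages of \<open>F\<close> and of its stopped part
  agree, since the cell of \<open>y\<close> lies in \<open>{N (max_avg L F) > l}\<close>.\<close>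

lemma norm_max_avg_stopped_part:
  assumes l: "l \<noteq> top" "2 * l < N (\<lambda>z. max_avg L (\<lambda>s. F s z) y)"
    and c: "max_avg L (\<lambda>s. N (F s)) y \<le> c"
  shows "l < N (\<lambda>z. max_avg L (\<lambda>s. stopped_part L c l s z) y)"
proof -
  define k where "k = (LEAST k. l < N (\<lambda>z. max_avg k (\<lambda>s. F s z) y))"
  have "l \<le> 2 * l" by (metis add_increasing mult_2 order_refl zero_le)
  then have L: "l < N (\<lambda>z. max_avg L (\<lambda>s. F s z) y)" using l by simp
  then have k: "l < N (\<lambda>z. max_avg k (\<lambda>s. F s z) y)" and kL: "k \<le> L"
    unfolding k_def by (rule LeastI, rule Least_le)
  have cavg: "cond_avg i (\<lambda>s. N (F s)) y \<le> c" if "i \<le> L" for i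
    using cond_avg_le_max_avg[OF that] c by (rule order_trans)
  have "l < N (\<lambda>z. max_avg L (\<lambda>s. F s z) s)" if s: "idx k s = idx k y" for s
  proof -
    have "l < N (\<lambda>z. max_avg k (\<lambda>s. F s z) s)" using k max_avg_cell[OF s] by simp
    also have "\<dots> \<le> N (\<lambda>z. max_avg L (\<lambda>s. F s z) s)"
      using kL by (intro norm_mono) (auto simp: max_avg_def intro!: SUP_subset_mono)
    finally show ?thesis .
  qed
  moreover have "cond_avg 0 (\<lambda>s. N (F s)) s \<le> c" if s: "idx k s = idx k y" for s
    using cavg[of 0] cond_avg_cell[OF nested_le[of 0 k, OF _ s]] by simp
  ultimately have cell: "stopped_part L c l s z = stopped c L 0 s z" if s: "idx k s = idx k y" for s z
    using s by (simp add: stopped_part_def)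
  have eq: "cond_avg j (\<lambda>s. stopped_part L c l s z) y = cond_avg j (\<lambda>s. F s z) y"
    if "k \<le> j" "j \<le> L" for j z
  proof -
    have "cond_avg j (\<lambda>s. stopped_part L c l s z) y = cond_avg j (\<lambda>s. stopped c L 0 s z) y"
      by (intro cond_avg_cong_cell cell nested_le[OF that(1)])
    also have "\<dots> = cond_avg j (\<lambda>s. F s z) y"
      using that cavg by (intro cond_avg_stopped_above) auto
    finally show ?thesis .
  qed
  define H where "H z = (if k = 0 then 0 else max_avg (k - 1) (\<lambda>s. F s z) y)" for z
  have H: "N H \<le> l" "H \<in> borel_measurable Z"
  proof -
    show "H \<in> borel_measurable Z"
      using measurable_slice(1)[OF max_avg_F_measurable, of "k - 1" y] by (auto simp: H_def[abs_def])
    show "N H \<le> l"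
    proof (cases "k = 0")
      case False
      then have "\<not> l < N (\<lambda>z. max_avg (k - 1) (\<lambda>s. F s z) y)"
        using not_less_Least[of "k - 1" "\<lambda>k. l < N (\<lambda>z. max_avg k (\<lambda>s. F s z) y)"]
        unfolding k_def[symmetric] by simp
      then show ?thesis using False by (simp add: H_def[abs_def])
    qed (simp add: H_def[abs_def])
  qed
  have "max_avg L (\<lambda>s. F s z) y \<le> H z + max_avg L (\<lambda>s. stopped_part L c l s z) y" for z
    unfolding max_avg_def[of L "\<lambda>s. F s z"]
  proof (rule SUP_least)
    fix j assume "j \<in> {..L}"
    show "cond_avg j (\<lambda>s. F s z) y \<le> H z + max_avg L (\<lambda>s. stopped_part L c l s z) y"
    proof (cases "k \<le> j")
      case True
      then have "cond_avg j (\<lambda>s. F s z) y \<le> max_avg L (\<lambda>s. stopped_part L c l s z) y"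
        using \<open>j \<in> {..L}\<close> eq[of j z] cond_avg_le_max_avg[of j L "\<lambda>s. stopped_part L c l s z" y] by simp
      then show ?thesis by (simp add: add_increasing)
    next
      case False
      then have "cond_avg j (\<lambda>s. F s z) y \<le> H z"
        unfolding H_def by (auto intro!: cond_avg_le_max_avg)
      then show ?thesis by (simp add: add_increasing2)
    qed
  qed
  then have "N (\<lambda>z. max_avg L (\<lambda>s. F s z) y) \<le> N (\<lambda>z. H z + max_avg L (\<lambda>s. stopped_part L c l s z) y)"
    by (rule norm_mono)
  also have "\<dots> \<le> N H + N (\<lambda>z. max_avg L (\<lambda>s. stopped_part L c l s z) y)"
  proof (intro norm_add H)
    have "(\<lambda>(s, z). stopped_part L c l s z) \<in> borel_measurable (borel \<Otimes>\<^sub>M Z)" by measurable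
    from borel_measurable_max_avg_param[OF this, of "\<lambda>_. y"]
    show "(\<lambda>z. max_avg L (\<lambda>s. stopped_part L c l s z) y) \<in> borel_measurable Z" by simp
  qed
  also have "\<dots> \<le> l + N (\<lambda>z. max_avg L (\<lambda>s. stopped_part L c l s z) y)"
    by (intro add_right_mono H)
  finally have "l + l < l + N (\<lambda>z. max_avg L (\<lambda>s. stopped_part L c l s z) y)"
    using l(2) unfolding mult_2 by (rule less_le_trans[rotated])
  then show ?thesis using l(1) by (simp add: ennreal_add_left_cancel_less)
qed

text \<open>Outside this context, the rules about \<open>F\<close> would match every function and make \<open>measurable\<close> loop.\<close>

declare F_slice [measurable del] norm_F_measurable [measurable del]
  cond_avg_F_measurable [measurable del] max_avg_F_measurable [measurable del] stopped_measurable [measurable del]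
  norm_max_avg_measurable [measurable del] stopped_part_measurable [measurable del]

end

end

lemma ennreal_le_half_add_imp_le:
  fixes x r :: ennreal
  assumes "x \<le> ennreal (1 / 2) * x + r" "x \<noteq> top"
  shows "x \<le> 2 * r"
proof (cases r)
  case (real s)
  obtain t where t: "x = ennreal t" "0 \<le> t" using assms(2) by (cases x) auto
  define c :: real where "c = 1 / 2"
  have "x \<le> ennreal c * x + r" "0 \<le> c" using assms(1) unfolding c_def by simp_all
  then have "ennreal t \<le> ennreal (c * t + s)"
    using t real by (simp add: ennreal_mult[symmetric] ennreal_plus[symmetric] del: ennreal_plus)
  then have "t \<le> 2 * s" using t real by (subst (asm) ennreal_le_iff) (auto simp: c_def)
  then have "ennreal t \<le> ennreal (2 * s)" by (rule ennreal_leI)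
  then show ?thesis using t real by (simp add: ennreal_mult)
qed (simp add: ennreal_mult_top)

context dyadic_function_norm
begin

text \<open>A crude bound with a factor depending on L. It serves to establish finiteness before the
  absorption, so the factor enters no final constant.\<close>

lemma norm_max_avg_le_max_avg_norm:
  assumes F [measurable]: "(\<lambda>(y, z). F y z) \<in> borel_measurable (borel \<Otimes>\<^sub>M Z)"
  shows "N (\<lambda>z. max_avg L (\<lambda>s. F s z) y) \<le> of_nat (Suc L) * max_avg L (\<lambda>s. N (F s)) y"
proof -
  have meas: "(\<lambda>z. cond_avg k (\<lambda>s. F s z) y) \<in> borel_measurable Z" for k
    using measurable_slice(1)[OF cond_avg_F_measurable[OF F], of k y] .
  have "N (\<lambda>z. max_avg L (\<lambda>s. F s z) y) \<le> N (\<lambda>z. \<Sum>k\<le>L. cond_avg k (\<lambda>s. F s z) y)"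
    unfolding max_avg_def
    by (intro norm_mono SUP_least) (auto intro!: member_le_sum)
  also have "\<dots> \<le> (\<Sum>k\<le>L. N (\<lambda>z. cond_avg k (\<lambda>s. F s z) y))"
    by (intro norm_sum meas) simp
  also have "\<dots> \<le> (\<Sum>k\<le>L. max_avg L (\<lambda>s. N (F s)) y)"
    by (intro sum_mono order_trans[OF norm_cond_avg_le[OF F] cond_avg_le_max_avg]) simp
  finally show ?thesis by simp
qed

text \<open>On the left-hand set the maximal function of the stopped part has norm above u, whereas
  the stopped part itself has norm at most 2 \<gamma> u and lives on the right-hand set. Chebyshev's
  inequality and the bound at p0 compare the measures of the two sets; the gain is (2
  \<gamma>)^p0.\<close>

lemma good_lambda:
  assumes p0: "0 < p0" and g: "0 < \<gamma>" and B: "0 \<le> B" and u: "0 < u"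
    and bound: "\<And>F. (\<lambda>(y, z). F y z) \<in> borel_measurable (borel \<Otimes>\<^sub>M Z) \<Longrightarrow>
      (\<integral>\<^sup>+y. ennpowr (N (\<lambda>z. max_avg L (\<lambda>s. F s z) y)) p0 \<partial>lborel)
        \<le> ennreal B * (\<integral>\<^sup>+y. ennpowr (N (F y)) p0 \<partial>lborel)"
    and F [measurable]: "(\<lambda>(y, z). F y z) \<in> borel_measurable (borel \<Otimes>\<^sub>M Z)"
  shows "(\<integral>\<^sup>+y. indicator {y. 2 * ennreal u < N (\<lambda>z. max_avg L (\<lambda>s. F s z) y)
          \<and> max_avg L (\<lambda>s. N (F s)) y \<le> ennreal (\<gamma> * u)} y \<partial>lborel)
    \<le> ennreal (B * (2 * \<gamma>) powr p0) *
        (\<integral>\<^sup>+y. indicator {y. ennreal u < N (\<lambda>z. max_avg L (\<lambda>s. F s z) y)} y \<partial>lborel)"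
    (is "?A \<le> _ * ?D")
proof -
  let ?G = "stopped_part F L (ennreal (\<gamma> * u)) (ennreal u)"
  note [measurable] = norm_max_avg_measurable[OF F] norm_F_measurable[OF F]
  have G: "(\<lambda>(y, z). ?G y z) \<in> borel_measurable (borel \<Otimes>\<^sub>M Z)"
    by (rule stopped_part_measurable[OF F])
  let ?l = "ennreal (u powr p0)"
  have "?l * ?A = (\<integral>\<^sup>+y. ?l * indicator {y. 2 * ennreal u < N (\<lambda>z. max_avg L (\<lambda>s. F s z) y)
          \<and> max_avg L (\<lambda>s. N (F s)) y \<le> ennreal (\<gamma> * u)} y \<partial>lborel)"
    unfolding indicator_def mem_Collect_eq
    by (rule nn_integral_cmult[symmetric]) measurable
  also have "\<dots> \<le> (\<integral>\<^sup>+y. ennpowr (N (\<lambda>z. max_avg L (\<lambda>s. ?G s z) y)) p0 \<partial>lborel)"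
  proof (intro nn_integral_mono)
    fix y
    have "?l \<le> ennpowr (N (\<lambda>z. max_avg L (\<lambda>s. ?G s z) y)) p0"
      if "2 * ennreal u < N (\<lambda>z. max_avg L (\<lambda>s. F s z) y)" "max_avg L (\<lambda>s. N (F s)) y \<le> ennreal (\<gamma> * u)"
      using norm_max_avg_stopped_part[OF F _ that] p0 u
        ennpowr_mono[of "ennreal u" "N (\<lambda>z. max_avg L (\<lambda>s. ?G s z) y)" p0]
      by (simp add: ennpowr_ennreal)
    then show "?l * indicator {y. 2 * ennreal u < N (\<lambda>z. max_avg L (\<lambda>s. F s z) y)
          \<and> max_avg L (\<lambda>s. N (F s)) y \<le> ennreal (\<gamma> * u)} y
        \<le> ennpowr (N (\<lambda>z. max_avg L (\<lambda>s. ?G s z) y)) p0"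
      by (auto simp: indicator_def)
  qed
  also have "\<dots> \<le> ennreal B * (\<integral>\<^sup>+y. ennpowr (N (?G y)) p0 \<partial>lborel)"
    by (rule bound[OF G])
  also have "\<dots> \<le> ennreal B * (\<integral>\<^sup>+y. ennreal ((2 * \<gamma> * u) powr p0) *
      indicator {y. ennreal u < N (\<lambda>z. max_avg L (\<lambda>s. F s z) y)} y \<partial>lborel)"
  proof (intro mult_left_mono nn_integral_mono)
    fix y
    have "ennpowr (N (?G y)) p0 \<le> ennpowr (2 * ennreal (\<gamma> * u) * indicator {y. ennreal u < N (\<lambda>z. max_avg L (\<lambda>s. F s z) y)} y) p0"
      using p0 by (intro ennpowr_mono norm_stopped_part_le[OF F]) auto
    also have "2 * ennreal (\<gamma> * u) = ennreal (2 * \<gamma> * u)"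
      using g u by (simp add: ennreal_mult mult.assoc)
    also have "ennpowr (ennreal (2 * \<gamma> * u) * indicator {y. ennreal u < N (\<lambda>z. max_avg L (\<lambda>s. F s z) y)} y) p0
       = ennreal ((2 * \<gamma> * u) powr p0) * indicator {y. ennreal u < N (\<lambda>z. max_avg L (\<lambda>s. F s z) y)} y"
      using g u p0 by (auto simp: ennpowr_ennreal indicator_def)
    finally show "ennpowr (N (?G y)) p0 \<le> ennreal ((2 * \<gamma> * u) powr p0) *
      indicator {y. ennreal u < N (\<lambda>z. max_avg L (\<lambda>s. F s z) y)} y" .
  qed simp
  also have "\<dots> = ennreal B * (ennreal ((2 * \<gamma> * u) powr p0) * ?D)"
    unfolding indicator_def mem_Collect_eq
    by (subst nn_integral_cmult) measurable
  also have "\<dots> = ?l * (ennreal (B * (2 * \<gamma>) powr p0) * ?D)"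
    using g u B by (simp add: powr_mult ennreal_mult ac_simps)
  finally have "?l * ?A \<le> ?l * (ennreal (B * (2 * \<gamma>) powr p0) * ?D)" .
  then have "ennreal (1 / (u powr p0)) * (?l * ?A) \<le> ennreal (1 / (u powr p0)) * (?l * (ennreal (B * (2 * \<gamma>) powr p0) * ?D))"
    by (rule mult_left_mono) simp
  moreover have "ennreal (1 / (u powr p0)) * ?l = 1"
    using u by (simp add: ennreal_mult[symmetric])
  ultimately show ?thesis
    by (simp only: mult.assoc[symmetric] mult_1_left)
qed

text \<open>The good-\<lambda> inequality is integrated against q u^(q-1). The smallness of \<gamma>
  lets the first term be absorbed, for q on either side of p0, and the second involves the scalar
  maximal function of N F, to which Doob's inequality applies at exponent q.\<close>

theorem norm_max_avg_exponent_change: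
  assumes p0: "0 < p0" and g: "0 < \<gamma>" and B: "0 \<le> B" and q: "1 < q"
    and small: "2 powr q * (B * (2 * \<gamma>) powr p0) \<le> 1 / 2"
    and bound: "\<And>F. (\<lambda>(y, z). F y z) \<in> borel_measurable (borel \<Otimes>\<^sub>M Z) \<Longrightarrow>
      (\<integral>\<^sup>+y. ennpowr (N (\<lambda>z. max_avg L (\<lambda>s. F s z) y)) p0 \<partial>lborel)
        \<le> ennreal B * (\<integral>\<^sup>+y. ennpowr (N (F y)) p0 \<partial>lborel)"
    and F [measurable]: "(\<lambda>(y, z). F y z) \<in> borel_measurable (borel \<Otimes>\<^sub>M Z)"
  shows "(\<integral>\<^sup>+y. ennpowr (N (\<lambda>z. max_avg L (\<lambda>s. F s z) y)) q \<partial>lborel)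
    \<le> ennreal (2 * (2 powr q * (1 / \<gamma>) powr q * (2 * q / (q - 1) * 2 powr (q - 1))))
       * (\<integral>\<^sup>+y. ennpowr (N (F y)) q \<partial>lborel)"
proof -
  note [measurable] = norm_max_avg_measurable[OF F] norm_F_measurable[OF F]
  define Y where "Y y = N (\<lambda>z. max_avg L (\<lambda>s. F s z) y)" for y
  define W where "W y = max_avg L (\<lambda>s. N (F s)) y" for y
  have [measurable]: "Y \<in> borel_measurable borel" "W \<in> borel_measurable borel"
    unfolding Y_def[abs_def] W_def[abs_def] by measurable
  define \<epsilon> where "\<epsilon> = B * (2 * \<gamma>) powr p0"
  have e0: "0 \<le> \<epsilon>" using B by (simp add: \<epsilon>_def)
  let ?C = "2 * q / (q - 1) * 2 powr (q - 1)"
  have C0: "0 \<le> ?C" using q by simp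
  define X where "X = (\<integral>\<^sup>+y. ennpowr (Y y) q \<partial>lborel)"
  define V where "V = (\<integral>\<^sup>+y. ennpowr (W y) q \<partial>lborel)"
  have V: "V \<le> ennreal ?C * (\<integral>\<^sup>+y. ennpowr (N (F y)) q \<partial>lborel)"
    unfolding V_def W_def by (intro max_avg_strong_type q) measurable
  \<comment> \<open>The level set of Y / 2 at u is {2 u < Y}, the set of the good-\<lambda>
    inequality. The factor lost by halving is restored afterwards through
    \<open>2 powr q\<close>.\<close>
  have "(\<integral>\<^sup>+y. ennpowr (ennreal (1 / 2) * Y y) q \<partial>lborel) =
      (\<integral>\<^sup>+u. layer_weight q u * (\<integral>\<^sup>+y. indicator {y. ennreal u < ennreal (1 / 2) * Y y} y \<partial>lborel) \<partial>lborel)"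
    using q by (intro layer_cake sigma_finite_lborel) auto
  also have "\<dots> \<le> (\<integral>\<^sup>+u. ennreal \<epsilon> * (layer_weight q u * (\<integral>\<^sup>+y. indicator {y. ennreal u < Y y} y \<partial>lborel)) +
      layer_weight q u * (\<integral>\<^sup>+y. indicator {y. ennreal u < ennreal (1 / \<gamma>) * W y} y \<partial>lborel) \<partial>lborel)"
  proof (intro nn_integral_mono)
    fix u :: real
    show "layer_weight q u * (\<integral>\<^sup>+y. indicator {y. ennreal u < ennreal (1 / 2) * Y y} y \<partial>lborel)
      \<le> ennreal \<epsilon> * (layer_weight q u * (\<integral>\<^sup>+y. indicator {y. ennreal u < Y y} y \<partial>lborel)) +
        layer_weight q u * (\<integral>\<^sup>+y. indicator {y. ennreal u < ennreal (1 / \<gamma>) * W y} y \<partial>lborel)"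
    proof (cases "0 < u")
      case True
      have "(\<integral>\<^sup>+y. indicator {y. ennreal u < ennreal (1 / 2) * Y y} y \<partial>lborel)
        \<le> (\<integral>\<^sup>+y. indicator {y. 2 * ennreal u < Y y \<and> W y \<le> ennreal (\<gamma> * u)} y +
            indicator {y. ennreal u < ennreal (1 / \<gamma>) * W y} y \<partial>lborel)"
      proof (intro nn_integral_mono)
        fix y
        have 1: "2 * ennreal u < Y y" if "ennreal u < ennreal (1 / 2) * Y y"
        proof (cases "Y y")
          case (real r)
          have "ennreal u < ennreal (1 / 2 * r)"
            using that real by (subst ennreal_mult) simp_all
          then have "2 * u < r" using True by (simp add: ennreal_less_iff)
          then have "ennreal (2 * u) < Y y" using True real by (simp add: ennreal_less_iff)
          then show ?thesis using True by (simp add: ennreal_mult)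
        qed (simp add: ennreal_mult_less_top)
        have 2: "ennreal u < ennreal (1 / \<gamma>) * W y" if "\<not> W y \<le> ennreal (\<gamma> * u)"
        proof (cases "W y")
          case (real r)
          then show ?thesis using that True g
            by (simp add: ennreal_mult[symmetric] ennreal_less_iff field_simps)
        next
          case top
          then show ?thesis using g by (simp add: ennreal_mult_top)
        qed
        show "indicator {y. ennreal u < ennreal (1 / 2) * Y y} y
          \<le> (indicator {y. 2 * ennreal u < Y y \<and> W y \<le> ennreal (\<gamma> * u)} y +
            indicator {y. ennreal u < ennreal (1 / \<gamma>) * W y} y :: ennreal)"
          using 1 2 by (auto simp: indicator_def)
      qed
      also have "\<dots> = (\<integral>\<^sup>+y. indicator {y. 2 * ennreal u < Y y \<and> W y \<le> ennreal (\<gamma> * u)} y \<partial>lborel) +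
            (\<integral>\<^sup>+y. indicator {y. ennreal u < ennreal (1 / \<gamma>) * W y} y \<partial>lborel)"
        unfolding indicator_def mem_Collect_eq by (rule nn_integral_add) measurable
      also have "\<dots> \<le> ennreal \<epsilon> * (\<integral>\<^sup>+y. indicator {y. ennreal u < Y y} y \<partial>lborel) +
            (\<integral>\<^sup>+y. indicator {y. ennreal u < ennreal (1 / \<gamma>) * W y} y \<partial>lborel)"
        unfolding Y_def W_def \<epsilon>_def
        by (intro add_right_mono good_lambda[OF p0 g B True bound F])
      finally show ?thesis
        using mult_left_mono[of _ _ "layer_weight q u"] by (fastforce simp: distrib_left mult.left_commute)
    qed (simp add: layer_weight_def)
  qed
  also have "\<dots> = (\<integral>\<^sup>+u. ennreal \<epsilon> * (layer_weight q u * (\<integral>\<^sup>+y. indicator {y. ennreal u < Y y} y \<partial>lborel)) \<partial>lborel) +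
      (\<integral>\<^sup>+u. layer_weight q u * (\<integral>\<^sup>+y. indicator {y. ennreal u < ennreal (1 / \<gamma>) * W y} y \<partial>lborel) \<partial>lborel)"
    unfolding indicator_def mem_Collect_eq by (rule nn_integral_add) measurable
  also have "(\<integral>\<^sup>+u. ennreal \<epsilon> * (layer_weight q u * (\<integral>\<^sup>+y. indicator {y. ennreal u < Y y} y \<partial>lborel)) \<partial>lborel)
     = ennreal \<epsilon> * (\<integral>\<^sup>+u. layer_weight q u * (\<integral>\<^sup>+y. indicator {y. ennreal u < Y y} y \<partial>lborel) \<partial>lborel)"
    unfolding indicator_def mem_Collect_eq by (rule nn_integral_cmult) measurable
  also have "(\<integral>\<^sup>+u. layer_weight q u * (\<integral>\<^sup>+y. indicator {y. ennreal u < Y y} y \<partial>lborel) \<partial>lborel) = X"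
    unfolding X_def using q by (intro layer_cake[symmetric] sigma_finite_lborel) auto
  also have "(\<integral>\<^sup>+u. layer_weight q u * (\<integral>\<^sup>+y. indicator {y. ennreal u < ennreal (1 / \<gamma>) * W y} y \<partial>lborel) \<partial>lborel)
      = (\<integral>\<^sup>+y. ennpowr (ennreal (1 / \<gamma>) * W y) q \<partial>lborel)"
    using q by (intro layer_cake[symmetric] sigma_finite_lborel) auto
  also have "\<dots> = ennreal ((1 / \<gamma>) powr q) * V"
    unfolding V_def using q g
    by (subst nn_integral_cmult[symmetric]) (auto simp: ennpowr_mult ennpowr_ennreal)
  also have "(\<integral>\<^sup>+y. ennpowr (ennreal (1 / 2) * Y y) q \<partial>lborel) = ennreal ((1 / 2) powr q) * X"
    unfolding X_def using q ennpowr_ennreal[of "1 / 2" q]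
    by (subst nn_integral_cmult[symmetric]) (auto simp: ennpowr_mult)
  finally have "ennreal (2 powr q) * (ennreal ((1 / 2) powr q) * X)
      \<le> ennreal (2 powr q) * (ennreal \<epsilon> * X + ennreal ((1 / \<gamma>) powr q) * V)"
    by (rule mult_left_mono) simp
  moreover have "ennreal (2 powr q) * ennreal ((1 / 2) powr q) = 1"
    by (simp add: ennreal_mult[symmetric] powr_mult[symmetric])
  moreover have "ennreal (2 powr q) * (ennreal \<epsilon> * X + ennreal ((1 / \<gamma>) powr q) * V)
      \<le> ennreal (1 / 2) * X + ennreal (2 powr q * (1 / \<gamma>) powr q) * V"
  proof -
    have "ennreal (2 powr q) * (ennreal \<epsilon> * X) = ennreal (2 powr q * \<epsilon>) * X"
      using e0 by (simp add: ennreal_mult mult.assoc)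
    also have "\<dots> \<le> ennreal (1 / 2) * X"
      using small by (intro mult_right_mono ennreal_leI) (simp_all only: \<epsilon>_def zero_le)
    finally have "ennreal (2 powr q) * (ennreal \<epsilon> * X) \<le> ennreal (1 / 2) * X" .
    then show ?thesis by (simp add: distrib_left ennreal_mult mult.assoc add_right_mono)
  qed
  ultimately have XV: "X \<le> ennreal (1 / 2) * X + ennreal (2 powr q * (1 / \<gamma>) powr q) * V"
    by (simp add: mult.assoc[symmetric])
  show ?thesis
  \<comment> \<open>An infinite right-hand side leaves nothing to prove. Otherwise V is finite by
    Doob's inequality, hence X is finite by the crude bound, as the absorption requires.\<close>
  proof (cases "(\<integral>\<^sup>+y. ennpowr (N (F y)) q \<partial>lborel) = top")
    case True
    have "0 < 2 * (2 powr q * (1 / \<gamma>) powr q * ?C)" using q g by simp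
    moreover have "ennreal a * top = top" if "0 < a" for a
      using that by (simp add: ennreal_mult_top)
    ultimately show ?thesis unfolding True by (metis top_greatest)
  next
    case False
    then have Vfin: "V \<noteq> top"
      using V by (auto simp: top_unique ennreal_mult_eq_top_iff)
    have "X \<le> (\<integral>\<^sup>+y. ennpowr (of_nat (Suc L)) q * ennpowr (W y) q \<partial>lborel)"
      unfolding X_def
    proof (intro nn_integral_mono)
      fix y
      have "ennpowr (Y y) q \<le> ennpowr (of_nat (Suc L) * W y) q"
        unfolding Y_def W_def using q by (intro ennpowr_mono norm_max_avg_le_max_avg_norm[OF F]) simp
      then show "ennpowr (Y y) q \<le> ennpowr (of_nat (Suc L)) q * ennpowr (W y) q"
        using q by (simp only: ennpowr_mult)
    qed
    also have "\<dots> = ennpowr (of_nat (Suc L)) q * V"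
      unfolding V_def by (rule nn_integral_cmult) measurable
    finally have "X \<noteq> top"
      using Vfin by (auto simp: top_unique ennreal_mult_eq_top_iff simp del: of_nat_Suc)
    then have "X \<le> 2 * (ennreal (2 powr q * (1 / \<gamma>) powr q) * V)"
      by (rule ennreal_le_half_add_imp_le[OF XV])
    also have "\<dots> \<le> 2 * (ennreal (2 powr q * (1 / \<gamma>) powr q) * (ennreal ?C * (\<integral>\<^sup>+y. ennpowr (N (F y)) q \<partial>lborel)))"
      by (intro mult_left_mono V) auto
    also have "\<dots> = ennreal (2 * (2 powr q * (1 / \<gamma>) powr q * ?C)) * (\<integral>\<^sup>+y. ennpowr (N (F y)) q \<partial>lborel)"
    proof -
      have gen: "2 * (ennreal a * (ennreal c * I)) = ennreal (2 * (a * c)) * I" if "0 \<le> a" "0 \<le> c" for a c and I :: ennreal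
        using that by (simp add: ennreal_mult mult.assoc)
      show ?thesis by (rule gen[OF _ C0]) simp
    qed
    finally show ?thesis by (simp add: X_def Y_def)
  qed
qed

end

section \<open>Mixed norms and the strong maximal function\<close>

abbreviation vec_upd :: "real ^ 'n \<Rightarrow> 'n::finite \<Rightarrow> real \<Rightarrow> real ^ 'n" where
  "vec_upd x i s \<equiv> (\<chi> k. if k = i then s else x $ k)"

lemma vec_upd_upd [simp]: "vec_upd (vec_upd x i s) i t = vec_upd x i t"
  by (simp add: vec_eq_iff)

lemma vec_upd_commute: "i \<noteq> j \<Longrightarrow> vec_upd (vec_upd x i s) j t = vec_upd (vec_upd x j t) i s"
  by (simp add: vec_eq_iff)

lemma borel_measurable_vec_upd [measurable (raw)]:
  fixes f :: "'a \<Rightarrow> real ^ 'n::finite"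
  assumes [measurable]: "f \<in> borel_measurable M" "g \<in> borel_measurable M"
  shows "(\<lambda>z. vec_upd (f z) i (g z)) \<in> borel_measurable M"
proof -
  have [measurable]: "(\<lambda>x :: real ^ 'n. x $ i) \<in> borel_measurable borel"
    by (intro borel_measurable_continuous_onI continuous_intros)
  have "(\<lambda>z. vec_upd (f z) i (g z)) = (\<lambda>z. f z + (g z - f z $ i) *\<^sub>R axis i 1)"
    by (auto simp: fun_eq_iff vec_eq_iff axis_def)
  also have "\<dots> \<in> borel_measurable M" by measurable
  finally show ?thesis .
qed

lemma borel_measurable_vec_nth' [measurable (raw)]:
  fixes f :: "'a \<Rightarrow> real ^ 'n::finite"
  assumes [measurable]: "f \<in> borel_measurable M"
  shows "(\<lambda>z. f z $ i) \<in> borel_measurable M"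
proof -
  have [measurable]: "(\<lambda>x :: real ^ 'n. x $ i) \<in> borel_measurable borel"
    by (intro borel_measurable_continuous_onI continuous_intros)
  show ?thesis by measurable
qed

lemma partial_Lp_mono:
  assumes "0 < q" "\<And>z. f z \<le> g z" shows "partial_Lp q i f x \<le> partial_Lp q i g x"
  unfolding partial_Lp_def using assms by (intro ennpowr_mono nn_integral_mono) auto

lemma partial_Lp_cmult:
  assumes "0 < q" and [measurable]: "f \<in> borel_measurable borel"
  shows "partial_Lp q i (\<lambda>z. c * f z) x = c * partial_Lp q i f x"
  using assms(1) unfolding partial_Lp_def
  by (simp add: ennpowr_mult nn_integral_cmult)

lemma borel_measurable_partial_Lp [measurable (raw)]:
  fixes F :: "'a \<Rightarrow> real ^ 'n::finite \<Rightarrow> ennreal"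
  assumes [measurable]: "(\<lambda>(y, z). F y z) \<in> borel_measurable (M \<Otimes>\<^sub>M borel)"
    "f \<in> borel_measurable M"
  shows "(\<lambda>y. partial_Lp q i (F y) (f y)) \<in> borel_measurable M"
  unfolding partial_Lp_def by measurable

text \<open>With the same exponent in y and in coordinate k, the root taken in k cancels against the
  power taken in y, and only a double integral remains.\<close>

lemma partial_Lp_swap:
  fixes F :: "real \<Rightarrow> real ^ 'n::finite \<Rightarrow> ennreal"
  assumes q: "0 < q" and [measurable]: "(\<lambda>(y, z). F y z) \<in> borel_measurable (borel \<Otimes>\<^sub>M borel)"
  shows "(\<integral>\<^sup>+y. ennpowr (partial_Lp q k (F y) x) q \<partial>lborel)
     = (\<integral>\<^sup>+s. \<integral>\<^sup>+y. ennpowr (F y (vec_upd x k s)) q \<partial>lborel \<partial>lborel)"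
proof -
  have "(\<integral>\<^sup>+y. ennpowr (partial_Lp q k (F y) x) q \<partial>lborel)
     = (\<integral>\<^sup>+y. \<integral>\<^sup>+s. ennpowr (F y (vec_upd x k s)) q \<partial>lborel \<partial>lborel)"
    using q by (simp add: partial_Lp_def)
  also have "\<dots> = (\<integral>\<^sup>+s. \<integral>\<^sup>+y. ennpowr (F y (vec_upd x k s)) q \<partial>lborel \<partial>lborel)"
    by (rule lborel_pair.Fubini') measurable
  finally show ?thesis .
qed

text \<open>A mixed norm in the coordinates of a list only, the first innermost. The inductions
  remove the outermost coordinate, so intermediate norms are functions of the coordinates left
  over.\<close>

definition pnorm ::
  "real ^ 'n::finite \<Rightarrow> 'n list \<Rightarrow> (real ^ 'n \<Rightarrow> ennreal) \<Rightarrow> real ^ 'n \<Rightarrow> ennreal" where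
  "pnorm p l f = fold (\<lambda>i. partial_Lp (p $ i) i) l f"

lemma pnorm_Nil [simp]: "pnorm p [] f = f"
  by (simp add: pnorm_def)

lemma pnorm_snoc: "pnorm p (l @ [k]) f = partial_Lp (p $ k) k (pnorm p l f)"
  by (simp add: pnorm_def)

lemma pnorm_append: "pnorm p (l @ l') f = pnorm p l' (pnorm p l f)"
  by (simp add: pnorm_def)

lemma pnorm_mono:
  assumes "\<And>i. i \<in> set l \<Longrightarrow> 0 < p $ i" "\<And>z. f z \<le> g z"
  shows "pnorm p l f x \<le> pnorm p l g x"
  using assms
  by (induction l arbitrary: x rule: rev_induct) (auto simp: pnorm_snoc intro!: partial_Lp_mono)

lemma borel_measurable_pnorm [measurable (raw)]:
  fixes F :: "'a \<Rightarrow> real ^ 'n::finite \<Rightarrow> ennreal"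
  assumes F [measurable]: "(\<lambda>(y, z). F y z) \<in> borel_measurable (M \<Otimes>\<^sub>M borel)"
  shows "f \<in> borel_measurable M \<Longrightarrow> (\<lambda>y. pnorm p l (F y) (f y)) \<in> borel_measurable M"
proof -
  have *: "(\<lambda>(y, z). pnorm p l (F y) z) \<in> borel_measurable (M \<Otimes>\<^sub>M borel)"
  proof (induction l rule: rev_induct)
    case (snoc k l)
    note [measurable] = snoc
    have "(\<lambda>(y, z). pnorm p l (F (fst y)) z) \<in> borel_measurable ((M \<Otimes>\<^sub>M (borel :: (real ^ 'n) measure)) \<Otimes>\<^sub>M borel)"
      by measurable
    from borel_measurable_partial_Lp[OF this, of snd "p $ k" k] show ?case
      by (simp add: pnorm_snoc case_prod_beta)
  qed (simp add: F)
  assume [measurable]: "f \<in> borel_measurable M"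
  note [measurable] = *
  show ?thesis by measurable
qed

lemma borel_measurable_pnorm' [measurable]:
  assumes [measurable]: "f \<in> borel_measurable borel"
  shows "pnorm p l f \<in> borel_measurable borel"
proof -
  have "(\<lambda>(y, z). f z) \<in> borel_measurable ((borel :: (real ^ 'a) measure) \<Otimes>\<^sub>M borel)" by measurable
  then show ?thesis by (rule borel_measurable_pnorm[where F="\<lambda>_. f" and f="\<lambda>x. x"]) measurable
qed

lemma pnorm_cmult:
  assumes "\<And>i. i \<in> set l \<Longrightarrow> 0 < p $ i" and [measurable]: "f \<in> borel_measurable borel"
  shows "pnorm p l (\<lambda>z. c * f z) x = c * pnorm p l f x"
  using assms(1)
proof (induction l arbitrary: x rule: rev_induct)
  case (snoc k l)
  have "pnorm p l (\<lambda>z. c * f z) = (\<lambda>x. c * pnorm p l f x)"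
    using snoc by (auto simp: fun_eq_iff)
  then show ?case using snoc.prems by (simp add: pnorm_snoc partial_Lp_cmult)
qed simp

text \<open>Minkowski's inequality moves the integral out through one coordinate norm after the
  other.\<close>

lemma pnorm_integral_le:
  fixes F :: "real \<Rightarrow> real ^ 'n::finite \<Rightarrow> ennreal"
  assumes "\<And>i. i \<in> set l \<Longrightarrow> 1 \<le> p $ i" and [measurable]: "(\<lambda>(y, z). F y z) \<in> borel_measurable (borel \<Otimes>\<^sub>M borel)"
  shows "pnorm p l (\<lambda>z. \<integral>\<^sup>+y. F y z \<partial>lborel) x \<le> (\<integral>\<^sup>+y. pnorm p l (F y) x \<partial>lborel)"
  using assms(1)
proof (induction l arbitrary: x rule: rev_induct)
  case (snoc k l)
  have k: "1 \<le> p $ k" using snoc.prems by simp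
  have "pnorm p (l @ [k]) (\<lambda>z. \<integral>\<^sup>+y. F y z \<partial>lborel) x
      \<le> partial_Lp (p $ k) k (\<lambda>z. \<integral>\<^sup>+y. pnorm p l (F y) z \<partial>lborel) x"
    unfolding pnorm_snoc using snoc less_le_trans[OF zero_less_one k] by (intro partial_Lp_mono) auto
  also have "\<dots> \<le> (\<integral>\<^sup>+y. partial_Lp (p $ k) k (pnorm p l (F y)) x \<partial>lborel)"
    unfolding partial_Lp_def
  proof (rule Minkowski_integral_inequality[OF sigma_finite_lborel sigma_finite_lborel k])
    have "(\<lambda>(s, z). F (snd s) z) \<in> borel_measurable (((borel::real measure) \<Otimes>\<^sub>M borel) \<Otimes>\<^sub>M borel)" by measurable
    from borel_measurable_pnorm[OF this, of "\<lambda>s. vec_upd x k (fst s)" p l]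
    show "(\<lambda>(s, y). pnorm p l (F y) (vec_upd x k s)) \<in> borel_measurable (lborel \<Otimes>\<^sub>M lborel)"
      by (simp add: case_prod_beta)
  qed
  finally show ?case by (simp add: pnorm_snoc)
qed simp

lemma function_norm_pnorm:
  assumes "\<And>i. i \<in> set l \<Longrightarrow> 1 \<le> p $ i"
  shows "function_norm borel (\<lambda>f. pnorm p l f x)"
proof
  have pos: "0 < p $ i" if "i \<in> set l" for i using assms[OF that] by simp
  show "pnorm p l f x \<le> pnorm p l g x" if "\<And>z. f z \<le> g z" for f g
    using pos that by (rule pnorm_mono)
  show "pnorm p l (\<lambda>z. c * f z) x = c * pnorm p l f x" if "f \<in> borel_measurable borel" for c f
    using pos that by (rule pnorm_cmult)
  show "(\<lambda>y. pnorm p l (F y) x) \<in> borel_measurable borel"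
    if "(\<lambda>(y, z). F y z) \<in> borel_measurable (borel \<Otimes>\<^sub>M borel)" for F :: "real \<Rightarrow> _"
    using that by (rule borel_measurable_pnorm) simp
  show "pnorm p l (\<lambda>z. \<integral>\<^sup>+y. F y z \<partial>lborel) x \<le> (\<integral>\<^sup>+y. pnorm p l (F y) x \<partial>lborel)"
    if "(\<lambda>(y, z). F y z) \<in> borel_measurable (borel \<Otimes>\<^sub>M borel)" for F :: "real \<Rightarrow> _"
    using assms that by (rule pnorm_integral_le)
qed simp

text \<open>For the outermost exponent equal to the exponent of the variable \<open>y\<close>, Tonelli reduces the
  claim to a shorter list of inner variables; the good-\<open>\<lambda>\<close> inequality then changes the exponent.\<close>

theorem dyadic_pnorm_max:
  assumes "\<And>i. i \<in> set l \<Longrightarrow> 1 < p $ i" "1 < q"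
  shows "\<exists>C\<ge>0. \<forall>idx len L F x. dyadic_filtration idx len \<longrightarrow>
      (\<lambda>(y, z). F y z) \<in> borel_measurable (borel \<Otimes>\<^sub>M borel) \<longrightarrow>
      (\<integral>\<^sup>+y. ennpowr (pnorm p l (\<lambda>z. dyadic_filtration.max_avg idx len L (\<lambda>s. F s z) y) x) q \<partial>lborel)
        \<le> ennreal C * (\<integral>\<^sup>+y. ennpowr (pnorm p l (F y) x) q \<partial>lborel)"
  using assms
proof (induction l arbitrary: q rule: rev_induct)
  case Nil
  show ?case
  proof (intro exI conjI allI impI)
    show "0 \<le> 2 * q / (q - 1) * 2 powr (q - 1)" using Nil by simp
    fix idx len L and F :: "real \<Rightarrow> real ^ 'a \<Rightarrow> ennreal" and x
    assume d: "dyadic_filtration idx len" and F: "(\<lambda>(y, z). F y z) \<in> borel_measurable (borel \<Otimes>\<^sub>M borel)"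
    interpret dyadic_filtration idx len by fact
    have "(\<lambda>s. F s x) \<in> borel_measurable borel"
      using measurable_compose[OF measurable_Pair2' F, of x] by simp
    then show "(\<integral>\<^sup>+y. ennpowr (pnorm p [] (\<lambda>z. max_avg L (\<lambda>s. F s z) y) x) q \<partial>lborel)
        \<le> ennreal (2 * q / (q - 1) * 2 powr (q - 1)) * (\<integral>\<^sup>+y. ennpowr (pnorm p [] (F y) x) q \<partial>lborel)"
      using max_avg_strong_type[of q "\<lambda>s. F s x" L] Nil by simp
  qed
next
  case (snoc k l)
  define p0 where "p0 = p $ k"
  have p0: "1 < p0" using snoc.prems by (simp add: p0_def)
  obtain C where C: "0 \<le> C" and IH: "\<And>idx len L F x. dyadic_filtration idx len \<Longrightarrow>
      (\<lambda>(y, z). F y z) \<in> borel_measurable (borel \<Otimes>\<^sub>M borel) \<Longrightarrow>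
      (\<integral>\<^sup>+y. ennpowr (pnorm p l (\<lambda>z. dyadic_filtration.max_avg idx len L (\<lambda>s. F s z) y) x) p0 \<partial>lborel)
        \<le> ennreal C * (\<integral>\<^sup>+y. ennpowr (pnorm p l (F y) x) p0 \<partial>lborel)"
    using snoc.IH[of p0] snoc.prems p0 by auto
  \<comment> \<open>Solves 2^q (C + 1) (2 \<gamma>)^p0 = 1/2. Using C + 1 in place of C keeps
    \<gamma> defined when C = 0.\<close>
  define \<gamma> where "\<gamma> = (1 / (2 * (2 powr q * (C + 1)))) powr (1 / p0) / 2"
  have g: "0 < \<gamma>" using C unfolding \<gamma>_def by simp
  have "2 powr q * (C * (2 * \<gamma>) powr p0) = 2 powr q * (C * (1 / (2 * (2 powr q * (C + 1)))))"
    using C p0 by (simp add: \<gamma>_def powr_powr)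
  also have "\<dots> = C / (C + 1) * (1 / 2)" by simp
  also have "\<dots> \<le> 1 * (1 / 2)" using C by (intro mult_right_mono) auto
  finally have small: "2 powr q * (C * (2 * \<gamma>) powr p0) \<le> 1 / 2" by simp
  let ?K = "2 * (2 powr q * (1 / \<gamma>) powr q * (2 * q / (q - 1) * 2 powr (q - 1)))"
  show ?case
  proof (intro exI conjI allI impI)
    show "0 \<le> ?K" using snoc.prems by simp
    fix idx len L and F :: "real \<Rightarrow> real ^ 'a \<Rightarrow> ennreal" and x
    assume d: "dyadic_filtration idx len" and F: "(\<lambda>(y, z). F y z) \<in> borel_measurable (borel \<Otimes>\<^sub>M borel)"
    interpret dyadic_filtration idx len by fact
    have le1: "1 \<le> p $ i" if "i \<in> set (l @ [k])" for i using snoc.prems(1)[OF that] by simp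
    interpret function_norm borel "\<lambda>f. pnorm p (l @ [k]) f x"
      using le1 by (rule function_norm_pnorm)
    interpret dyadic_function_norm idx len borel "\<lambda>f. pnorm p (l @ [k]) f x" ..
    show "(\<integral>\<^sup>+y. ennpowr (pnorm p (l @ [k]) (\<lambda>z. max_avg L (\<lambda>s. F s z) y) x) q \<partial>lborel)
        \<le> ennreal ?K * (\<integral>\<^sup>+y. ennpowr (pnorm p (l @ [k]) (F y) x) q \<partial>lborel)"
    proof (rule norm_max_avg_exponent_change[OF _ g C snoc.prems(2) small _ F])
      fix G :: "real \<Rightarrow> real ^ 'a \<Rightarrow> ennreal"
      assume G [measurable]: "(\<lambda>(y, z). G y z) \<in> borel_measurable (borel \<Otimes>\<^sub>M borel)"
      note [measurable] = max_avg_F_measurable[OF G]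
      have m1: "(\<lambda>(y, z). pnorm p l (\<lambda>z. max_avg L (\<lambda>s. G s z) y) z) \<in> borel_measurable (borel \<Otimes>\<^sub>M borel)"
      proof -
        have "(\<lambda>(y, z). max_avg L (\<lambda>s. G s z) (fst y)) \<in> borel_measurable ((borel \<Otimes>\<^sub>M (borel :: (real ^ 'a) measure)) \<Otimes>\<^sub>M borel)"
          by measurable
        from borel_measurable_pnorm[OF this, of snd] show ?thesis by (simp add: case_prod_beta)
      qed
      have m2: "(\<lambda>(y, z). pnorm p l (G y) z) \<in> borel_measurable (borel \<Otimes>\<^sub>M borel)"
      proof -
        have "(\<lambda>(y, z). G (fst y) z) \<in> borel_measurable ((borel \<Otimes>\<^sub>M (borel :: (real ^ 'a) measure)) \<Otimes>\<^sub>M borel)"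
          by measurable
        from borel_measurable_pnorm[OF this, of snd] show ?thesis by (simp add: case_prod_beta)
      qed
      \<comment> \<open>At exponent p0 the norm in coordinate k can be exchanged with the integral
        in y; for each fixed value of coordinate k the induction hypothesis then concerns the
        shorter list.\<close>
      have "(\<integral>\<^sup>+y. ennpowr (pnorm p (l @ [k]) (\<lambda>z. max_avg L (\<lambda>s. G s z) y) x) p0 \<partial>lborel) =
         (\<integral>\<^sup>+s. \<integral>\<^sup>+y. ennpowr (pnorm p l (\<lambda>z. max_avg L (\<lambda>s. G s z) y) (vec_upd x k s)) p0 \<partial>lborel \<partial>lborel)"
        unfolding pnorm_snoc p0_def[symmetric] using p0 m1 by (intro partial_Lp_swap) auto
      also have "\<dots> \<le> (\<integral>\<^sup>+s. ennreal C * (\<integral>\<^sup>+y. ennpowr (pnorm p l (G y) (vec_upd x k s)) p0 \<partial>lborel) \<partial>lborel)"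
        by (intro nn_integral_mono IH d G)
      also have "\<dots> = ennreal C * (\<integral>\<^sup>+s. \<integral>\<^sup>+y. ennpowr (pnorm p l (G y) (vec_upd x k s)) p0 \<partial>lborel \<partial>lborel)"
      proof (rule nn_integral_cmult)
        note [measurable] = m2
        have "(\<lambda>(s, y). ennpowr (pnorm p l (G y) (vec_upd x k s)) p0) \<in> borel_measurable (lborel \<Otimes>\<^sub>M lborel)"
          using measurable_compose[of "\<lambda>(s, y). (y, vec_upd x k s)" "lborel \<Otimes>\<^sub>M lborel", OF _ m2]
          by (auto simp: case_prod_beta)
        then show "(\<lambda>s. \<integral>\<^sup>+y. ennpowr (pnorm p l (G y) (vec_upd x k s)) p0 \<partial>lborel) \<in> borel_measurable lborel"
          by (rule lborel.borel_measurable_nn_integral)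
      qed
      also have "(\<integral>\<^sup>+s. \<integral>\<^sup>+y. ennpowr (pnorm p l (G y) (vec_upd x k s)) p0 \<partial>lborel \<partial>lborel) =
          (\<integral>\<^sup>+y. ennpowr (pnorm p (l @ [k]) (G y) x) p0 \<partial>lborel)"
        unfolding pnorm_snoc p0_def[symmetric] using p0 m2 by (intro partial_Lp_swap[symmetric]) auto
      finally show "(\<integral>\<^sup>+y. ennpowr (pnorm p (l @ [k]) (\<lambda>z. max_avg L (\<lambda>s. G s z) y) x) p0 \<partial>lborel)
        \<le> ennreal C * (\<integral>\<^sup>+y. ennpowr (pnorm p (l @ [k]) (G y) x) p0 \<partial>lborel)" .
    qed (use p0 in simp)
  qed
qed

section \<open>Centred intervals and two dyadic grids shifted by a third\<close>

definition grid_idx :: "real \<Rightarrow> int \<Rightarrow> nat \<Rightarrow> real \<Rightarrow> int" where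
  "grid_idx \<delta> \<sigma> i y = \<lfloor>y / (3 * \<delta> / 2 ^ i) - of_int (\<sigma> * (-1) ^ i) / 3\<rfloor>"

text \<open>The alternating sign makes the grids shifted by a third of the cell length nested.\<close>

lemma dyadic_filtration_grid:
  assumes d: "0 < \<delta>"
  shows "dyadic_filtration (grid_idx \<delta> \<sigma>) (\<lambda>i. 3 * \<delta> / 2 ^ i)"
proof
  fix i :: nat and s y :: real
  let ?len = "3 * \<delta> / 2 ^ i" and ?c = "of_int (\<sigma> * (-1) ^ i) / 3 :: real"
  show "grid_idx \<delta> \<sigma> i \<in> borel \<rightarrow>\<^sub>M count_space UNIV"
    unfolding grid_idx_def by measurable
  show "0 < ?len" "3 * \<delta> / 2 ^ i = 2 * (3 * \<delta> / 2 ^ Suc i)" using d by simp_all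
  have len: "0 < ?len" using d by simp
  let ?m = "grid_idx \<delta> \<sigma> i y"
  have "{s. grid_idx \<delta> \<sigma> i s = ?m} = {(of_int ?m + ?c) * ?len ..< (of_int ?m + ?c) * ?len + ?len}"
  proof (intro set_eqI)
    fix s
    have "grid_idx \<delta> \<sigma> i s = ?m \<longleftrightarrow> of_int ?m + ?c \<le> s / ?len \<and> s / ?len < of_int ?m + ?c + 1"
      unfolding grid_idx_def[of \<delta> \<sigma> i s] floor_eq_iff by linarith
    also have "\<dots> \<longleftrightarrow> (of_int ?m + ?c) * ?len \<le> s \<and> s < (of_int ?m + ?c + 1) * ?len"
      by (simp only: pos_le_divide_eq[OF len] pos_divide_less_eq[OF len])
    finally show "s \<in> {s. grid_idx \<delta> \<sigma> i s = ?m} \<longleftrightarrow>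
        s \<in> {(of_int ?m + ?c) * ?len ..< (of_int ?m + ?c) * ?len + ?len}"
      by (simp only: mem_Collect_eq atLeastLessThan_iff distrib_right mult_1)
  qed
  then show "emeasure lborel {s. grid_idx \<delta> \<sigma> i s = ?m} = ennreal ?len"
    using d by (simp add: emeasure_lborel_Ico)
  assume eq: "grid_idx \<delta> \<sigma> (Suc i) s = grid_idx \<delta> \<sigma> (Suc i) y"
  \<comment> \<open>The offset changes from c to -c between consecutive levels, while doubling the
    coordinate doubles its offset to 2 c. The discrepancy 3 c is an integer, so the coarse index is
    obtained by integer division of the corrected fine index.\<close>
  have step: "grid_idx \<delta> \<sigma> i y = (grid_idx \<delta> \<sigma> (Suc i) y - \<sigma> * (-1) ^ i) div 2" for y
  proof -
    let ?a = "y / ?len - ?c"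
    have "y / (3 * \<delta> / 2 ^ Suc i) - of_int (\<sigma> * (-1) ^ Suc i) / 3 = 2 * ?a + of_int (\<sigma> * (-1) ^ i)"
      using d by (simp add: field_simps)
    then have eq: "grid_idx \<delta> \<sigma> (Suc i) y - \<sigma> * (-1) ^ i = \<lfloor>2 * ?a\<rfloor>"
      unfolding grid_idx_def by (simp only: floor_add_int[symmetric])
    have half: "\<lfloor>a\<rfloor> = \<lfloor>2 * a\<rfloor> div 2" for a :: real
      using floor_divide_real_eq_div[of 2 "2 * a"] by simp
    show ?thesis unfolding eq grid_idx_def[of \<delta> \<sigma> i] by (rule half)
  qed
  show "grid_idx \<delta> \<sigma> i s = grid_idx \<delta> \<sigma> i y" unfolding step eq ..
qed

text \<open>Two points closer than 1/3 that are separated by an integer both lie within 1/3 of it,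
  hence no integer translate of t = 1/3 or t = -1/3 separates them.\<close>

lemma floor_shift_third:
  fixes u v :: real
  assumes "\<bar>u - v\<bar> < 1 / 3" "\<lfloor>u\<rfloor> \<noteq> \<lfloor>v\<rfloor>" "t = 1 / 3 \<or> t = - 1 / 3"
  shows "\<lfloor>u - t\<rfloor> = \<lfloor>v - t\<rfloor>"
proof -
  have *: "\<lfloor>u - t\<rfloor> = \<lfloor>v - t\<rfloor>" if "\<bar>u - v\<bar> < 1 / 3" "\<lfloor>u\<rfloor> < \<lfloor>v\<rfloor>" for u v :: real
  proof -
    have 1: "of_int \<lfloor>v\<rfloor> \<le> v" "u < of_int \<lfloor>v\<rfloor>" using that(2) by (simp, linarith)
    show ?thesis using assms(3)
    proof
      assume t: "t = 1 / 3"
      have "\<lfloor>u - t\<rfloor> = \<lfloor>v\<rfloor> - 1" "\<lfloor>v - t\<rfloor> = \<lfloor>v\<rfloor> - 1"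
        unfolding floor_eq_iff using 1 t that(1) by (auto simp: abs_less_iff; linarith)+
      then show ?thesis by simp
    next
      assume t: "t = - 1 / 3"
      have "\<lfloor>u - t\<rfloor> = \<lfloor>v\<rfloor>" "\<lfloor>v - t\<rfloor> = \<lfloor>v\<rfloor>"
        unfolding floor_eq_iff using 1 t that(1) by (auto simp: abs_less_iff; linarith)+
      then show ?thesis by simp
    qed
  qed
  from assms(2) consider "\<lfloor>u\<rfloor> < \<lfloor>v\<rfloor>" | "\<lfloor>v\<rfloor> < \<lfloor>u\<rfloor>" by linarith
  then show ?thesis
  proof cases
    case 1 then show ?thesis using *[of u v] assms(1) by simp
  next
    case 2 then show ?thesis using *[of v u] assms(1) by (simp add: abs_minus_commute)
  qed
qed

text \<open>Cells have length 3 \<delta> / 2^i, so points closer than \<delta> / 2^i are less than a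
  third of a cell apart. If one grid separates them, the grid shifted by a third does not.\<close>

lemma grid_idx_close:
  assumes d: "0 < \<delta>" and "\<bar>s - y\<bar> < \<delta> / 2 ^ i" "grid_idx \<delta> 0 i s \<noteq> grid_idx \<delta> 0 i y"
  shows "grid_idx \<delta> 1 i s = grid_idx \<delta> 1 i y"
proof -
  let ?len = "3 * \<delta> / 2 ^ i"
  have "\<bar>s / ?len - y / ?len\<bar> = \<bar>s - y\<bar> / ?len"
    using d by (simp only: diff_divide_distrib[symmetric] abs_divide) simp
  also have "\<dots> < 1 / 3"
    using assms(2) d by (simp add: field_simps)
  finally have "\<bar>s / ?len - y / ?len\<bar> < 1 / 3" .
  moreover have "of_int (1 * (- 1) ^ i) / 3 = (1 / 3 :: real) \<or> of_int (1 * (- 1) ^ i) / 3 = (- 1 / 3 :: real)"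
    by (cases "even i") auto
  ultimately show ?thesis
    using floor_shift_third[of "s / ?len" "y / ?len"] assms(3) unfolding grid_idx_def by simp
qed

text \<open>The centred maximal function over the radii \<delta> / 2^i. The normalising factor is
  twice the reciprocal of the interval length.\<close>

definition hl_max :: "real \<Rightarrow> nat \<Rightarrow> (real \<Rightarrow> ennreal) \<Rightarrow> real \<Rightarrow> ennreal" where
  "hl_max \<delta> L f y =
     (SUP i\<in>{..L}. ennreal (2 ^ i / \<delta>) * (\<integral>\<^sup>+s. indicator {s. \<bar>s - y\<bar> < \<delta> / 2 ^ i} s * f s \<partial>lborel))"

lemma borel_measurable_hl_max [measurable (raw)]:
  assumes [measurable]: "(\<lambda>(s, z). F s z) \<in> borel_measurable (borel \<Otimes>\<^sub>M Z)" "y \<in> borel_measurable Z"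
  shows "(\<lambda>z. hl_max \<delta> L (\<lambda>s. F s z) (y z)) \<in> borel_measurable Z"
proof -
  have [measurable]: "(\<lambda>(z, s). F s z) \<in> borel_measurable (Z \<Otimes>\<^sub>M borel)"
    by measurable
  show ?thesis unfolding hl_max_def indicator_def mem_Collect_eq by measurable
qed

text \<open>Every centred interval is covered by the two cells of y, one from each grid. The factor
  3 is the ratio of the normalisations \<open>2 ^ i / \<delta>\<close> and
  \<open>1 / (3 * \<delta> / 2 ^ i)\<close>.\<close>

lemma hl_max_le_max_avg:
  assumes d: "0 < \<delta>" and f [measurable]: "f \<in> borel_measurable borel"
  shows "hl_max \<delta> L f y \<le> 3 * (dyadic_filtration.max_avg (grid_idx \<delta> 0) (\<lambda>i. 3 * \<delta> / 2 ^ i) L f y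
      + dyadic_filtration.max_avg (grid_idx \<delta> 1) (\<lambda>i. 3 * \<delta> / 2 ^ i) L f y)"
  unfolding hl_max_def
proof (rule SUP_least)
  fix i assume i: "i \<in> {..L}"
  let ?len = "\<lambda>i. 3 * \<delta> / 2 ^ i"
  interpret G0: dyadic_filtration "grid_idx \<delta> 0" ?len by (rule dyadic_filtration_grid[OF d])
  interpret G1: dyadic_filtration "grid_idx \<delta> 1" ?len by (rule dyadic_filtration_grid[OF d])
  let ?i0 = "\<lambda>s. indicator {s. grid_idx \<delta> 0 i s = grid_idx \<delta> 0 i y} s :: ennreal"
  let ?i1 = "\<lambda>s. indicator {s. grid_idx \<delta> 1 i s = grid_idx \<delta> 1 i y} s :: ennreal"
  have avg0: "ennreal (1 / ?len i) * (\<integral>\<^sup>+s. ?i0 s * f s \<partial>lborel) = G0.cond_avg i f y"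
  proof -
    have "ennreal (1 / ?len i) * (\<integral>\<^sup>+s. ?i0 s * f s \<partial>lborel) = (\<integral>\<^sup>+s. ennreal (1 / ?len i) * (?i0 s * f s) \<partial>lborel)"
      by (rule nn_integral_cmult[symmetric]) measurable
    then show ?thesis unfolding G0.cond_avg_def by (simp only: mult.assoc mult.left_commute)
  qed
  have avg1: "ennreal (1 / ?len i) * (\<integral>\<^sup>+s. ?i1 s * f s \<partial>lborel) = G1.cond_avg i f y"
  proof -
    have "ennreal (1 / ?len i) * (\<integral>\<^sup>+s. ?i1 s * f s \<partial>lborel) = (\<integral>\<^sup>+s. ennreal (1 / ?len i) * (?i1 s * f s) \<partial>lborel)"
      by (rule nn_integral_cmult[symmetric]) measurable
    then show ?thesis unfolding G1.cond_avg_def by (simp only: mult.assoc mult.left_commute)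
  qed
  have "ennreal (2 ^ i / \<delta>) = 3 * ennreal (1 / ?len i)"
    using d by (simp flip: ennreal_numeral ennreal_mult)
  then have "ennreal (2 ^ i / \<delta>) * (\<integral>\<^sup>+s. indicator {s. \<bar>s - y\<bar> < \<delta> / 2 ^ i} s * f s \<partial>lborel)
     = 3 * (ennreal (1 / ?len i) * (\<integral>\<^sup>+s. indicator {s. \<bar>s - y\<bar> < \<delta> / 2 ^ i} s * f s \<partial>lborel))"
    by (simp add: mult.assoc)
  also have "\<dots> \<le> 3 * (ennreal (1 / ?len i) * (\<integral>\<^sup>+s. ?i0 s * f s + ?i1 s * f s \<partial>lborel))"
  proof (intro mult_left_mono nn_integral_mono)
    fix s
    show "indicator {s. \<bar>s - y\<bar> < \<delta> / 2 ^ i} s * f s \<le> ?i0 s * f s + ?i1 s * f s"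
      using grid_idx_close[OF d, of s y i] by (auto simp: indicator_def)
  qed auto
  also have "(\<integral>\<^sup>+s. ?i0 s * f s + ?i1 s * f s \<partial>lborel) = (\<integral>\<^sup>+s. ?i0 s * f s \<partial>lborel) + (\<integral>\<^sup>+s. ?i1 s * f s \<partial>lborel)"
    by (rule nn_integral_add) measurable
  also have "ennreal (1 / ?len i) * \<dots> = G0.cond_avg i f y + G1.cond_avg i f y"
    unfolding distrib_left by (simp only: avg0 avg1)
  also have "3 * (G0.cond_avg i f y + G1.cond_avg i f y) \<le> 3 * (G0.max_avg L f y + G1.max_avg L f y)"
    using i by (intro mult_left_mono add_mono G0.cond_avg_le_max_avg G1.cond_avg_le_max_avg) auto
  finally show "ennreal (2 ^ i / \<delta>) * (\<integral>\<^sup>+s. indicator {s. \<bar>s - y\<bar> < \<delta> / 2 ^ i} s * f s \<partial>lborel)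
    \<le> 3 * (G0.max_avg L f y + G1.max_avg L f y)" .
qed

theorem pnorm_hl_max:
  assumes p: "\<And>i. i \<in> set l \<Longrightarrow> 1 < p $ i" and q: "1 < q"
  shows "\<exists>C\<ge>0. \<forall>\<delta> L F x. 0 < \<delta> \<longrightarrow> (\<lambda>(y, z). F y z) \<in> borel_measurable (borel \<Otimes>\<^sub>M borel) \<longrightarrow>
      (\<integral>\<^sup>+y. ennpowr (pnorm p l (\<lambda>z. hl_max \<delta> L (\<lambda>s. F s z) y) x) q \<partial>lborel)
        \<le> ennreal C * (\<integral>\<^sup>+y. ennpowr (pnorm p l (F y) x) q \<partial>lborel)"
proof -
  obtain C where C: "0 \<le> C" and bound': "\<forall>idx len L F x. dyadic_filtration idx len \<longrightarrow>
      (\<lambda>(y, z). F y z) \<in> borel_measurable (borel \<Otimes>\<^sub>M borel) \<longrightarrow>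
      (\<integral>\<^sup>+y. ennpowr (pnorm p l (\<lambda>z. dyadic_filtration.max_avg idx len L (\<lambda>s. F s z) y) x) q \<partial>lborel)
        \<le> ennreal C * (\<integral>\<^sup>+y. ennpowr (pnorm p l (F y) x) q \<partial>lborel)"
    by (rule exE[OF dyadic_pnorm_max[of l p q, OF p q]]) (assumption, elim conjE, rule that)
  note bound = bound'[rule_format]
  show ?thesis
  proof (intro exI conjI allI impI)
    show "0 \<le> 3 powr q * 2 powr q * (2 * C)" using C by simp
    fix \<delta> :: real and L and F :: "real \<Rightarrow> real ^ 'a \<Rightarrow> ennreal" and x
    assume d: "0 < \<delta>" and F [measurable]: "(\<lambda>(y, z). F y z) \<in> borel_measurable (borel \<Otimes>\<^sub>M borel)"
    let ?len = "\<lambda>i. 3 * \<delta> / 2 ^ i"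
    interpret G0: dyadic_filtration "grid_idx \<delta> 0" ?len by (rule dyadic_filtration_grid[OF d])
    interpret G1: dyadic_filtration "grid_idx \<delta> 1" ?len by (rule dyadic_filtration_grid[OF d])
    have p1: "1 \<le> p $ i" "0 < p $ i" if "i \<in> set l" for i using p[OF that] by simp_all
    interpret function_norm borel "\<lambda>f. pnorm p l f x"
      using p1(1) by (rule function_norm_pnorm)
    interpret N0: dyadic_function_norm "grid_idx \<delta> 0" ?len borel "\<lambda>f. pnorm p l f x" ..
    interpret N1: dyadic_function_norm "grid_idx \<delta> 1" ?len borel "\<lambda>f. pnorm p l f x" ..
    note [measurable] = N0.max_avg_F_measurable[OF F] N1.max_avg_F_measurable[OF F]
    let ?A = "\<lambda>y. pnorm p l (\<lambda>z. G0.max_avg L (\<lambda>s. F s z) y) x"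
    let ?B = "\<lambda>y. pnorm p l (\<lambda>z. G1.max_avg L (\<lambda>s. F s z) y) x"
    have AB [measurable]: "?A \<in> borel_measurable borel" "?B \<in> borel_measurable borel"
      by (intro N0.norm_max_avg_measurable[OF F] N1.norm_max_avg_measurable[OF F])+
    have three: "ennpowr 3 q = ennreal (3 powr q)" "ennpowr 2 q = ennreal (2 powr q)"
      using ennpowr_ennreal[of 3 q] ennpowr_ennreal[of 2 q] by simp_all
    have "(\<integral>\<^sup>+y. ennpowr (pnorm p l (\<lambda>z. hl_max \<delta> L (\<lambda>s. F s z) y) x) q \<partial>lborel)
      \<le> (\<integral>\<^sup>+y. ennreal (3 powr q * 2 powr q) * (ennpowr (?A y) q + ennpowr (?B y) q) \<partial>lborel)"
    proof (intro nn_integral_mono)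
      fix y
      have m: "(\<lambda>z. G0.max_avg L (\<lambda>s. F s z) y) \<in> borel_measurable borel"
        "(\<lambda>z. G1.max_avg L (\<lambda>s. F s z) y) \<in> borel_measurable borel"
        using N0.measurable_slice(1)[OF N0.max_avg_F_measurable[OF F]]
          N1.measurable_slice(1)[OF N1.max_avg_F_measurable[OF F]] by simp_all
      have "pnorm p l (\<lambda>z. hl_max \<delta> L (\<lambda>s. F s z) y) x
        \<le> pnorm p l (\<lambda>z. 3 * (G0.max_avg L (\<lambda>s. F s z) y + G1.max_avg L (\<lambda>s. F s z) y)) x"
        by (intro pnorm_mono p1 hl_max_le_max_avg d N0.measurable_slice(2)[OF F])
      also have "\<dots> = 3 * pnorm p l (\<lambda>z. G0.max_avg L (\<lambda>s. F s z) y + G1.max_avg L (\<lambda>s. F s z) y) x"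
        using m by (intro pnorm_cmult p1) auto
      also have "\<dots> \<le> 3 * (?A y + ?B y)"
        by (intro mult_left_mono norm_add m) auto
      finally have "ennpowr (pnorm p l (\<lambda>z. hl_max \<delta> L (\<lambda>s. F s z) y) x) q \<le> ennpowr (3 * (?A y + ?B y)) q"
        using q by (intro ennpowr_mono) auto
      also have "\<dots> \<le> ennpowr 3 q * (ennpowr 2 q * (ennpowr (?A y) q + ennpowr (?B y) q))"
        using q by (simp only: ennpowr_mult) (intro mult_left_mono ennpowr_add_le, auto)
      finally show "ennpowr (pnorm p l (\<lambda>z. hl_max \<delta> L (\<lambda>s. F s z) y) x) q
          \<le> ennreal (3 powr q * 2 powr q) * (ennpowr (?A y) q + ennpowr (?B y) q)"
        unfolding three by (simp add: ennreal_mult mult.assoc)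
    qed
    also have "\<dots> = ennreal (3 powr q * 2 powr q) * ((\<integral>\<^sup>+y. ennpowr (?A y) q \<partial>lborel) + (\<integral>\<^sup>+y. ennpowr (?B y) q \<partial>lborel))"
      by (subst nn_integral_cmult) (measurable, simp add: nn_integral_add)
    also have "\<dots> \<le> ennreal (3 powr q * 2 powr q) * (ennreal C * (\<integral>\<^sup>+y. ennpowr (pnorm p l (F y) x) q \<partial>lborel)
         + ennreal C * (\<integral>\<^sup>+y. ennpowr (pnorm p l (F y) x) q \<partial>lborel))"
      by (intro mult_left_mono add_mono bound dyadic_filtration_grid d F) auto
    also have "\<dots> = ennreal (3 powr q * 2 powr q * (2 * C)) * (\<integral>\<^sup>+y. ennpowr (pnorm p l (F y) x) q \<partial>lborel)"
      using C by (simp add: ennreal_mult mult.assoc mult_2[symmetric])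
    finally show "(\<integral>\<^sup>+y. ennpowr (pnorm p l (\<lambda>z. hl_max \<delta> L (\<lambda>s. F s z) y) x) q \<partial>lborel)
       \<le> ennreal (3 powr q * 2 powr q * (2 * C)) * (\<integral>\<^sup>+y. ennpowr (pnorm p l (F y) x) q \<partial>lborel)" .
  qed
qed

section \<open>The strong maximal function on mixed norm spaces\<close>

lemma pnorm_cong_coord:
  assumes "i \<notin> set l" "\<And>z. z $ i = x $ i \<Longrightarrow> f z = g z"
  shows "pnorm p l f x = pnorm p l g x"
  using assms
proof (induction l arbitrary: x rule: rev_induct)
  case (snoc k l)
  then have "pnorm p l f (vec_upd x k s) = pnorm p l g (vec_upd x k s)" for s
    by (intro snoc.IH) auto
  then show ?case by (simp add: pnorm_snoc partial_Lp_def)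
qed simp

lemma pnorm_vec_upd:
  assumes "i \<notin> set l" "\<And>z s. f (vec_upd z i s) = f z"
  shows "pnorm p l f (vec_upd x i s) = pnorm p l f x"
  using assms
proof (induction l arbitrary: x rule: rev_induct)
  case (snoc k l)
  then have "pnorm p l f (vec_upd (vec_upd x i s) k t) = pnorm p l f (vec_upd x k t)" for t
    by (subst vec_upd_commute) auto
  then show ?case by (simp add: pnorm_snoc partial_Lp_def)
qed simp

definition coord_max :: "real \<Rightarrow> nat \<Rightarrow> 'n::finite \<Rightarrow> (real ^ 'n \<Rightarrow> ennreal) \<Rightarrow> real ^ 'n \<Rightarrow> ennreal" where
  "coord_max \<delta> L i g x = hl_max \<delta> L (\<lambda>s. g (vec_upd x i s)) (x $ i)"

lemma borel_measurable_coord_max [measurable]: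
  assumes [measurable]: "g \<in> borel_measurable borel"
  shows "coord_max \<delta> L i g \<in> borel_measurable borel"
  unfolding coord_max_def[abs_def] by measurable

text \<open>Coordinate i takes the part of the variable y in \<open>pnorm_hl_max\<close>: the inner
  norms do not touch it, so g becomes a family, indexed by y, of functions of the inner
  variables.\<close>

lemma partial_Lp_coord_max:
  assumes p: "\<And>k. k \<in> set l \<Longrightarrow> 1 < p $ k" and q: "1 < q" and i: "i \<notin> set l"
  shows "\<exists>C\<ge>0. \<forall>\<delta> L g x. 0 < \<delta> \<longrightarrow> g \<in> borel_measurable borel \<longrightarrow>
      partial_Lp q i (pnorm p l (coord_max \<delta> L i g)) x \<le> ennreal C * partial_Lp q i (pnorm p l g) x"
proof -
  obtain C where C: "0 \<le> C" and bound': "\<forall>\<delta> L F x. 0 < \<delta> \<longrightarrow>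
      (\<lambda>(y, z). F y z) \<in> borel_measurable (borel \<Otimes>\<^sub>M borel) \<longrightarrow>
      (\<integral>\<^sup>+y. ennpowr (pnorm p l (\<lambda>z. hl_max \<delta> L (\<lambda>s. F s z) y) x) q \<partial>lborel)
        \<le> ennreal C * (\<integral>\<^sup>+y. ennpowr (pnorm p l (F y) x) q \<partial>lborel)"
    by (rule exE[OF pnorm_hl_max[of l p q, OF p q]]) (assumption, elim conjE, rule that)
  note bound = bound'[rule_format]
  show ?thesis
  proof (intro exI conjI allI impI)
    show "0 \<le> C powr (1 / q)" by simp
    fix \<delta> :: real and L and g :: "real ^ 'a \<Rightarrow> ennreal" and x
    assume d: "0 < \<delta>" and [measurable]: "g \<in> borel_measurable borel"
    have F: "(\<lambda>(y, z). g (vec_upd z i y)) \<in> borel_measurable (borel \<Otimes>\<^sub>M borel)"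
      by measurable
    have "pnorm p l (coord_max \<delta> L i g) (vec_upd x i y) = pnorm p l (\<lambda>z. hl_max \<delta> L (\<lambda>s. g (vec_upd z i s)) y) x" for y
    proof -
      have "pnorm p l (coord_max \<delta> L i g) (vec_upd x i y) =
        pnorm p l (\<lambda>z. hl_max \<delta> L (\<lambda>s. g (vec_upd z i s)) y) (vec_upd x i y)"
        using i by (intro pnorm_cong_coord) (auto simp: coord_max_def)
      also have "\<dots> = pnorm p l (\<lambda>z. hl_max \<delta> L (\<lambda>s. g (vec_upd z i s)) y) x"
        using i by (intro pnorm_vec_upd) simp_all
      finally show ?thesis .
    qed
    moreover have "pnorm p l g (vec_upd x i y) = pnorm p l (\<lambda>z. g (vec_upd z i y)) x" for y
    proof -
      have "pnorm p l g (vec_upd x i y) = pnorm p l (\<lambda>z. g (vec_upd z i y)) (vec_upd x i y)"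
        using i by (intro pnorm_cong_coord) (auto simp: vec_eq_iff intro!: arg_cong[of _ _ g])
      also have "\<dots> = pnorm p l (\<lambda>z. g (vec_upd z i y)) x"
        using i by (intro pnorm_vec_upd) simp_all
      finally show ?thesis .
    qed
    ultimately have "ennpowr (partial_Lp q i (pnorm p l (coord_max \<delta> L i g)) x) q
        \<le> ennreal C * ennpowr (partial_Lp q i (pnorm p l g) x) q"
      using bound[OF d F, of L x] q by (simp add: partial_Lp_def)
    also have "\<dots> = ennpowr (ennreal (C powr (1 / q)) * partial_Lp q i (pnorm p l g) x) q"
      using q C by (simp add: ennpowr_mult ennpowr_ennreal powr_powr)
    finally show "partial_Lp q i (pnorm p l (coord_max \<delta> L i g)) x \<le> ennreal (C powr (1 / q)) * partial_Lp q i (pnorm p l g) x"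
      using q by (simp add: ennpowr_le_iff)
  qed
qed

text \<open>The vector-valued bound concerns the coordinates up to i. It holds pointwise in the
  remaining ones, whose norms are monotone and homogeneous and therefore preserve it.\<close>

lemma pnorm_coord_max:
  assumes p: "\<And>k. k \<in> set xs \<Longrightarrow> 1 < p $ k" and xs: "distinct xs" "i \<in> set xs"
  shows "\<exists>C\<ge>0. \<forall>\<delta> L g x. 0 < \<delta> \<longrightarrow> g \<in> borel_measurable borel \<longrightarrow>
      pnorm p xs (coord_max \<delta> L i g) x \<le> ennreal C * pnorm p xs g x"
proof -
  obtain l l' where l: "xs = l @ i # l'" by (meson split_list xs(2))
  obtain C where C: "0 \<le> C" and bound: "\<And>\<delta> L g x. 0 < \<delta> \<Longrightarrow> g \<in> borel_measurable borel \<Longrightarrow>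
      partial_Lp (p $ i) i (pnorm p l (coord_max \<delta> L i g)) x \<le> ennreal C * partial_Lp (p $ i) i (pnorm p l g) x"
    using partial_Lp_coord_max[of l p "p $ i" i] p xs l by auto
  have xs_eq: "pnorm p xs f = pnorm p l' (partial_Lp (p $ i) i (pnorm p l f))" for f
    using pnorm_append[of p l "[i] @ l'"] pnorm_append[of p "[i]" l'] by (simp add: l pnorm_def)
  have pos: "0 < p $ k" if "k \<in> set l'" for k using p[of k] that l by auto
  show ?thesis
  proof (intro exI conjI allI impI)
    fix \<delta> :: real and L and g :: "real ^ 'a \<Rightarrow> ennreal" and x
    assume d: "0 < \<delta>" and g [measurable]: "g \<in> borel_measurable borel"
    have "pnorm p xs (coord_max \<delta> L i g) x \<le> pnorm p l' (\<lambda>x. ennreal C * partial_Lp (p $ i) i (pnorm p l g) x) x"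
      unfolding xs_eq by (intro pnorm_mono pos bound d g)
    also have "\<dots> = ennreal C * pnorm p xs g x"
      unfolding xs_eq by (intro pnorm_cmult pos) measurable
    finally show "pnorm p xs (coord_max \<delta> L i g) x \<le> ennreal C * pnorm p xs g x" .
  qed (rule C)
qed

lemma borel_measurable_fold_coord_max [measurable]:
  "g \<in> borel_measurable borel \<Longrightarrow> fold (coord_max \<delta> L) ys g \<in> borel_measurable borel"
  by (induction ys arbitrary: g) auto

text \<open>Each one-dimensional operator is bounded on the full mixed norm, so the bounds multiply
  whatever the order of the operators.\<close>

theorem pnorm_strong_max:
  assumes p: "\<And>k. k \<in> set xs \<Longrightarrow> 1 < p $ k" and xs: "distinct xs" "set ys \<subseteq> set xs"
  shows "\<exists>C\<ge>0. \<forall>\<delta> L g x. 0 < \<delta> \<longrightarrow> g \<in> borel_measurable borel \<longrightarrow>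
      pnorm p xs (fold (coord_max \<delta> L) ys g) x \<le> ennreal C * pnorm p xs g x"
  using xs(2)
proof (induction ys)
  case Nil
  show ?case by (intro exI[of _ 1]) auto
next
  case (Cons i ys)
  obtain C where C: "0 \<le> C" and 1: "\<And>\<delta> L g x. 0 < \<delta> \<Longrightarrow> g \<in> borel_measurable borel \<Longrightarrow>
      pnorm p xs (fold (coord_max \<delta> L) ys g) x \<le> ennreal C * pnorm p xs g x"
    using Cons by auto
  obtain C' where C': "0 \<le> C'" and 2: "\<And>\<delta> L g x. 0 < \<delta> \<Longrightarrow> g \<in> borel_measurable borel \<Longrightarrow>
      pnorm p xs (coord_max \<delta> L i g) x \<le> ennreal C' * pnorm p xs g x"
    using pnorm_coord_max[OF p xs(1), of i] Cons.prems by auto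
  show ?case
  proof (intro exI conjI allI impI)
    show "0 \<le> C * C'" using C C' by simp
    fix \<delta> :: real and L and g :: "real ^ 'a \<Rightarrow> ennreal" and x
    assume d: "0 < \<delta>" and g [measurable]: "g \<in> borel_measurable borel"
    have "pnorm p xs (fold (coord_max \<delta> L) (i # ys) g) x \<le> ennreal C * pnorm p xs (coord_max \<delta> L i g) x"
      using 1[OF d, of "coord_max \<delta> L i g"] by simp
    also have "\<dots> \<le> ennreal C * (ennreal C' * pnorm p xs g x)"
      by (intro mult_left_mono 2 d g) simp
    finally show "pnorm p xs (fold (coord_max \<delta> L) (i # ys) g) x \<le> ennreal (C * C') * pnorm p xs g x"
      using C C' by (simp add: ennreal_mult mult.assoc)
  qed
qed

section \<open>Iterated integrals and null sets\<close>

lemma borel_measurable_vec_lambda: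
  fixes f :: "'n::finite \<Rightarrow> 'a \<Rightarrow> real"
  assumes [measurable]: "\<And>k. f k \<in> borel_measurable M"
  shows "(\<lambda>z. \<chi> k. f k z) \<in> borel_measurable M"
proof -
  have "(\<lambda>z. \<chi> k. f k z) = (\<lambda>z. \<Sum>k\<in>UNIV. f k z *\<^sub>R axis k 1)"
    by (auto simp: fun_eq_iff vec_eq_iff axis_def if_distrib cong: if_cong)
  then show ?thesis by simp
qed

lemma Basis_vec_real: "(Basis :: (real ^ 'n::finite) set) = range (\<lambda>k. axis k 1)"
  by (auto simp: Basis_vec_def)

lemma prod_Basis_vec: "(\<Prod>b\<in>(Basis :: (real ^ 'n::finite) set). x \<bullet> b) = (\<Prod>k\<in>UNIV. x $ k)"
proof -
  have "inj (\<lambda>k :: 'n. axis k (1 :: real))"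
    by (auto simp: inj_on_def axis_eq_axis)
  then show ?thesis
    unfolding Basis_vec_real by (subst prod.reindex) (auto simp: inner_axis)
qed

lemma lborel_vec_eq:
  "distr (\<Pi>\<^sub>M k\<in>UNIV. lborel) borel (\<lambda>z. \<chi> k. z k) = (lborel :: (real ^ 'n::finite) measure)"
proof (rule lborel_eqI[symmetric])
  interpret product_sigma_finite "\<lambda>_ :: 'n. lborel :: real measure" ..
  have [measurable]: "(\<lambda>z. \<chi> k. z k) \<in> borel_measurable (\<Pi>\<^sub>M k\<in>(UNIV :: 'n set). (lborel :: real measure))"
    by (rule borel_measurable_vec_lambda) measurable
  fix l u :: "real ^ 'n"
  assume le: "\<And>b. b \<in> Basis \<Longrightarrow> l \<bullet> b \<le> u \<bullet> b"
  have le': "l $ k \<le> u $ k" for k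
    using le[of "axis k 1"] by (simp add: inner_axis Basis_vec_real)
  have "emeasure (distr (\<Pi>\<^sub>M k\<in>UNIV. lborel) borel (\<lambda>z. \<chi> k. z k)) (box l u) =
      emeasure (\<Pi>\<^sub>M k\<in>(UNIV :: 'n set). lborel) (\<Pi>\<^sub>E k\<in>UNIV. {l $ k<..<u $ k})"
    by (subst emeasure_distr) (auto intro!: arg_cong2[where f=emeasure] simp: mem_box_cart space_PiM PiE_def extensional_def Pi_iff)
  also have "\<dots> = (\<Prod>k\<in>UNIV. emeasure lborel {l $ k<..<u $ k})"
    by (rule emeasure_PiM) auto
  also have "\<dots> = ennreal (\<Prod>k\<in>UNIV. (u - l) $ k)"
    using le' by (simp add: prod_ennreal)
  finally show "emeasure (distr (\<Pi>\<^sub>M k\<in>UNIV. lborel) borel (\<lambda>z. \<chi> k. z k)) (box l u) = (\<Prod>b\<in>Basis. (u - l) \<bullet> b)"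
    by (simp only: prod_Basis_vec)
qed simp

text \<open>The weight sees the coordinate of the base point as well as the integration variable.
  Constant weights give iterated integrals over the whole space, indicators of |b - a| < r give
  integrals over cubes centred at x.\<close>

definition coord_integral ::
  "('n \<Rightarrow> real \<Rightarrow> real \<Rightarrow> ennreal) \<Rightarrow> 'n \<Rightarrow> (real ^ 'n \<Rightarrow> ennreal) \<Rightarrow> real ^ 'n::finite \<Rightarrow> ennreal" where
  "coord_integral w k g x = (\<integral>\<^sup>+s. w k (x $ k) s * g (vec_upd x k s) \<partial>lborel)"

lemma fold_coord_integral:
  fixes f :: "real ^ 'n::finite \<Rightarrow> ennreal"
  assumes xs: "distinct xs" and f [measurable]: "f \<in> borel_measurable borel"
    and w [measurable]: "\<And>k. (\<lambda>(a, b). w k a b) \<in> borel_measurable (borel \<Otimes>\<^sub>M borel)"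
  shows "fold (coord_integral w) xs f x =
    (\<integral>\<^sup>+z. (\<Prod>k\<in>set xs. w k (x $ k) (z k)) * f (\<chi> k. if k \<in> set xs then z k else x $ k)
      \<partial>(\<Pi>\<^sub>M k\<in>set xs. lborel))"
  using xs
proof (induction xs arbitrary: x rule: rev_induct)
  case Nil
  interpret product_sigma_finite "\<lambda>_ :: 'n. lborel :: real measure" ..
  show ?case by (simp add: space_PiM_empty emeasure_PiM_empty)
next
  case (snoc i xs)
  interpret product_sigma_finite "\<lambda>_ :: 'n. lborel :: real measure" ..
  have i: "i \<notin> set xs" and d: "distinct xs" using snoc.prems by auto
  let ?P = "\<Pi>\<^sub>M k\<in>set xs. (lborel :: real measure)"
  let ?G = "\<lambda>z. (\<Prod>k\<in>insert i (set xs). w k (x $ k) (z k)) * f (\<chi> k. if k \<in> insert i (set xs) then z k else x $ k)"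
  have [measurable]: "(\<lambda>z. \<chi> k. if k \<in> I then z k else x $ k) \<in> borel_measurable (\<Pi>\<^sub>M k\<in>I. (lborel :: real measure))" for I x
  proof (rule borel_measurable_vec_lambda)
    fix k show "(\<lambda>z. if k \<in> I then z k else x $ k) \<in> borel_measurable (\<Pi>\<^sub>M k\<in>I. (lborel :: real measure))"
      by (cases "k \<in> I") (auto intro: measurable_component_singleton[where M="\<lambda>_. lborel", simplified])
  qed
  have [measurable]: "(\<lambda>z. w k a (z k)) \<in> borel_measurable (\<Pi>\<^sub>M k\<in>I. (lborel :: real measure))" if "k \<in> I" for I a k
  proof -
    have "(\<lambda>z. z k) \<in> borel_measurable (\<Pi>\<^sub>M k\<in>I. (lborel :: real measure))"
      using that measurable_component_singleton[of k I "\<lambda>_. lborel :: real measure"] by simp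
    then show ?thesis by measurable
  qed
  have prod_meas [measurable]: "(\<lambda>z. \<Prod>k\<in>I. w k (x $ k) (z k)) \<in> borel_measurable (\<Pi>\<^sub>M k\<in>I. (lborel :: real measure))" for I x
    by (intro borel_measurable_prod_ennreal) measurable
  have "fold (coord_integral w) (xs @ [i]) f x =
     (\<integral>\<^sup>+s. w i (x $ i) s * (\<integral>\<^sup>+z. (\<Prod>k\<in>set xs. w k (vec_upd x i s $ k) (z k)) *
        f (\<chi> k. if k \<in> set xs then z k else vec_upd x i s $ k) \<partial>?P) \<partial>lborel)"
    by (simp add: coord_integral_def snoc.IH[OF d])
  also have "\<dots> = (\<integral>\<^sup>+s. \<integral>\<^sup>+z. ?G (z(i := s)) \<partial>?P \<partial>lborel)"
  proof (intro nn_integral_cong)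
    fix s
    have "w i (x $ i) s * (\<integral>\<^sup>+z. (\<Prod>k\<in>set xs. w k (vec_upd x i s $ k) (z k)) *
        f (\<chi> k. if k \<in> set xs then z k else vec_upd x i s $ k) \<partial>?P) =
      (\<integral>\<^sup>+z. w i (x $ i) s * ((\<Prod>k\<in>set xs. w k (vec_upd x i s $ k) (z k)) *
        f (\<chi> k. if k \<in> set xs then z k else vec_upd x i s $ k)) \<partial>?P)"
      by (rule nn_integral_cmult[symmetric]) measurable
    also have "\<dots> = (\<integral>\<^sup>+z. ?G (z(i := s)) \<partial>?P)"
    proof (intro nn_integral_cong)
      fix z
      \<comment> \<open>Replacing coordinate i of the base point leaves the weights of the other
        coordinates unchanged.\<close>
      have 1: "(\<Prod>k\<in>set xs. w k (vec_upd x i s $ k) (z k)) = (\<Prod>k\<in>set xs. w k (x $ k) ((z(i := s)) k))"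
        using i by (intro prod.cong) auto
      have 2: "(\<chi> k. if k \<in> set xs then z k else vec_upd x i s $ k) =
          (\<chi> k. if k \<in> insert i (set xs) then (z(i := s)) k else x $ k)"
        using i by (auto simp: vec_eq_iff)
      show "w i (x $ i) s * ((\<Prod>k\<in>set xs. w k (vec_upd x i s $ k) (z k)) *
        f (\<chi> k. if k \<in> set xs then z k else vec_upd x i s $ k)) = ?G (z(i := s))"
        unfolding 1 2 using i by (simp add: mult.assoc)
    qed
    finally show "w i (x $ i) s * (\<integral>\<^sup>+z. (\<Prod>k\<in>set xs. w k (vec_upd x i s $ k) (z k)) *
        f (\<chi> k. if k \<in> set xs then z k else vec_upd x i s $ k) \<partial>?P) = (\<integral>\<^sup>+z. ?G (z(i := s)) \<partial>?P)" .
  qed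
  also have "\<dots> = (\<integral>\<^sup>+z. ?G z \<partial>(\<Pi>\<^sub>M k\<in>insert i (set xs). lborel))"
    by (rule product_nn_integral_insert_rev[symmetric]) (simp, rule i, measurable)
  finally show ?case by simp
qed

theorem fold_coord_integral_UNIV:
  fixes f :: "real ^ 'n::finite \<Rightarrow> ennreal"
  assumes xs: "distinct xs" "set xs = UNIV" and f [measurable]: "f \<in> borel_measurable borel"
    and w [measurable]: "\<And>k. (\<lambda>(a, b). w k a b) \<in> borel_measurable (borel \<Otimes>\<^sub>M borel)"
  shows "fold (coord_integral w) xs f x = (\<integral>\<^sup>+y. (\<Prod>k\<in>UNIV. w k (x $ k) (y $ k)) * f y \<partial>lborel)"
proof -
  have [measurable]: "(\<lambda>z. \<chi> k. z k) \<in> borel_measurable (\<Pi>\<^sub>M k\<in>(UNIV :: 'n set). (lborel :: real measure))"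
    by (rule borel_measurable_vec_lambda) measurable
  have "(\<integral>\<^sup>+y. (\<Prod>k\<in>UNIV. w k (x $ k) (y $ k)) * f y \<partial>lborel)
    = (\<integral>\<^sup>+z. (\<Prod>k\<in>UNIV. w k (x $ k) ((\<chi> k. z k) $ k)) * f (\<chi> k. z k) \<partial>(\<Pi>\<^sub>M k\<in>UNIV. lborel))"
    unfolding lborel_vec_eq[symmetric] by (rule nn_integral_distr) measurable
  then show ?thesis
    using fold_coord_integral[OF xs(1) f w, where x=x] xs(2) by simp
qed

text \<open>Almost every line in direction i meets a null set N in a null set. Tonelli is applied to
  the translates of N along the axis, which have measure zero by translation invariance; this needs
  no splitting of the space into coordinates.\<close>

lemma AE_partial_Lp_cong:
  fixes f g :: "real ^ 'n::finite \<Rightarrow> ennreal"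
  assumes "AE x in lborel. f x = g x"
  shows "AE x in lborel. partial_Lp q i f x = partial_Lp q i g x"
proof -
  obtain N where N: "\<And>x. x \<in> space lborel - N \<Longrightarrow> f x = g x" "N \<in> null_sets lborel"
    by (rule AE_E3[OF assms]) (rule that)
  then have N_meas [measurable]: "N \<in> sets borel" by auto
  let ?e = "axis i 1 :: real ^ 'n"
  have shift: "(\<integral>\<^sup>+x. indicator N (x + c) \<partial>lborel) = (0 :: ennreal)" for c
  proof -
    have "(\<integral>\<^sup>+x. indicator N (x + c) \<partial>lborel) = (\<integral>\<^sup>+x. indicator N x \<partial>distr lborel borel (\<lambda>x. c + x))"
      by (subst nn_integral_distr) (auto simp: add.commute)
    also have "\<dots> = 0" using N by (simp add: lborel_distr_plus null_sets_def)
    finally show ?thesis .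
  qed
  have meas: "(\<lambda>x. \<integral>\<^sup>+s. indicator N (x + s *\<^sub>R ?e) \<partial>lborel :: ennreal) \<in> borel_measurable borel"
    by measurable
  have "(\<integral>\<^sup>+x. \<integral>\<^sup>+s. indicator N (x + s *\<^sub>R ?e) \<partial>lborel \<partial>lborel) =
    (\<integral>\<^sup>+s. \<integral>\<^sup>+x. indicator N (x + s *\<^sub>R ?e) \<partial>lborel \<partial>lborel)"
    by (rule lborel_pair.Fubini'[symmetric]) measurable
  also have "\<dots> = 0" by (simp add: shift)
  finally have "AE x in lborel. (\<integral>\<^sup>+s. indicator N (x + s *\<^sub>R ?e) \<partial>lborel) = 0"
    by (subst (asm) nn_integral_0_iff_AE) (simp_all add: meas)
  then show ?thesis
  proof eventually_elim
    case (elim x)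
    have upd: "vec_upd x i s = x + (- (x $ i) + s) *\<^sub>R ?e" for s
      by (auto simp: vec_eq_iff axis_def)
    have "(\<integral>\<^sup>+s. indicator N (vec_upd x i s) \<partial>lborel) = (\<integral>\<^sup>+s. indicator N (x + s *\<^sub>R ?e) \<partial>lborel)"
      unfolding upd using nn_integral_real_affine[of "\<lambda>s. indicator N (x + s *\<^sub>R ?e)" 1 "- (x $ i)"] by simp
    then have "(\<integral>\<^sup>+s. indicator N (vec_upd x i s) \<partial>lborel) = 0" using elim by simp
    then have "AE s in lborel. vec_upd x i s \<notin> N"
      by (subst (asm) nn_integral_0_iff_AE) (measurable, simp add: indicator_eq_0_iff)
    then have "AE s in lborel. ennpowr (f (vec_upd x i s)) q = ennpowr (g (vec_upd x i s)) q"
      by eventually_elim (use N in auto)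
    then show ?case
      unfolding partial_Lp_def by (subst nn_integral_cong_AE) auto
  qed
qed

lemma AE_pnorm_cong:
  assumes "AE x in lborel. f x = g x"
  shows "AE x in lborel. pnorm p l f x = pnorm p l g x"
proof (induction l rule: rev_induct)
  case (snoc k l)
  then show ?case unfolding pnorm_snoc by (rule AE_partial_Lp_cong)
qed (simp add: assms)

lemma pnorm_indep:
  assumes "\<And>i. i \<notin> set l \<Longrightarrow> x $ i = y $ i"
  shows "pnorm p l f x = pnorm p l f y"
  using assms
proof (induction l arbitrary: x y rule: rev_induct)
  case Nil
  then have "x = y" by (simp add: vec_eq_iff)
  then show ?case by simp
next
  case (snoc k l)
  have "pnorm p l f (vec_upd x k s) = pnorm p l f (vec_upd y k s)" for s
    using snoc.prems by (intro snoc.IH) auto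
  then show ?case by (simp add: pnorm_snoc partial_Lp_def)
qed

text \<open>With every coordinate used up the two norms are constant functions, so agreement almost
  everywhere already means agreement at x.\<close>

lemma pnorm_cong_AE:
  assumes "AE x in lborel. f x = g x" "set l = UNIV"
  shows "pnorm p l f x = pnorm p l g x"
proof -
  have "ae_filter (lborel :: (real ^ 'a) measure) \<noteq> bot"
    by (simp add: ae_filter_eq_bot_iff)
  then obtain y where "pnorm p l f y = pnorm p l g y"
    using eventually_happens'[OF _ AE_pnorm_cong[OF assms(1), of p l]] by blast
  then show ?thesis using pnorm_indep[of l x y p] assms(2) by simp
qed

section \<open>Monotone limits, powers and Hoelder bounds for mixed norms\<close>

lemma pnorm_SUP:
  fixes \<phi> :: "nat \<Rightarrow> real ^ 'n::finite \<Rightarrow> ennreal"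
  assumes "\<And>i. i \<in> set l \<Longrightarrow> 0 < p $ i" "incseq \<phi>" and [measurable]: "\<And>n. \<phi> n \<in> borel_measurable borel"
  shows "pnorm p l (\<lambda>x. SUP n. \<phi> n x) x = (SUP n. pnorm p l (\<phi> n) x)"
  using assms(1)
proof (induction l arbitrary: x rule: rev_induct)
  case (snoc k l)
  have k: "0 < p $ k" using snoc.prems by simp
  have mono: "pnorm p l (\<phi> m) x \<le> pnorm p l (\<phi> n) x" if "m \<le> n" for m n x
    using snoc.prems assms(2) that by (intro pnorm_mono) (auto simp: incseq_def le_fun_def)
  have "pnorm p l (\<lambda>x. SUP n. \<phi> n x) = (\<lambda>x. SUP n. pnorm p l (\<phi> n) x)"
    using snoc by auto
  then have "pnorm p (l @ [k]) (\<lambda>x. SUP n. \<phi> n x) x =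
     ennpowr (\<integral>\<^sup>+s. (SUP n. ennpowr (pnorm p l (\<phi> n) (vec_upd x k s)) (p $ k)) \<partial>lborel) (1 / p $ k)"
    using k by (simp add: pnorm_snoc partial_Lp_def ennpowr_SUP)
  also have "\<dots> = ennpowr (SUP n. \<integral>\<^sup>+s. ennpowr (pnorm p l (\<phi> n) (vec_upd x k s)) (p $ k) \<partial>lborel) (1 / p $ k)"
    using k by (subst nn_integral_monotone_convergence_SUP)
      (auto simp: incseq_def le_fun_def intro!: ennpowr_mono mono)
  also have "\<dots> = (SUP n. pnorm p (l @ [k]) (\<phi> n) x)"
    using k by (simp add: ennpowr_SUP pnorm_snoc partial_Lp_def)
  finally show ?case .
qed simp

text \<open>In one coordinate, raising to \<theta> and then to p2 gives the power p1, and the root 1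
  / p2 = \<theta> / p1 leaves the \<theta>-th power outside. The proportionality of the two exponent
  vectors enters here.\<close>

lemma pnorm_ennpowr:
  assumes "\<And>i. i \<in> set l \<Longrightarrow> 0 < p1 $ i \<and> p1 $ i = \<theta> * p2 $ i" "0 < \<theta>"
  shows "pnorm p2 l (\<lambda>z. ennpowr (g z) \<theta>) x = ennpowr (pnorm p1 l g x) \<theta>"
  using assms(1)
proof (induction l arbitrary: x rule: rev_induct)
  case (snoc k l)
  have k: "0 < p1 $ k" "p1 $ k = \<theta> * p2 $ k" using snoc.prems[of k] by simp_all
  have "1 / p2 $ k = 1 / (p1 $ k) * \<theta>" using k assms(2) by (auto simp: field_simps)
  moreover have "pnorm p2 l (\<lambda>z. ennpowr (g z) \<theta>) = (\<lambda>x. ennpowr (pnorm p1 l g x) \<theta>)"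
    by (intro ext snoc.IH snoc.prems) simp
  ultimately show ?case
    by (simp only: pnorm_snoc partial_Lp_def ennpowr_ennpowr k(2)[symmetric])
qed simp

lemma pnorm_eq_0_coord:
  assumes "k \<notin> set l" "\<And>i. i \<in> set l \<Longrightarrow> 0 < p $ i" "\<And>z. z $ k = x $ k \<Longrightarrow> f z = 0"
  shows "pnorm p l f x = 0"
proof -
  have "pnorm p l f x = pnorm p l (\<lambda>z. 0 * f z) x"
    using assms by (intro pnorm_cong_coord[of k]) auto
  also have "\<dots> = pnorm p l (\<lambda>z. 0 * 0) x" by simp
  also have "\<dots> = 0 * pnorm p l (\<lambda>z. 0) x" using assms(2) by (intro pnorm_cmult) auto
  finally show ?thesis by simp
qed

text \<open>Jensen's inequality for the uniform distribution on the interval, multiplied back by the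
  length d.\<close>

lemma nn_integral_interval_le_Lp:
  fixes h :: "real \<Rightarrow> ennreal"
  assumes q: "1 \<le> q" and l: "0 < d" and [measurable]: "h \<in> borel_measurable borel"
    and supp: "\<And>s. s \<notin> {a..<a + d} \<Longrightarrow> h s = 0"
  shows "(\<integral>\<^sup>+s. h s \<partial>lborel) \<le> ennreal (d powr (1 - 1 / q)) * ennpowr (\<integral>\<^sup>+s. ennpowr (h s) q \<partial>lborel) (1 / q)"
proof -
  let ?w = "\<lambda>s. ennreal (1 / d) * indicator {a..<a + d} s"
  have w: "(\<integral>\<^sup>+s. ?w s \<partial>lborel) = 1"
    using l by (subst nn_integral_cmult) (auto simp: ennreal_mult[symmetric])
  have hw: "h s * ?w s = ennreal (1 / d) * h s" "ennpowr (h s) q * ?w s = ennreal (1 / d) * ennpowr (h s) q" for s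
    using supp[of s] by (auto simp: indicator_def mult.commute)
  have "ennpowr (\<integral>\<^sup>+s. h s * ?w s \<partial>lborel) q \<le> (\<integral>\<^sup>+s. ennpowr (h s) q * ?w s \<partial>lborel)"
    by (rule ennpowr_nn_integral_le[OF q]) (measurable, simp only: w order_refl)
  then have "ennpowr (ennreal (1 / d) * (\<integral>\<^sup>+s. h s \<partial>lborel)) q \<le> ennreal (1 / d) * (\<integral>\<^sup>+s. ennpowr (h s) q \<partial>lborel)"
    unfolding hw by (simp add: nn_integral_cmult)
  then have "ennreal (1 / d) * (\<integral>\<^sup>+s. h s \<partial>lborel) \<le> ennpowr (ennreal (1 / d) * (\<integral>\<^sup>+s. ennpowr (h s) q \<partial>lborel)) (1 / q)"
    using q by (subst (asm) ennpowr_le_iff_le_root) auto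
  also have "\<dots> = ennreal ((1 / d) powr (1 / q)) * ennpowr (\<integral>\<^sup>+s. ennpowr (h s) q \<partial>lborel) (1 / q)"
    using q l by (simp add: ennpowr_mult ennpowr_ennreal)
  finally have "ennreal d * (ennreal (1 / d) * (\<integral>\<^sup>+s. h s \<partial>lborel))
     \<le> ennreal d * (ennreal ((1 / d) powr (1 / q)) * ennpowr (\<integral>\<^sup>+s. ennpowr (h s) q \<partial>lborel) (1 / q))"
    by (rule mult_left_mono) simp
  moreover have "ennreal d * ennreal (1 / d) = 1" using l by (simp add: ennreal_mult[symmetric])
  moreover have "ennreal d * ennreal ((1 / d) powr (1 / q)) = ennreal (d powr (1 - 1 / q))"
    using l by (simp add: ennreal_mult[symmetric] powr_diff powr_divide)
  ultimately show ?thesis by (simp only: mult.assoc[symmetric] mult_1_left)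
qed

definition cell :: "real \<Rightarrow> real ^ 'n \<Rightarrow> (real ^ 'n::finite) set" where
  "cell d a = {x. \<forall>k. a $ k \<le> x $ k \<and> x $ k < a $ k + d}"

lemma sets_cell' [measurable]: "cell d a \<in> sets borel"
proof -
  have "cell d a = (\<Inter>k. {x \<in> space borel. a $ k \<le> x $ k \<and> x $ k < a $ k + d})"
    by (auto simp: cell_def)
  also have "\<dots> \<in> sets borel"
    by (intro sets.finite_INT) (simp, simp, measurable)
  finally show ?thesis .
qed

text \<open>Hoelder's inequality one coordinate at a time. The norm in the coordinates already
  treated still vanishes off the k-th side of the cell, by \<open>pnorm_eq_0_coord\<close>, so the
  next step again takes place on an interval of length d.\<close>

lemma iterated_integral_le_pnorm:
  assumes p: "\<And>i. i \<in> set l \<Longrightarrow> 1 \<le> p $ i" and l: "0 < d" and [measurable]: "\<phi> \<in> borel_measurable borel"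
    and supp: "\<And>z. z \<notin> cell d a \<Longrightarrow> \<phi> z = 0" and "distinct xs" "set xs \<subseteq> set l"
  shows "fold (coord_integral (\<lambda>_ _ _. 1)) xs \<phi> x \<le> ennreal (\<Prod>k\<in>set xs. d powr (1 - 1 / p $ k)) * pnorm p xs \<phi> x"
  using assms(5,6)
proof (induction xs arbitrary: x rule: rev_induct)
  case (snoc k xs)
  have pos: "0 < p $ i" if "i \<in> set xs" for i
    using p[of i] that snoc.prems(2) by auto
  have k: "1 \<le> p $ k" "k \<notin> set xs" using snoc.prems p by auto
  let ?c = "\<Prod>k\<in>set xs. d powr (1 - 1 / p $ k)"
  have c: "0 \<le> ?c" by (intro prod_nonneg) simp
  have "fold (coord_integral (\<lambda>_ _ _. 1)) (xs @ [k]) \<phi> x \<le> (\<integral>\<^sup>+s. ennreal ?c * pnorm p xs \<phi> (vec_upd x k s) \<partial>lborel)"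
    using snoc.prems by (auto simp: coord_integral_def intro!: nn_integral_mono snoc.IH)
  also have "\<dots> = ennreal ?c * (\<integral>\<^sup>+s. pnorm p xs \<phi> (vec_upd x k s) \<partial>lborel)"
    by (rule nn_integral_cmult) measurable
  also have "(\<integral>\<^sup>+s. pnorm p xs \<phi> (vec_upd x k s) \<partial>lborel)
      \<le> ennreal (d powr (1 - 1 / p $ k)) * ennpowr (\<integral>\<^sup>+s. ennpowr (pnorm p xs \<phi> (vec_upd x k s)) (p $ k) \<partial>lborel) (1 / p $ k)"
  proof (rule nn_integral_interval_le_Lp[OF k(1) l])
    show "pnorm p xs \<phi> (vec_upd x k s) = 0" if "s \<notin> {a $ k..<a $ k + d}" for s
      using k pos that by (intro pnorm_eq_0_coord[of k] supp) (auto simp: cell_def)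
  qed measurable
  also have "ennreal ?c * (ennreal (d powr (1 - 1 / p $ k)) * ennpowr (\<integral>\<^sup>+s. ennpowr (pnorm p xs \<phi> (vec_upd x k s)) (p $ k) \<partial>lborel) (1 / p $ k))
     = ennreal (\<Prod>k\<in>set (xs @ [k]). d powr (1 - 1 / p $ k)) * pnorm p (xs @ [k]) \<phi> x"
    using k c by (simp add: pnorm_snoc partial_Lp_def ennreal_mult ac_simps)
  finally show ?case by (simp add: mult_left_mono)
qed simp

lemma nn_integral_cell_le_pnorm:
  fixes \<phi> :: "real ^ 'n::finite \<Rightarrow> ennreal"
  assumes p: "\<And>i. 1 \<le> p $ i" and l: "0 < d" and [measurable]: "\<phi> \<in> borel_measurable borel"
    and xs: "distinct xs" "set xs = UNIV"
  shows "(\<integral>\<^sup>+y. \<phi> y * indicator (cell d a) y \<partial>lborel)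
    \<le> ennreal (d powr (real CARD('n) - (\<Sum>k\<in>UNIV. 1 / p $ k))) * pnorm p xs (\<lambda>y. \<phi> y * indicator (cell d a) y) x"
proof -
  have m: "(\<lambda>y. \<phi> y * indicator (cell d a) y) \<in> borel_measurable borel" by measurable
  have w: "(\<lambda>(a, b). 1 :: ennreal) \<in> borel_measurable ((borel :: real measure) \<Otimes>\<^sub>M (borel :: real measure))"
    by measurable
  have "(\<integral>\<^sup>+y. \<phi> y * indicator (cell d a) y \<partial>lborel) =
      fold (coord_integral (\<lambda>_ _ _. 1)) xs (\<lambda>y. \<phi> y * indicator (cell d a) y) x"
    by (subst fold_coord_integral_UNIV[OF xs m w]) simp
  also have "\<dots> \<le> ennreal (\<Prod>k\<in>set xs. d powr (1 - 1 / p $ k)) * pnorm p xs (\<lambda>y. \<phi> y * indicator (cell d a) y) x"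
    using p l xs by (intro iterated_integral_le_pnorm[of xs _ _ _ a]) auto
  also have "(\<Prod>k\<in>set xs. d powr (1 - 1 / p $ k)) = d powr (real CARD('n) - (\<Sum>k\<in>UNIV. 1 / p $ k))"
    using l unfolding xs by (simp add: powr_sum[symmetric] sum_subtractf)
  finally show ?thesis .
qed

lemma pnorm_indicator_cell_le:
  assumes p: "\<And>i. i \<in> set xs \<Longrightarrow> 0 < p $ i" and l: "0 < d" and "distinct xs"
  shows "pnorm p xs (indicator (cell d a)) x \<le> ennreal (\<Prod>k\<in>set xs. d powr (1 / p $ k))"
  using assms(1,3)
proof (induction xs arbitrary: x rule: rev_induct)
  case (snoc k xs)
  have k: "0 < p $ k" "k \<notin> set xs" and pos: "\<And>i. i \<in> set xs \<Longrightarrow> 0 < p $ i"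
    using snoc.prems by auto
  let ?c = "\<Prod>k\<in>set xs. d powr (1 / p $ k)"
  have c: "0 \<le> ?c" by (intro prod_nonneg) simp
  have "pnorm p xs (indicator (cell d a)) (vec_upd x k s) \<le> ennreal ?c * indicator {a $ k..<a $ k + d} s" for s
  proof (cases "s \<in> {a $ k..<a $ k + d}")
    case False
    then have "pnorm p xs (indicator (cell d a)) (vec_upd x k s) = 0"
      using k pos by (intro pnorm_eq_0_coord[of k]) (auto simp: cell_def indicator_def)
    then show ?thesis by simp
  qed (use snoc in simp)
  then have "pnorm p (xs @ [k]) (indicator (cell d a)) x \<le>
      ennpowr (\<integral>\<^sup>+s. ennpowr (ennreal ?c * indicator {a $ k..<a $ k + d} s) (p $ k) \<partial>lborel) (1 / p $ k)"
    unfolding pnorm_snoc partial_Lp_def using k by (intro ennpowr_mono nn_integral_mono) auto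
  also have "(\<integral>\<^sup>+s. ennpowr (ennreal ?c * indicator {a $ k..<a $ k + d} s) (p $ k) \<partial>lborel) =
      (\<integral>\<^sup>+s. ennpowr (ennreal ?c) (p $ k) * indicator {a $ k..<a $ k + d} s \<partial>lborel)"
    by (intro nn_integral_cong) (auto simp: indicator_def)
  also have "\<dots> = ennpowr (ennreal ?c) (p $ k) * ennreal d"
    using l by (subst nn_integral_cmult) auto
  also have "ennpowr \<dots> (1 / p $ k) = ennreal ?c * ennpowr (ennreal d) (1 / p $ k)"
    using k by (simp add: ennpowr_mult)
  also have "\<dots> = ennreal (\<Prod>k\<in>set (xs @ [k]). d powr (1 / p $ k))"
    using k c l by (simp add: ennpowr_ennreal ennreal_mult mult.commute)
  finally show ?case .
qed (simp add: indicator_def)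

section \<open>Decomposition of the Riesz kernel\<close>

text \<open>The bound keeps track of v because shifting the index replaces v by 2 v. The constant K
  = 1 / (1 - 2^(-a)) is the solution of 1 + K 2^(-a) = K, which closes the induction.\<close>

lemma geometric_sum_above:
  assumes a: "0 < a" and v: "0 < v"
  shows "(\<Sum>i\<le>L. if 1 \<le> 2 ^ i * v then (2 ^ i * v) powr (- a) else 0) \<le>
    1 / (1 - 2 powr (- a)) * (if 1 \<le> v then v powr (- a) else (1 :: real))"
  using v
proof (induction L arbitrary: v)
  case 0
  have lt: "2 powr (- a) < (1 :: real)" using a by (simp add: powr_less_one)
  then have "1 \<le> 1 / (1 - 2 powr (- a))" by simp
  then show ?case using 0 lt mult_right_mono[of 1 "1 / (1 - 2 powr (- a))" "v powr (- a)"] by auto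
next
  case (Suc L)
  define K where "K = 1 / (1 - 2 powr (- a))"
  have lt: "2 powr (- a) < (1 :: real)" using a by (simp add: powr_less_one)
  then have "K * (1 - 2 powr (- a)) = 1" using a by (simp add: K_def)
  then have "K - K * 2 powr (- a) = 1" by (simp only: right_diff_distrib mult_1_right)
  then have K: "1 + K * 2 powr (- a) = K" "0 < K" using lt by (linarith, simp add: K_def)
  let ?f = "\<lambda>v i. if 1 \<le> 2 ^ i * v then (2 ^ i * v) powr (- a) else (0 :: real)"
  have "(\<Sum>i\<le>L. ?f v (Suc i)) = (\<Sum>i\<le>L. ?f (2 * v) i)"
    by (intro sum.cong) (simp_all add: ac_simps)
  also have "\<dots> \<le> K * (if 1 \<le> 2 * v then (2 * v) powr (- a) else 1)"
    using Suc.IH[of "2 * v"] Suc.prems by (simp add: K_def)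
  finally have tail: "(\<Sum>i\<le>L. ?f v (Suc i)) \<le> K * (if 1 \<le> 2 * v then (2 * v) powr (- a) else 1)" .
  have "(\<Sum>i\<le>Suc L. ?f v i) = ?f v 0 + (\<Sum>i\<le>L. ?f v (Suc i))"
    by (rule sum.atMost_Suc_shift)
  also have "\<dots> \<le> ?f v 0 + K * (if 1 \<le> 2 * v then (2 * v) powr (- a) else 1)"
    by (intro add_left_mono tail)
  also have "?f v 0 + K * (if 1 \<le> 2 * v then (2 * v) powr (- a) else 1) \<le> K * (if 1 \<le> v then v powr (- a) else 1)"
  proof (cases "1 \<le> v")
    case True
    have "v powr (- a) + K * (2 * v) powr (- a) = v powr (- a) * (1 + K * 2 powr (- a))"
      using True by (simp add: powr_mult algebra_simps)
    then show ?thesis using True K by simp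
  next
    case False
    have "(2 * v) powr (- a) \<le> 1" if "1 \<le> 2 * v"
      using powr_mono2'[of "- a" 1 "2 * v"] that a by simp
    then show ?thesis using False K by (auto simp: mult_left_le)
  qed
  finally show ?case by (simp add: K_def)
qed

text \<open>With k = 1 / (2^b - 1), the subtracted term k v^b makes the induction exact while 2 v <
  1: the first summand v^b equals k (2 v)^b - k v^b.\<close>

lemma geometric_sum_below:
  assumes b: "0 < b" and v: "0 < v"
  shows "(\<Sum>i\<le>L. if 2 ^ i * v < 1 then (2 ^ i * v) powr b else 0) \<le>
    (if v < 1 then 1 + 1 / (2 powr b - 1) - 1 / (2 powr b - 1) * v powr b else (0 :: real))"
  using v
proof (induction L arbitrary: v)
  case 0
  have gt: "1 < 2 powr b" using b by simp
  define k where "k = 1 / (2 powr b - 1)"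
  have k: "0 < k" using gt by (simp add: k_def)
  have "(1 + k) * v powr b \<le> 1 + k" if "v < 1"
    using that 0 b k by (simp add: powr_le1)
  then show ?case by (auto simp: k_def[symmetric] algebra_simps)
next
  case (Suc L)
  have gt: "1 < 2 powr b" using b by simp
  define k where "k = 1 / (2 powr b - 1)"
  have k: "0 < k" "k * (2 powr b - 1) = 1" using gt b by (simp_all add: k_def)
  let ?f = "\<lambda>v i. if 2 ^ i * v < 1 then (2 ^ i * v) powr b else (0 :: real)"
  have "(\<Sum>i\<le>L. ?f v (Suc i)) = (\<Sum>i\<le>L. ?f (2 * v) i)"
    by (intro sum.cong) (simp_all add: ac_simps)
  also have "\<dots> \<le> (if 2 * v < 1 then 1 + k - k * (2 * v) powr b else 0)"
    unfolding k_def by (rule Suc.IH) (use Suc.prems in simp)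
  finally have tail: "(\<Sum>i\<le>L. ?f v (Suc i)) \<le> (if 2 * v < 1 then 1 + k - k * (2 * v) powr b else 0)" .
  have "(\<Sum>i\<le>Suc L. ?f v i) = ?f v 0 + (\<Sum>i\<le>L. ?f v (Suc i))"
    by (rule sum.atMost_Suc_shift)
  also have "\<dots> \<le> ?f v 0 + (if 2 * v < 1 then 1 + k - k * (2 * v) powr b else 0)"
    by (intro add_left_mono tail)
  also have "?f v 0 + (if 2 * v < 1 then 1 + k - k * (2 * v) powr b else 0) \<le> (if v < 1 then 1 + k - k * v powr b else 0)"
  proof (cases "2 * v < 1")
    case True
    have "v powr b = v powr b * (k * (2 powr b - 1))" using k by simp
    also have "\<dots> = k * (2 * v) powr b - k * v powr b"
      using Suc.prems by (simp add: powr_mult algebra_simps)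
    finally show ?thesis using True Suc.prems by simp
  next
    case False
    have "(1 + k) * v powr b \<le> 1 + k" if "v < 1"
      using that Suc.prems b k by (simp add: powr_le1)
    then show ?thesis using False by (auto simp: algebra_simps)
  qed
  finally show ?case unfolding k_def .
qed

text \<open>At scale w = \<open>2 ^ i / d\<close> the summand is at most both x w^(-a) and y w^b.
  Above the scale where these agree the first decays geometrically, below it the second does, and
  both parts are comparable to the common value.\<close>

lemma hedberg_sum_real:
  assumes a: "0 < a" and b: "0 < b" and x: "0 < x" and y: "0 < y" and d: "0 < (d :: real)"
  shows "(\<Sum>i\<le>L. (2 ^ i / d) powr (- a) * min x (y * (2 ^ i / d) powr (a + b)))
    \<le> (1 / (1 - 2 powr (- a)) + (1 + 1 / (2 powr b - 1))) * (x powr (b / (a + b)) * y powr (a / (a + b)))"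
proof -
  \<comment> \<open>The scale at which the two entries of the minimum coincide.\<close>
  define T where "T = (x / y) powr (1 / (a + b))"
  have T: "0 < T" using x y by (simp add: T_def)
  have Tc: "y * T powr (a + b) = x" using x y a b by (simp add: T_def powr_powr)
  have yTb: "y * T powr b = x * T powr (- a)"
    using T unfolding Tc[symmetric] by (simp add: powr_add powr_minus)
  have "a + b \<noteq> 0" using a b by simp
  then have e: "1 - a / (a + b) = b / (a + b)" by (simp add: field_simps)
  have S: "x * T powr (- a) = x powr (b / (a + b)) * y powr (a / (a + b))"
  proof -
    have "x * T powr (- a) = x powr 1 * x powr (- (a / (a + b))) * y powr (a / (a + b))"
      using x y by (simp add: T_def powr_powr powr_divide powr_minus field_simps)
    also have "x powr 1 * x powr (- (a / (a + b))) = x powr (b / (a + b))"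
      unfolding powr_add[symmetric] using e by simp
    finally show ?thesis .
  qed
  \<comment> \<open>Since \<open>2 ^ i / d = T * (2 ^ i * v)\<close>, the threshold becomes
    \<open>2 ^ i * v = 1\<close>.\<close>
  define v where "v = 1 / (d * T)"
  have v: "0 < v" using d T by (simp add: v_def)
  let ?g = "\<lambda>i. (if 1 \<le> 2 ^ i * v then (2 ^ i * v) powr (- a) else 0) + (if 2 ^ i * v < 1 then (2 ^ i * v) powr b else 0)"
  have summand: "(2 ^ i / d) powr (- a) * min x (y * (2 ^ i / d) powr (a + b)) \<le> x * T powr (- a) * ?g i" for i
  proof -
    define w where "w = 2 ^ i * v"
    have w: "0 < w" "2 ^ i / d = T * w" using v d T by (auto simp: w_def v_def)
    show ?thesis
    proof (cases "1 \<le> w")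
      case True
      have "(T * w) powr (- a) * min x (y * (T * w) powr (a + b)) \<le> (T * w) powr (- a) * x"
        by (intro mult_left_mono) auto
      also have "\<dots> = x * T powr (- a) * w powr (- a)" using T w by (simp add: powr_mult)
      finally show ?thesis using True unfolding w(2) w_def[symmetric] by simp
    next
      case False
      have "(T * w) powr (- a) * min x (y * (T * w) powr (a + b)) \<le> (T * w) powr (- a) * (y * (T * w) powr (a + b))"
        by (intro mult_left_mono) auto
      also have "\<dots> = y * ((T * w) powr (- a) * (T * w) powr (a + b))" by simp
      also have "\<dots> = y * (T * w) powr b" unfolding powr_add[symmetric] by simp
      also have "\<dots> = x * T powr (- a) * w powr b" using T w yTb by (simp add: powr_mult mult.assoc[symmetric])
      finally show ?thesis using False unfolding w(2) w_def[symmetric] by simp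
    qed
  qed
  have gt: "1 < 2 powr b" using b by simp
  have lt: "2 powr (- a) < (1 :: real)" using a by (simp add: powr_less_one)
  have v1: "v powr (- a) \<le> 1" if "1 \<le> v" using powr_mono2'[of "- a" 1 v] that a by simp
  have "(\<Sum>i\<le>L. ?g i) \<le> 1 / (1 - 2 powr (- a)) * (if 1 \<le> v then v powr (- a) else 1) +
     (if v < 1 then 1 + 1 / (2 powr b - 1) - 1 / (2 powr b - 1) * v powr b else 0)"
    unfolding sum.distrib by (intro add_mono geometric_sum_above geometric_sum_below a b v)
  also have "\<dots> \<le> 1 / (1 - 2 powr (- a)) * 1 + (1 + 1 / (2 powr b - 1))"
    using gt lt v1 by (intro add_mono mult_left_mono) auto
  finally have g: "(\<Sum>i\<le>L. ?g i) \<le> 1 / (1 - 2 powr (- a)) + (1 + 1 / (2 powr b - 1))" by simp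
  have "(\<Sum>i\<le>L. (2 ^ i / d) powr (- a) * min x (y * (2 ^ i / d) powr (a + b))) \<le> (\<Sum>i\<le>L. x * T powr (- a) * ?g i)"
    by (intro sum_mono summand)
  also have "\<dots> = x * T powr (- a) * (\<Sum>i\<le>L. ?g i)" by (rule sum_distrib_left[symmetric])
  also have "\<dots> \<le> x * T powr (- a) * (1 / (1 - 2 powr (- a)) + (1 + 1 / (2 powr b - 1)))"
    using x g by (intro mult_left_mono) auto
  finally show ?thesis by (simp only: S mult.commute)
qed

text \<open>The balancing scale exists for positive finite A and R; the values 0 and top are treated
  separately.\<close>

lemma hedberg_sum:
  assumes a: "0 < a" and b: "0 < b"
  shows "\<exists>C\<ge>0. \<forall>A R d L. 0 < d \<longrightarrow>
    (\<Sum>i\<le>L. ennreal ((2 ^ i / d) powr (- a)) * min A (R * ennreal ((2 ^ i / d) powr (a + b))))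
      \<le> ennreal C * (ennpowr A (b / (a + b)) * ennpowr R (a / (a + b)))"
proof (intro exI conjI allI impI)
  let ?C = "1 / (1 - 2 powr (- a)) + (1 + 1 / (2 powr b - 1))"
  have gt: "1 < 2 powr b" using b by simp
  have lt: "2 powr (- a) < (1 :: real)" using a by (simp add: powr_less_one)
  have C: "0 < ?C" using gt lt by (intro add_pos_pos) auto
  then show "0 \<le> ?C" by simp
  have "ennreal c * top = top" if "0 < c" for c using that by (simp add: ennreal_mult_top)
  from this[OF C] have Ctop: "ennreal ?C * top = top" .
  fix A R :: ennreal and d :: real and L :: nat
  assume d: "0 < d"
  let ?S = "\<Sum>i\<le>L. ennreal ((2 ^ i / d) powr (- a)) * min A (R * ennreal ((2 ^ i / d) powr (a + b)))"
  consider "A = 0 \<or> R = 0" | "A = top" "R \<noteq> 0" | "R = top" "A \<noteq> 0"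
    | x y where "A = ennreal x" "R = ennreal y" "0 < x" "0 < y"
    by (cases A; cases R) (auto simp: ennreal_eq_0_iff le_less)
  then show "?S \<le> ennreal ?C * (ennpowr A (b / (a + b)) * ennpowr R (a / (a + b)))"
  proof cases
    case 1
    then have S0: "?S = 0" by (intro sum.neutral) (auto simp: min_def)
    show ?thesis unfolding S0 by simp
  next
    case 2
    have eq: "ennpowr A (b / (a + b)) * ennpowr R (a / (a + b)) = top"
      using 2 by (simp add: ennreal_top_mult)
    show ?thesis unfolding eq Ctop by (rule top_greatest)
  next
    case 3
    have eq: "ennpowr A (b / (a + b)) * ennpowr R (a / (a + b)) = top"
      using 3 by (simp add: ennreal_mult_top)
    show ?thesis unfolding eq Ctop by (rule top_greatest)
  next
    case (4 x y)
    have "?S = (\<Sum>i\<le>L. ennreal ((2 ^ i / d) powr (- a) * min x (y * (2 ^ i / d) powr (a + b))))"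
    proof (intro sum.cong refl)
      fix i
      have "min A (R * ennreal ((2 ^ i / d) powr (a + b))) = ennreal (min x (y * (2 ^ i / d) powr (a + b)))"
        using 4 by (auto simp: min_def ennreal_mult[symmetric] ennreal_le_iff)
      then show "ennreal ((2 ^ i / d) powr (- a)) * min A (R * ennreal ((2 ^ i / d) powr (a + b))) =
        ennreal ((2 ^ i / d) powr (- a) * min x (y * (2 ^ i / d) powr (a + b)))"
        using 4 by (simp add: ennreal_mult)
    qed
    also have "\<dots> = ennreal (\<Sum>i\<le>L. (2 ^ i / d) powr (- a) * min x (y * (2 ^ i / d) powr (a + b)))"
      using 4 by (intro sum_ennreal) auto
    also have "\<dots> \<le> ennreal (?C * (x powr (b / (a + b)) * y powr (a / (a + b))))"
      using hedberg_sum_real[OF a b 4(3,4) d] by (rule ennreal_leI)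
    also have "\<dots> = ennreal ?C * (ennpowr A (b / (a + b)) * ennpowr R (a / (a + b)))"
      using 4 C by (simp add: ennpowr_ennreal ennreal_mult)
    finally show ?thesis .
  qed
qed

text \<open>A ball of the sup norm rather than a Euclidean one: as a product of intervals it suits
  iterated integrals and dyadic cubes.\<close>

definition cube_ball :: "real ^ 'n::finite \<Rightarrow> real \<Rightarrow> (real ^ 'n) set" where
  "cube_ball x r = {y. \<forall>k. \<bar>y $ k - x $ k\<bar> < r}"

lemma sets_cube_ball [measurable]: "cube_ball x r \<in> sets borel"
proof -
  have "cube_ball x r = (\<Inter>k. {y \<in> space borel. \<bar>y $ k - x $ k\<bar> < r})"
    by (auto simp: cube_ball_def)
  also have "\<dots> \<in> sets borel"
    by (intro sets.finite_INT) (simp, simp, measurable)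
  finally show ?thesis .
qed

section \<open>The kernel on dyadic shells\<close>

lemma ex_dyadic_below:
  assumes "1 < r" shows "\<exists>i. 2 ^ i < r \<and> r \<le> (2 :: real) ^ Suc i"
proof -
  define i where "i = (LEAST i. r \<le> 2 ^ Suc i)"
  obtain n where "r < 2 ^ n" using real_arch_pow[of 2 r] by auto
  also have "\<dots> \<le> 2 ^ Suc n" by simp
  finally have "r \<le> 2 ^ Suc n" by simp
  then have 1: "r \<le> 2 ^ Suc i" unfolding i_def by (rule LeastI)
  have "2 ^ i < r"
  proof (cases i)
    case (Suc j)
    then show ?thesis using not_less_Least[of j "\<lambda>i. r \<le> 2 ^ Suc i"] unfolding i_def[symmetric] by simp
  qed (use assms in simp)
  then show ?thesis using 1 by auto
qed

lemma ex_dyadic_above: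
  assumes "1 \<le> r" shows "\<exists>i. 2 ^ i \<le> r \<and> r < (2 :: real) ^ Suc i"
proof -
  define i where "i = (LEAST i. r < 2 ^ Suc i)"
  obtain n where "r < 2 ^ n" using real_arch_pow[of 2 r] by auto
  also have "\<dots> \<le> 2 ^ Suc n" by simp
  finally have "r < 2 ^ Suc n" .
  then have 1: "r < 2 ^ Suc i" unfolding i_def by (rule LeastI)
  have "2 ^ i \<le> r"
  proof (cases i)
    case (Suc j)
    then show ?thesis using not_less_Least[of j "\<lambda>i. r < 2 ^ Suc i"] unfolding i_def[symmetric] by simp
  qed (use assms in simp)
  then show ?thesis using 1 by auto
qed

definition kernel :: "real \<Rightarrow> real ^ 'n::finite \<Rightarrow> real ^ 'n \<Rightarrow> ennreal" where
  "kernel \<alpha> x y = ennreal (1 / norm (x - y) powr (real CARD('n) - \<alpha>))"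

lemma ennreal_term_le_suminf: "f i \<le> (\<Sum>i. f i)" for f :: "nat \<Rightarrow> ennreal"
  using sum_le_suminf[of f "{i}"] by simp

text \<open>Each y off the diagonal lies in one dyadic shell of the sup norm distance, and the
  single term of that shell already dominates: the kernel is at most its value at the inner radius,
  because the Euclidean norm exceeds the sup norm and the exponent is negative. Inside radius d the
  inner radius is d / 2^(i+1), whence \<open>Suc i\<close>.\<close>

lemma kernel_le:
  fixes x y :: "real ^ 'n::finite"
  assumes d: "0 < d" and a: "\<alpha> < real CARD('n)"
  shows "kernel \<alpha> x y \<le>
    (\<Sum>i. ennreal ((2 ^ Suc i / d) powr (real CARD('n) - \<alpha>)) * indicator (cube_ball x (d / 2 ^ i)) y) +
    (\<Sum>i. ennreal ((d * 2 ^ i) powr (\<alpha> - real CARD('n))) * indicator (cube_ball x (d * 2 ^ Suc i)) y)"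
    (is "_ \<le> suminf ?f + suminf ?g")
proof (cases "x = y")
  \<comment> \<open>On the diagonal the kernel has the default value 1 / 0 = 0.\<close>
  case True
  then show ?thesis by (simp add: kernel_def)
next
  case False
  let ?n = "real CARD('n)"
  define \<rho> where "\<rho> = infnorm (x - y)"
  have r: "0 < \<rho>" using False by (simp add: \<rho>_def infnorm_pos_lt)
  have rn: "\<rho> \<le> norm (x - y)" unfolding \<rho>_def by (rule infnorm_le_norm)
  have comp: "\<bar>y $ k - x $ k\<bar> \<le> \<rho>" for k
    using component_le_infnorm_cart[of "x - y" k] by (simp add: \<rho>_def abs_minus_commute)
  have kern: "kernel \<alpha> x y \<le> ennreal (c powr (\<alpha> - ?n))" if "0 < c" "c \<le> \<rho>" for c
  proof -
    have "kernel \<alpha> x y = ennreal (norm (x - y) powr (\<alpha> - ?n))"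
      unfolding kernel_def by (simp add: powr_minus_divide[symmetric])
    also have "\<dots> \<le> ennreal (c powr (\<alpha> - ?n))"
      using that rn a by (intro ennreal_leI powr_mono2') auto
    finally show ?thesis .
  qed
  show ?thesis
  proof (cases "\<rho> < d")
    case True
    then have "1 < d / \<rho>" using r by simp
    from ex_dyadic_below[OF this] obtain i where i: "2 ^ i < d / \<rho>" "d / \<rho> \<le> 2 ^ Suc i" by auto
    have 1: "\<rho> < d / 2 ^ i" "d / 2 ^ Suc i \<le> \<rho>" using i r d by (simp_all add: field_simps)
    have "kernel \<alpha> x y \<le> ennreal ((d / 2 ^ Suc i) powr (\<alpha> - ?n))"
      using 1 d by (intro kern) auto
    also have "(d / 2 ^ Suc i) powr (\<alpha> - ?n) = (2 ^ Suc i / d) powr (?n - \<alpha>)"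
      using d powr_minus_divide[of "d / 2 ^ Suc i" "?n - \<alpha>"] by (simp add: powr_divide)
    also have "ennreal ((2 ^ Suc i / d) powr (?n - \<alpha>)) = ?f i"
      using 1 order_le_less_trans[OF comp 1(1)] by (simp add: cube_ball_def)
    also have "\<dots> \<le> suminf ?f + suminf ?g" by (intro add_increasing2 ennreal_term_le_suminf) simp
    finally show ?thesis .
  next
    case False
    then have "1 \<le> \<rho> / d" using d by simp
    from ex_dyadic_above[OF this] obtain i where i: "2 ^ i \<le> \<rho> / d" "\<rho> / d < 2 ^ Suc i" by auto
    have 1: "d * 2 ^ i \<le> \<rho>" "\<rho> < d * 2 ^ Suc i" using i d by (simp_all add: field_simps)
    have "kernel \<alpha> x y \<le> ennreal ((d * 2 ^ i) powr (\<alpha> - ?n))"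
      using 1 d by (intro kern) auto
    also have "\<dots> = ?g i"
      using 1 order_le_less_trans[OF comp 1(2)] by (simp add: cube_ball_def)
    also have "\<dots> \<le> suminf ?f + suminf ?g" by (intro add_increasing ennreal_term_le_suminf) simp
    finally show ?thesis .
  qed
qed

definition ball_integral :: "(real ^ 'n::finite \<Rightarrow> ennreal) \<Rightarrow> real ^ 'n \<Rightarrow> real \<Rightarrow> ennreal" where
  "ball_integral \<phi> x r = (\<integral>\<^sup>+y. \<phi> y * indicator (cube_ball x r) y \<partial>lborel)"

definition riesz :: "real \<Rightarrow> (real ^ 'n::finite \<Rightarrow> ennreal) \<Rightarrow> real ^ 'n \<Rightarrow> ennreal" where
  "riesz \<alpha> \<phi> x = (\<integral>\<^sup>+y. \<phi> y * kernel \<alpha> x y \<partial>lborel)"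

lemma riesz_le:
  fixes \<phi> :: "real ^ 'n::finite \<Rightarrow> ennreal"
  assumes d: "0 < d" and a: "\<alpha> < real CARD('n)" and [measurable]: "\<phi> \<in> borel_measurable borel"
  shows "riesz \<alpha> \<phi> x \<le>
    (\<Sum>i. ennreal ((2 ^ Suc i / d) powr (real CARD('n) - \<alpha>)) * ball_integral \<phi> x (d / 2 ^ i)) +
    (\<Sum>i. ennreal ((d * 2 ^ i) powr (\<alpha> - real CARD('n))) * ball_integral \<phi> x (d * 2 ^ Suc i))"
proof -
  let ?f = "\<lambda>i y. ennreal ((2 ^ Suc i / d) powr (real CARD('n) - \<alpha>)) * indicator (cube_ball x (d / 2 ^ i)) y"
  let ?g = "\<lambda>i y. ennreal ((d * 2 ^ i) powr (\<alpha> - real CARD('n))) * indicator (cube_ball x (d * 2 ^ Suc i)) y"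
  have "riesz \<alpha> \<phi> x \<le> (\<integral>\<^sup>+y. (\<Sum>i. \<phi> y * ?f i y) + (\<Sum>i. \<phi> y * ?g i y) \<partial>lborel)"
    unfolding riesz_def ennreal_suminf_cmult distrib_left[symmetric]
    by (intro nn_integral_mono mult_left_mono kernel_le d a) simp
  also have "\<dots> = (\<integral>\<^sup>+y. (\<Sum>i. \<phi> y * ?f i y) \<partial>lborel) + (\<integral>\<^sup>+y. (\<Sum>i. \<phi> y * ?g i y) \<partial>lborel)"
    by (rule nn_integral_add) measurable
  also have "(\<integral>\<^sup>+y. (\<Sum>i. \<phi> y * ?f i y) \<partial>lborel) = (\<Sum>i. \<integral>\<^sup>+y. \<phi> y * ?f i y \<partial>lborel)"
    by (rule nn_integral_suminf) measurable
  also have "(\<integral>\<^sup>+y. (\<Sum>i. \<phi> y * ?g i y) \<partial>lborel) = (\<Sum>i. \<integral>\<^sup>+y. \<phi> y * ?g i y \<partial>lborel)"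
    by (rule nn_integral_suminf) measurable
  finally show ?thesis
    unfolding ball_integral_def mult.left_commute[of "\<phi> _"]
    by (simp add: nn_integral_cmult)
qed

lemma borel_measurable_coord_integral [measurable]:
  assumes [measurable]: "g \<in> borel_measurable borel" "\<And>k. (\<lambda>(a, b). w k a b) \<in> borel_measurable (borel \<Otimes>\<^sub>M borel)"
  shows "coord_integral w k g \<in> borel_measurable borel"
  unfolding coord_integral_def[abs_def] by measurable

lemma borel_measurable_fold_coord_integral:
  assumes "\<And>k. (\<lambda>(a, b). w k a b) \<in> borel_measurable (borel \<Otimes>\<^sub>M borel)"
  shows "g \<in> borel_measurable borel \<Longrightarrow> fold (coord_integral w) ys g \<in> borel_measurable borel"
  by (induction ys arbitrary: g) (auto intro: borel_measurable_coord_integral assms)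

text \<open>The integral over a centred cube is an iterated integral over centred intervals, and in
  each coordinate the radius d / 2^i is one of those in the supremum of
  \<open>hl_max\<close>.\<close>

lemma ball_integral_le_strong_max:
  fixes \<phi> :: "real ^ 'n::finite \<Rightarrow> ennreal"
  assumes d: "0 < d" and i: "i \<le> L" and \<phi> [measurable]: "\<phi> \<in> borel_measurable borel"
    and xs: "distinct xs" "set xs = UNIV"
  shows "ennreal ((2 ^ i / d) ^ CARD('n)) * ball_integral \<phi> x (d / 2 ^ i) \<le> fold (coord_max d L) xs \<phi> x"
proof -
  define w :: "'n \<Rightarrow> real \<Rightarrow> real \<Rightarrow> ennreal" where "w k a b = indicator {b. \<bar>b - a\<bar> < d / 2 ^ i} b" for k a b
  have w [measurable]: "(\<lambda>(a, b). w k a b) \<in> borel_measurable (borel \<Otimes>\<^sub>M borel)" for k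
    unfolding w_def indicator_def mem_Collect_eq by measurable
  have wk [measurable]: "w k a \<in> borel_measurable borel" for k a
    using measurable_compose[OF measurable_Pair1' w, of a k] by simp
  have prod_w: "(\<Prod>k\<in>UNIV. w k (x $ k) (y $ k)) = indicator (cube_ball x (d / 2 ^ i)) y" for y
  proof (cases "y \<in> cube_ball x (d / 2 ^ i)")
    case True then show ?thesis by (auto simp: w_def cube_ball_def)
  next
    case False
    then obtain k where "\<not> \<bar>y $ k - x $ k\<bar> < d / 2 ^ i" by (auto simp: cube_ball_def)
    then have "w k (x $ k) (y $ k) = 0" by (simp add: w_def)
    then have "(\<Prod>k\<in>UNIV. w k (x $ k) (y $ k)) = 0" by (intro prod_zero) auto
    then show ?thesis using False by simp
  qed
  have step: "ennreal ((2 ^ i / d) ^ length ys) * fold (coord_integral w) ys \<phi> x \<le> fold (coord_max d L) ys \<phi> x" for ys x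
  proof (induction ys arbitrary: x rule: rev_induct)
    case (snoc k ys)
    have "fold (coord_integral w) ys \<phi> \<in> borel_measurable borel"
      by (intro borel_measurable_fold_coord_integral w \<phi>)
    then have [measurable]: "(\<lambda>s. fold (coord_integral w) ys \<phi> (vec_upd x k s)) \<in> borel_measurable borel"
      by (rule measurable_compose[rotated]) measurable
    have h: "(\<lambda>s. w k (x $ k) s * fold (coord_integral w) ys \<phi> (vec_upd x k s)) \<in> borel_measurable lborel"
      using wk[of k "x $ k"] by measurable
    let ?c = "ennreal ((2 ^ i / d) ^ length ys)"
    have "ennreal ((2 ^ i / d) ^ length (ys @ [k])) * fold (coord_integral w) (ys @ [k]) \<phi> x =
       ennreal (2 ^ i / d) * (?c * (\<integral>\<^sup>+s. w k (x $ k) s * fold (coord_integral w) ys \<phi> (vec_upd x k s) \<partial>lborel))"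
    proof -
      have pw: "ennreal ((2 ^ i / d) ^ length (ys @ [k])) = ennreal (2 ^ i / d) * ?c"
        using d by (simp add: ennreal_mult[symmetric])
      show ?thesis unfolding pw mult.assoc by (simp add: coord_integral_def)
    qed
    also have "\<dots> = ennreal (2 ^ i / d) * (\<integral>\<^sup>+s. ?c * (w k (x $ k) s * fold (coord_integral w) ys \<phi> (vec_upd x k s)) \<partial>lborel)"
      by (intro arg_cong2[where f=times] refl nn_integral_cmult[symmetric] h)
    also have "\<dots> \<le> ennreal (2 ^ i / d) * (\<integral>\<^sup>+s. indicator {s. \<bar>s - x $ k\<bar> < d / 2 ^ i} s * fold (coord_max d L) ys \<phi> (vec_upd x k s) \<partial>lborel)"
      unfolding mult.left_commute[of ?c] w_def[of k "x $ k"]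
      by (intro mult_left_mono nn_integral_mono snoc) auto
    also have "\<dots> \<le> hl_max d L (\<lambda>s. fold (coord_max d L) ys \<phi> (vec_upd x k s)) (x $ k)"
      unfolding hl_max_def by (rule SUP_upper2[of i]) (use i in simp, rule order_refl)
    also have "\<dots> = fold (coord_max d L) (ys @ [k]) \<phi> x"
      by (simp add: coord_max_def)
    finally show ?case .
  qed simp
  have "length xs = CARD('n)" using xs by (metis distinct_card)
  moreover have "fold (coord_integral w) xs \<phi> x = ball_integral \<phi> x (d / 2 ^ i)"
    unfolding ball_integral_def fold_coord_integral_UNIV[OF xs \<phi> w] prod_w by (simp only: mult.commute)
  ultimately show ?thesis using step[of xs x] by (simp only:)
qed

section \<open>Estimates on a dyadic cube\<close>

definition side :: "int \<Rightarrow> real" where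
  "side j = 2 powr (- real_of_int j)"

definition dcube :: "int \<Rightarrow> int ^ 'n \<Rightarrow> (real ^ 'n::finite) set" where
  "dcube j m = cell (side j) (\<chi> k. side j * of_int (m $ k))"

definition cube_index :: "int \<Rightarrow> real ^ 'n \<Rightarrow> int ^ 'n::finite" where
  "cube_index j x = (\<chi> k. \<lfloor>x $ k / side j\<rfloor>)"

text \<open>Integer division rounds downwards, which gives the right cube for negative indices
  too.\<close>

definition ancestor :: "nat \<Rightarrow> int ^ 'n \<Rightarrow> int ^ 'n::finite" where
  "ancestor K m = (\<chi> k. m $ k div 2 ^ K)"

text \<open>Index shifts to the cubes of the same level that touch a given cube, itself
  included.\<close>

definition neighbours :: "(int ^ 'n::finite) set" where
  "neighbours = {e. \<forall>k. e $ k \<in> {- 1, 0, 1}}"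

lemma side_pos [simp]: "0 < side j" "side j \<noteq> 0"
  by (simp_all add: side_def)

lemma side_diff: "side (j - int K) = side j * 2 ^ K"
  by (simp add: side_def powr_diff powr_minus powr_realpow[symmetric] field_simps)

lemma side_add: "side (j + int K) = side j / 2 ^ K"
  using side_diff[of "j + int K" K] by (simp add: field_simps)

lemma finite_neighbours [simp]: "finite (neighbours :: (int ^ 'n::finite) set)"
proof -
  have "(neighbours :: (int ^ 'n) set) \<subseteq> vec_lambda ` (\<Pi>\<^sub>E k\<in>UNIV. {- 1, 0, 1})"
  proof
    fix e :: "int ^ 'n" assume "e \<in> neighbours"
    then have "(\<lambda>k. e $ k) \<in> (\<Pi>\<^sub>E k\<in>UNIV. {- 1, 0, 1})" "e = vec_lambda (\<lambda>k. e $ k)"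
      by (auto simp: neighbours_def)
    then show "e \<in> vec_lambda ` (\<Pi>\<^sub>E k\<in>UNIV. {- 1, 0, 1})" by (metis imageI)
  qed
  then show ?thesis by (rule finite_subset) (intro finite_imageI finite_PiE, auto)
qed

lemma sets_dcube [measurable]: "dcube j m \<in> sets borel"
  unfolding dcube_def by (rule sets_cell')

lemma mem_dcube_iff: "x \<in> dcube j m \<longleftrightarrow> cube_index j x = m"
proof -
  have "\<lfloor>x $ k / side j\<rfloor> = m $ k \<longleftrightarrow> side j * of_int (m $ k) \<le> x $ k \<and> x $ k < side j * of_int (m $ k) + side j" for k
    by (simp add: floor_eq_iff pos_le_divide_eq pos_divide_less_eq algebra_simps)
  then show ?thesis by (simp add: dcube_def cell_def cube_index_def vec_eq_iff)
qed

lemma dyadic_cube_eq: "dyadic_cube j m = dcube j m"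
proof -
  have "2 powi (- j) = side j"
    unfolding side_def by (subst powr_real_of_int'[symmetric]) auto
  then show ?thesis by (simp add: dyadic_cube_def dcube_def cell_def algebra_simps)
qed

lemma cube_index_diff: "cube_index (j - int K) x = ancestor K (cube_index j x)"
proof -
  have "\<lfloor>x $ k / side (j - int K)\<rfloor> = \<lfloor>x $ k / side j\<rfloor> div 2 ^ K" for k
    using floor_divide_real_eq_div[of "2 ^ K" "x $ k / side j"] by (simp add: side_diff)
  then show ?thesis by (simp add: cube_index_def ancestor_def vec_eq_iff)
qed

lemma cube_ball_subset_neighbours:
  assumes "y \<in> cube_ball x (side j)"
  shows "\<exists>e\<in>neighbours. y \<in> dcube j (cube_index j x + e)"
proof (rule bexI)
  let ?e = "cube_index j y - cube_index j x"
  show "y \<in> dcube j (cube_index j x + ?e)" by (simp add: mem_dcube_iff)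
  have "\<lfloor>y $ k / side j\<rfloor> - \<lfloor>x $ k / side j\<rfloor> \<in> {- 1, 0, 1}" for k
  proof -
    have "\<bar>y $ k - x $ k\<bar> < side j" using assms by (simp add: cube_ball_def)
    then have "\<bar>(y $ k - x $ k) / side j\<bar> < 1" by (simp add: abs_divide)
    then have "\<bar>y $ k / side j - x $ k / side j\<bar> < 1" by (simp add: diff_divide_distrib)
    then have "\<lfloor>y $ k / side j\<rfloor> - \<lfloor>x $ k / side j\<rfloor> = -1 \<or> \<lfloor>y $ k / side j\<rfloor> - \<lfloor>x $ k / side j\<rfloor> = 0 \<or>
      \<lfloor>y $ k / side j\<rfloor> - \<lfloor>x $ k / side j\<rfloor> = 1" by linarith
    then show ?thesis by blast
  qed
  then show "?e \<in> neighbours" by (simp add: neighbours_def cube_index_def)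
qed

lemma ball_integral_le_neighbours:
  assumes [measurable]: "\<phi> \<in> borel_measurable borel"
  shows "ball_integral \<phi> x (side j) \<le> (\<Sum>e\<in>neighbours. \<integral>\<^sup>+y. \<phi> y * indicator (dcube j (cube_index j x + e)) y \<partial>lborel)"
proof -
  have "ball_integral \<phi> x (side j) \<le> (\<integral>\<^sup>+y. (\<Sum>e\<in>neighbours. \<phi> y * indicator (dcube j (cube_index j x + e)) y) \<partial>lborel)"
    unfolding ball_integral_def
  proof (intro nn_integral_mono)
    fix y
    show "\<phi> y * indicator (cube_ball x (side j)) y \<le> (\<Sum>e\<in>neighbours. \<phi> y * indicator (dcube j (cube_index j x + e)) y)"
    proof (cases "y \<in> cube_ball x (side j)")
      case True
      then obtain e where e: "e \<in> neighbours" "y \<in> dcube j (cube_index j x + e)"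
        using cube_ball_subset_neighbours by blast
      then have "\<phi> y * indicator (cube_ball x (side j)) y = \<phi> y * indicator (dcube j (cube_index j x + e)) y"
        using True by simp
      also have "\<dots> \<le> (\<Sum>e\<in>neighbours. \<phi> y * indicator (dcube j (cube_index j x + e)) y)"
        using e by (intro member_le_sum) auto
      finally show ?thesis .
    qed simp
  qed
  also have "\<dots> = (\<Sum>e\<in>neighbours. \<integral>\<^sup>+y. \<phi> y * indicator (dcube j (cube_index j x + e)) y \<partial>lborel)"
    by (rule nn_integral_sum) measurable
  finally show ?thesis .
qed

text \<open>The \<open>r\<close>-th power of \<open>cube_coeff\<close> is the term of \<open>dcube j m\<close> in the Bourgain-Morrey norm.\<close>

definition cube_coeff :: "'n list \<Rightarrow> real ^ 'n \<Rightarrow> real \<Rightarrow> (real ^ 'n::finite \<Rightarrow> ennreal) \<Rightarrow> int \<Rightarrow> int ^ 'n \<Rightarrow> ennreal" where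
  "cube_coeff xs p t \<phi> j m = ennreal (side j powr (real CARD('n) / t - (\<Sum>k\<in>UNIV. 1 / p $ k))) *
     pnorm p xs (\<lambda>y. \<phi> y * indicator (dcube j m) y) 0"

text \<open>Hoelder's inequality on each neighbouring cube gives the power n - sum 1 / p of the
  side. The weight in \<open>cube_coeff\<close> accounts for n / t - sum 1 / p, so n - n / t is
  left.\<close>

lemma ball_integral_le_cube_coeff:
  fixes \<phi> :: "real ^ 'n::finite \<Rightarrow> ennreal"
  assumes p: "\<And>i. 1 \<le> p $ i" and [measurable]: "\<phi> \<in> borel_measurable borel"
    and xs: "distinct xs" "set xs = UNIV"
  shows "ball_integral \<phi> x (side j) \<le> ennreal (side j powr (real CARD('n) - real CARD('n) / t)) *
    (\<Sum>e\<in>neighbours. cube_coeff xs p t \<phi> j (cube_index j x + e))"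
proof -
  let ?n = "real CARD('n)" and ?s = "\<Sum>k\<in>UNIV. 1 / p $ k"
  have "(\<integral>\<^sup>+y. \<phi> y * indicator (dcube j m) y \<partial>lborel) \<le> ennreal (side j powr (?n - ?n / t)) * cube_coeff xs p t \<phi> j m" for m
  proof -
    have "(\<integral>\<^sup>+y. \<phi> y * indicator (dcube j m) y \<partial>lborel) \<le> ennreal (side j powr (?n - ?s)) *
        pnorm p xs (\<lambda>y. \<phi> y * indicator (dcube j m) y) 0"
      unfolding dcube_def by (intro nn_integral_cell_le_pnorm p xs) auto
    also have "ennreal (side j powr (?n - ?s)) = ennreal (side j powr (?n - ?n / t)) * ennreal (side j powr (?n / t - ?s))"
      by (simp add: ennreal_mult[symmetric] powr_add[symmetric])
    finally show ?thesis by (simp add: cube_coeff_def mult.assoc)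
  qed
  then have "(\<Sum>e\<in>neighbours. \<integral>\<^sup>+y. \<phi> y * indicator (dcube j (cube_index j x + e)) y \<partial>lborel) \<le>
     (\<Sum>e\<in>neighbours. ennreal (side j powr (?n - ?n / t)) * cube_coeff xs p t \<phi> j (cube_index j x + e))"
    by (intro sum_mono)
  then show ?thesis
    using ball_integral_le_neighbours[of \<phi> x j] by (simp add: sum_distrib_left)
qed

lemma hl_max_mono:
  assumes "L \<le> L'" "\<And>s. f s \<le> g s" "0 < \<delta>" shows "hl_max \<delta> L f y \<le> hl_max \<delta> L' g y"
  unfolding hl_max_def using assms
  by (intro SUP_mono) (auto intro!: bexI mult_left_mono nn_integral_mono)

text \<open>Monotonicity in the number of scales, which later permits monotone convergence.\<close>

lemma fold_coord_max_mono:
  assumes "L \<le> L'" "0 < \<delta>"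
  shows "fold (coord_max \<delta> L) ys g x \<le> fold (coord_max \<delta> L') ys g x"
proof (induction ys arbitrary: x rule: rev_induct)
  case (snoc k ys)
  show ?case using assms snoc by (simp add: coord_max_def hl_max_mono)
qed simp

section \<open>Small and large scales around a point of a dyadic cube\<close>

locale riesz_exponents =
  fixes p1 p2 :: "real ^ 'n::finite" and t1 t2 \<alpha> n :: real and xs :: "'n list"
  assumes p1: "1 < p1 $ i" and p2: "1 < p2 $ i" and t_pos: "0 < t1" "0 < t2"
    and card_n: "n = real CARD('n)" and alpha: "0 < \<alpha>" "\<alpha> < n"
    and t: "1 / t2 = 1 / t1 - \<alpha> / n"
    and p12: "p1 $ i = t1 / t2 * p2 $ i"
    and xs: "distinct xs" "set xs = UNIV"
begin

definition \<theta> :: real where "\<theta> = t1 / t2"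

lemma n_pos: "0 < n" by (simp add: card_n)

text \<open>These are the exponents of Hedberg's balance with a = \<alpha> and b = n / t2. The
  relation between t1 and t2 says that a + b = n / t1, the growth exponent of the Morrey
  bound.\<close>

lemma exponents: "\<alpha> + n / t2 = n / t1" "n / t2 / (\<alpha> + n / t2) = \<theta>" "\<alpha> / (\<alpha> + n / t2) = 1 - \<theta>"
  "0 < \<theta>" "\<theta> < 1"
proof -
  have "n * (1 / t2) = n * (1 / t1 - \<alpha> / n)" by (simp only: t)
  then show s: "\<alpha> + n / t2 = n / t1" using n_pos by (simp add: right_diff_distrib)
  show b: "n / t2 / (\<alpha> + n / t2) = \<theta>" unfolding s using t_pos n_pos by (simp add: \<theta>_def)
  have "\<alpha> + n / t2 \<noteq> 0" unfolding s using t_pos n_pos by simp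
  then have "\<alpha> / (\<alpha> + n / t2) + n / t2 / (\<alpha> + n / t2) = 1" unfolding add_divide_distrib[symmetric] by simp
  then show a: "\<alpha> / (\<alpha> + n / t2) = 1 - \<theta>" using b by simp
  show "0 < \<theta>" using t_pos by (simp add: \<theta>_def)
  have "0 < \<alpha> / (\<alpha> + n / t2)" unfolding s using alpha t_pos n_pos by simp
  then show "\<theta> < 1" using a by simp
qed

lemma p_le: "1 \<le> p1 $ i" "1 \<le> p2 $ i" "0 < p1 $ i" "0 < p2 $ i"
  using p1[of i] p2[of i] by simp_all

definition near_part :: "(real ^ 'n \<Rightarrow> ennreal) \<Rightarrow> int \<Rightarrow> int ^ 'n \<Rightarrow> real ^ 'n \<Rightarrow> ennreal" where
  "near_part \<phi> J m y = \<phi> y * indicator (\<Union>e\<in>neighbours. dcube J (m + e)) y"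

lemma near_part_measurable [measurable]:
  assumes [measurable]: "\<phi> \<in> borel_measurable borel"
  shows "near_part \<phi> J m \<in> borel_measurable borel"
proof -
  have [measurable]: "(\<Union>e\<in>neighbours. dcube J (m + e)) \<in> sets borel"
    by (intro sets.finite_UN) auto
  show ?thesis unfolding near_part_def[abs_def] by measurable
qed

lemma ball_integral_near_part:
  assumes x: "x \<in> dcube J m" and r: "r \<le> side J"
  shows "ball_integral \<phi> x r \<le> ball_integral (near_part \<phi> J m) x r"
  unfolding ball_integral_def
proof (intro nn_integral_mono)
  fix y
  have "y \<in> (\<Union>e\<in>neighbours. dcube J (m + e))" if "y \<in> cube_ball x r"
  proof -
    have "y \<in> cube_ball x (side J)" using that r unfolding cube_ball_def by (auto intro: less_le_trans)
    then show ?thesis using cube_ball_subset_neighbours[of y x J] x by (auto simp: mem_dcube_iff)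
  qed
  then show "\<phi> y * indicator (cube_ball x r) y \<le> near_part \<phi> J m y * indicator (cube_ball x r) y"
    by (auto simp: near_part_def indicator_def)
qed

text \<open>For u = 2^i / \<open>side J\<close> the kernel contributes u^(n-\<alpha>) up to a
  constant. The ball integral times u^n is bounded both by the maximal function and, through the
  coefficients, by a multiple of N u^(n/t1). The remaining factor u^(-\<alpha>) is the one in
  \<open>hedberg_sum\<close>.\<close>

lemma near_pointwise:
  "\<exists>C\<ge>0. \<forall>\<phi> N J m x L. \<phi> \<in> borel_measurable borel \<longrightarrow> (\<forall>j m. cube_coeff xs p1 t1 \<phi> j m \<le> N) \<longrightarrow> x \<in> dcube J m \<longrightarrow>
    (\<Sum>i\<le>L. ennreal ((2 ^ Suc i / side J) powr (n - \<alpha>)) * ball_integral \<phi> x (side J / 2 ^ i)) \<le>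
      ennreal C * (ennpowr (fold (coord_max (side J) L) xs (near_part \<phi> J m) x) \<theta> * ennpowr N (1 - \<theta>))"
proof -
  obtain C where C: "0 \<le> C" and hed: "\<forall>A R d L. 0 < d \<longrightarrow>
    (\<Sum>i\<le>L. ennreal ((2 ^ i / d) powr (- \<alpha>)) * min A (R * ennreal ((2 ^ i / d) powr (\<alpha> + n / t2))))
      \<le> ennreal C * (ennpowr A (n / t2 / (\<alpha> + n / t2)) * ennpowr R (\<alpha> / (\<alpha> + n / t2)))"
    using hedberg_sum[of \<alpha> "n / t2"] alpha t_pos n_pos by auto
  define c where "c = real (card (neighbours :: (int ^ 'n) set)) powr (1 - \<theta>)"
  show ?thesis
  proof (intro exI conjI allI impI)
    show "0 \<le> 2 powr (n - \<alpha>) * (C * c)" using C by (simp add: c_def)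
    fix \<phi> :: "real ^ 'n \<Rightarrow> ennreal" and N :: ennreal and J :: int and m :: "int ^ 'n" and x :: "real ^ 'n" and L :: nat
    assume \<phi> [measurable]: "\<phi> \<in> borel_measurable borel" and N: "\<forall>j m. cube_coeff xs p1 t1 \<phi> j m \<le> N"
      and x: "x \<in> dcube J m"
    let ?A = "fold (coord_max (side J) L) xs (near_part \<phi> J m) x"
    \<comment> \<open>The ball around x at each scale is covered by the neighbours of the dyadic
      cube of x at that scale, and each of them has coefficient at most N.\<close>
    define R where "R = of_nat (card (neighbours :: (int ^ 'n) set)) * N"
    have "ennreal ((2 ^ Suc i / side J) powr (n - \<alpha>)) * ball_integral \<phi> x (side J / 2 ^ i) \<le>
       ennreal (2 powr (n - \<alpha>)) * (ennreal ((2 ^ i / side J) powr (- \<alpha>)) *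
         min ?A (R * ennreal ((2 ^ i / side J) powr (\<alpha> + n / t2))))" if i: "i \<le> L" for i
    proof -
      define u where "u = 2 ^ i / side J"
      have u: "0 < u" by (simp add: u_def)
      have s: "side J / 2 ^ i = side (J + int i)" "side (J + int i) = 1 / u"
        by (simp_all add: side_add u_def)
      let ?B = "ball_integral \<phi> x (side J / 2 ^ i)"
      have 1: "ennreal (u ^ CARD('n)) * ?B \<le> ?A"
      proof -
        have "side J / 2 ^ i \<le> side J" by (simp add: divide_le_eq)
        then have "?B \<le> ball_integral (near_part \<phi> J m) x (side J / 2 ^ i)"
          by (rule ball_integral_near_part[OF x])
        then have "ennreal (u ^ CARD('n)) * ?B \<le> ennreal (u ^ CARD('n)) * ball_integral (near_part \<phi> J m) x (side J / 2 ^ i)"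
          by (rule mult_left_mono) simp
        also have "\<dots> \<le> ?A" unfolding u_def
          by (rule ball_integral_le_strong_max[OF side_pos(1) i near_part_measurable[OF \<phi>] xs])
        finally show ?thesis .
      qed
      have 2: "ennreal (u ^ CARD('n)) * ?B \<le> R * ennreal (u powr (\<alpha> + n / t2))"
      proof -
        have "?B \<le> ennreal ((1 / u) powr (n - n / t1)) * (\<Sum>e\<in>(neighbours :: (int ^ 'n) set). cube_coeff xs p1 t1 \<phi> (J + int i) (cube_index (J + int i) x + e))"
          using ball_integral_le_cube_coeff[of p1 \<phi> xs x "J + int i" t1] p_le xs unfolding s card_n by simp
        also have "\<dots> \<le> ennreal ((1 / u) powr (n - n / t1)) * (\<Sum>e\<in>(neighbours :: (int ^ 'n) set). N)"
          using N by (intro mult_left_mono sum_mono) auto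
        finally have "ennreal (u ^ CARD('n)) * ?B \<le> ennreal (u ^ CARD('n)) * (ennreal ((1 / u) powr (n - n / t1)) * R)"
          by (intro mult_left_mono) (auto simp: R_def)
        also have "\<dots> = R * (ennreal (u powr n) * ennreal ((1 / u) powr (n - n / t1)))"
          using u by (simp add: card_n powr_realpow ac_simps)
        also have "ennreal (u powr n) * ennreal ((1 / u) powr (n - n / t1)) = ennreal (u powr (\<alpha> + n / t2))"
          using u exponents(1) by (simp add: ennreal_mult[symmetric] powr_divide powr_diff)
        finally show ?thesis .
      qed
      have "ennreal ((2 ^ Suc i / side J) powr (n - \<alpha>)) = ennreal (2 powr (n - \<alpha>)) * (ennreal (u powr (- \<alpha>)) * ennreal (u ^ CARD('n)))"
      proof -
        have "2 ^ Suc i / side J = 2 * u" by (simp add: u_def)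
        then have "(2 ^ Suc i / side J) powr (n - \<alpha>) = 2 powr (n - \<alpha>) * (u powr (- \<alpha>) * u ^ CARD('n))"
          using u by (simp add: powr_mult powr_realpow[symmetric] powr_add[symmetric] card_n)
        then show ?thesis using u by (simp add: ennreal_mult)
      qed
      then have "ennreal ((2 ^ Suc i / side J) powr (n - \<alpha>)) * ?B =
          ennreal (2 powr (n - \<alpha>)) * (ennreal (u powr (- \<alpha>)) * (ennreal (u ^ CARD('n)) * ?B))"
        by (simp only: mult.assoc)
      also have "\<dots> \<le> ennreal (2 powr (n - \<alpha>)) * (ennreal (u powr (- \<alpha>)) * min ?A (R * ennreal (u powr (\<alpha> + n / t2))))"
        using 1 2 by (intro mult_left_mono) auto
      finally show ?thesis by (simp only: u_def)
    qed
    then have "(\<Sum>i\<le>L. ennreal ((2 ^ Suc i / side J) powr (n - \<alpha>)) * ball_integral \<phi> x (side J / 2 ^ i)) \<le>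
      (\<Sum>i\<le>L. ennreal (2 powr (n - \<alpha>)) * (ennreal ((2 ^ i / side J) powr (- \<alpha>)) *
         min ?A (R * ennreal ((2 ^ i / side J) powr (\<alpha> + n / t2)))))"
      by (intro sum_mono) auto
    also have "\<dots> = ennreal (2 powr (n - \<alpha>)) * (\<Sum>i\<le>L. ennreal ((2 ^ i / side J) powr (- \<alpha>)) *
         min ?A (R * ennreal ((2 ^ i / side J) powr (\<alpha> + n / t2))))"
      by (rule sum_distrib_left[symmetric])
    also have "\<dots> \<le> ennreal (2 powr (n - \<alpha>)) * (ennreal C * (ennpowr ?A \<theta> * ennpowr R (1 - \<theta>)))"
      using hed[rule_format, OF side_pos(1)] unfolding exponents(2,3) by (intro mult_left_mono) auto
    also have "ennpowr R (1 - \<theta>) = ennreal c * ennpowr N (1 - \<theta>)"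
      using exponents ennpowr_ennreal[of "real (card (neighbours :: (int ^ 'n) set))" "1 - \<theta>"]
      by (simp add: R_def ennpowr_mult c_def ennreal_of_nat_eq_real_of_nat)
    also have "ennreal (2 powr (n - \<alpha>)) * (ennreal C * (ennpowr ?A \<theta> * (ennreal c * ennpowr N (1 - \<theta>)))) =
        ennreal (2 powr (n - \<alpha>) * (C * c)) * (ennpowr ?A \<theta> * ennpowr N (1 - \<theta>))"
      using C by (simp add: ennreal_mult c_def ac_simps)
    finally show "(\<Sum>i\<le>L. ennreal ((2 ^ Suc i / side J) powr (n - \<alpha>)) * ball_integral \<phi> x (side J / 2 ^ i)) \<le>
      ennreal (2 powr (n - \<alpha>) * (C * c)) * (ennpowr ?A \<theta> * ennpowr N (1 - \<theta>))" .
  qed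
qed

text \<open>The large scale part at unit side length. Term i belongs to the ancestor i + 1 levels
  up, because the first ball outside the near range has radius 2 \<open>side J\<close>.\<close>

definition far_sum :: "(real ^ 'n \<Rightarrow> ennreal) \<Rightarrow> int \<Rightarrow> int ^ 'n \<Rightarrow> ennreal" where
  "far_sum \<phi> J m = (\<Sum>i. ennreal (2 powr (- real (Suc i) * (n / t2))) *
     (\<Sum>e\<in>neighbours. cube_coeff xs p1 t1 \<phi> (J - int (Suc i)) (ancestor (Suc i) m + e)))"

text \<open>The estimate depends on x only through its ancestors, which all points of the cube
  share; hence it is constant there.\<close>

lemma far_pointwise:
  assumes [measurable]: "\<phi> \<in> borel_measurable borel" and x: "x \<in> dcube J m"
  shows "(\<Sum>i. ennreal ((side J * 2 ^ i) powr (\<alpha> - n)) * ball_integral \<phi> x (side J * 2 ^ Suc i)) \<le>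
    ennreal (2 powr (n - \<alpha>) * side J powr (- (n / t2))) * far_sum \<phi> J m"
proof -
  have "ennreal ((side J * 2 ^ i) powr (\<alpha> - n)) * ball_integral \<phi> x (side J * 2 ^ Suc i) \<le>
     ennreal (2 powr (n - \<alpha>) * side J powr (- (n / t2))) * (ennreal (2 powr (- real (Suc i) * (n / t2))) *
     (\<Sum>e\<in>neighbours. cube_coeff xs p1 t1 \<phi> (J - int (Suc i)) (ancestor (Suc i) m + e)))" for i
  proof -
    define s where "s = side (J - int (Suc i))"
    have s: "side J * 2 ^ Suc i = s" "side J * 2 ^ i = s / 2" "0 < s"
      using side_diff[of J "Suc i"] by (auto simp: s_def)
    have idx: "cube_index (J - int (Suc i)) x = ancestor (Suc i) m"
      using x cube_index_diff[of J "Suc i" x] by (simp add: mem_dcube_iff)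
    have "ball_integral \<phi> x s \<le> ennreal (s powr (n - n / t1)) *
        (\<Sum>e\<in>neighbours. cube_coeff xs p1 t1 \<phi> (J - int (Suc i)) (ancestor (Suc i) m + e))"
      using ball_integral_le_cube_coeff[of p1 \<phi> xs x "J - int (Suc i)" t1] p_le xs
      unfolding idx s_def card_n by simp
    then have "ennreal ((s / 2) powr (\<alpha> - n)) * ball_integral \<phi> x s \<le> ennreal ((s / 2) powr (\<alpha> - n)) * (ennreal (s powr (n - n / t1)) *
        (\<Sum>e\<in>neighbours. cube_coeff xs p1 t1 \<phi> (J - int (Suc i)) (ancestor (Suc i) m + e)))"
      by (rule mult_left_mono) simp
    also have "\<dots> = (ennreal ((s / 2) powr (\<alpha> - n)) * ennreal (s powr (n - n / t1))) *
        (\<Sum>e\<in>neighbours. cube_coeff xs p1 t1 \<phi> (J - int (Suc i)) (ancestor (Suc i) m + e))"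
      by (simp only: mult.assoc)
    also have "ennreal ((s / 2) powr (\<alpha> - n)) * ennreal (s powr (n - n / t1)) =
      ennreal (2 powr (n - \<alpha>) * side J powr (- (n / t2))) * ennreal (2 powr (- real (Suc i) * (n / t2)))"
    proof -
      \<comment> \<open>The kernel is evaluated at the inner radius s / 2 of the shell, the ball has
        the outer radius s. This costs the factor 2^(n-\<alpha>).\<close>
      have "(s / 2) powr (\<alpha> - n) * s powr (n - n / t1) = 2 powr (n - \<alpha>) * (s powr (\<alpha> - n) * s powr (n - n / t1))"
        using s(3) by (simp add: powr_divide powr_diff field_simps)
      also have "s powr (\<alpha> - n) * s powr (n - n / t1) = s powr (- (n / t2))"
        unfolding powr_add[symmetric] using exponents(1) by (intro arg_cong[of _ _ "(powr) s"]) linarith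
      also have "s powr (- (n / t2)) = (side J * 2 powr (real (Suc i))) powr (- (n / t2))"
        unfolding s(1)[symmetric] by (simp add: powr_realpow[symmetric] powr_add)
      also have "\<dots> = side J powr (- (n / t2)) * 2 powr (- real (Suc i) * (n / t2))"
      proof -
        have "(2 powr real (Suc i)) powr (- (n / t2)) = 2 powr (- real (Suc i) * (n / t2))"
          unfolding powr_powr by (simp only: mult_minus_left mult_minus_right)
        then show ?thesis by (subst powr_mult) (simp_all only: side_pos)
      qed
      finally show ?thesis by (simp add: ennreal_mult[symmetric] mult.assoc)
    qed
    finally show ?thesis unfolding s(1,2) by (simp only: mult.assoc)
  qed
  then have "(\<Sum>i. ennreal ((side J * 2 ^ i) powr (\<alpha> - n)) * ball_integral \<phi> x (side J * 2 ^ Suc i)) \<le>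
     (\<Sum>i. ennreal (2 powr (n - \<alpha>) * side J powr (- (n / t2))) * (ennreal (2 powr (- real (Suc i) * (n / t2))) *
     (\<Sum>e\<in>neighbours. cube_coeff xs p1 t1 \<phi> (J - int (Suc i)) (ancestor (Suc i) m + e))))"
    by (intro suminf_le) auto
  then show ?thesis by (simp only: far_sum_def ennreal_suminf_cmult)
qed

end

section \<open>The coefficient of a single cube\<close>

context riesz_exponents
begin

lemma riesz_measurable [measurable]:
  assumes [measurable]: "\<phi> \<in> borel_measurable borel"
  shows "riesz \<alpha> \<phi> \<in> borel_measurable (borel :: (real ^ 'n) measure)"
  unfolding riesz_def[abs_def] kernel_def by measurable

lemma pnorm_near_part_le:
  assumes [measurable]: "\<phi> \<in> borel_measurable borel"
  shows "pnorm p1 xs (near_part \<phi> J m) 0 \<le> (\<Sum>e\<in>neighbours. pnorm p1 xs (\<lambda>y. \<phi> y * indicator (dcube J (m + e)) y) 0)"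
proof -
  interpret function_norm borel "\<lambda>f. pnorm p1 xs f 0"
    by (rule function_norm_pnorm) (rule p_le)
  have "pnorm p1 xs (near_part \<phi> J m) 0 \<le> pnorm p1 xs (\<lambda>y. \<Sum>e\<in>neighbours. \<phi> y * indicator (dcube J (m + e)) y) 0"
  proof (intro norm_mono)
    fix y
    show "near_part \<phi> J m y \<le> (\<Sum>e\<in>neighbours. \<phi> y * indicator (dcube J (m + e)) y)"
    proof (cases "\<exists>e\<in>neighbours. y \<in> dcube J (m + e)")
      case True
      then obtain e where e: "e \<in> neighbours" "y \<in> dcube J (m + e)" by blast
      then have "near_part \<phi> J m y = \<phi> y * indicator (dcube J (m + e)) y"
        by (auto simp: near_part_def indicator_def)
      also have "\<dots> \<le> (\<Sum>e\<in>neighbours. \<phi> y * indicator (dcube J (m + e)) y)"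
        using e by (intro member_le_sum) auto
      finally show ?thesis .
    qed (auto simp: near_part_def)
  qed
  also have "\<dots> \<le> (\<Sum>e\<in>neighbours. pnorm p1 xs (\<lambda>y. \<phi> y * indicator (dcube J (m + e)) y) 0)"
    by (intro norm_sum) auto
  finally show ?thesis .
qed

text \<open>Assumption C is the conclusion of \<open>near_pointwise\<close> for a fixed constant.
  Each partial sum of the near series is bounded with its own number L of scales, and the supremum
  over L covers the series.\<close>

lemma riesz_pointwise:
  assumes C: "\<forall>\<phi> N J m x L. \<phi> \<in> borel_measurable borel \<longrightarrow> (\<forall>j m. cube_coeff xs p1 t1 \<phi> j m \<le> N) \<longrightarrow> x \<in> dcube J m \<longrightarrow>
    (\<Sum>i\<le>L. ennreal ((2 ^ Suc i / side J) powr (n - \<alpha>)) * ball_integral \<phi> x (side J / 2 ^ i)) \<le>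
      ennreal C * (ennpowr (fold (coord_max (side J) L) xs (near_part \<phi> J m) x) \<theta> * ennpowr N (1 - \<theta>))"
    and \<phi> [measurable]: "\<phi> \<in> borel_measurable borel" and N: "\<forall>j m. cube_coeff xs p1 t1 \<phi> j m \<le> N"
  shows "riesz \<alpha> \<phi> x * indicator (dcube J m) x \<le>
    ennreal C * ennpowr N (1 - \<theta>) * ennpowr (SUP L. fold (coord_max (side J) L) xs (near_part \<phi> J m) x) \<theta> +
    ennreal (2 powr (n - \<alpha>) * side J powr (- (n / t2))) * far_sum \<phi> J m * indicator (dcube J m) x"
proof (cases "x \<in> dcube J m")
  case True
  have "(\<Sum>i. ennreal ((2 ^ Suc i / side J) powr (n - \<alpha>)) * ball_integral \<phi> x (side J / 2 ^ i))
     \<le> ennreal C * ennpowr N (1 - \<theta>) * ennpowr (SUP L. fold (coord_max (side J) L) xs (near_part \<phi> J m) x) \<theta>"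
    unfolding suminf_eq_SUP
  proof (rule SUP_least)
    fix L
    let ?f = "\<lambda>i. ennreal ((2 ^ Suc i / side J) powr (n - \<alpha>)) * ball_integral \<phi> x (side J / 2 ^ i)"
    have "(\<Sum>i<L. ?f i) \<le> (\<Sum>i\<le>L. ?f i)"
      by (intro sum_mono2) auto
    also have "\<dots> \<le> ennreal C * (ennpowr (fold (coord_max (side J) L) xs (near_part \<phi> J m) x) \<theta> * ennpowr N (1 - \<theta>))"
      using C \<phi> N True by blast
    also have "\<dots> = ennreal C * ennpowr N (1 - \<theta>) * ennpowr (fold (coord_max (side J) L) xs (near_part \<phi> J m) x) \<theta>"
      by (simp only: ac_simps)
    also have "\<dots> \<le> ennreal C * ennpowr N (1 - \<theta>) * ennpowr (SUP L. fold (coord_max (side J) L) xs (near_part \<phi> J m) x) \<theta>"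
      using exponents by (intro mult_left_mono ennpowr_mono SUP_upper) auto
    finally show "(\<Sum>i<L. ?f i) \<le> ennreal C * ennpowr N (1 - \<theta>) * ennpowr (SUP L. fold (coord_max (side J) L) xs (near_part \<phi> J m) x) \<theta>" .
  qed
  moreover have "riesz \<alpha> \<phi> x \<le> (\<Sum>i. ennreal ((2 ^ Suc i / side J) powr (n - \<alpha>)) * ball_integral \<phi> x (side J / 2 ^ i)) +
      (\<Sum>i. ennreal ((side J * 2 ^ i) powr (\<alpha> - n)) * ball_integral \<phi> x (side J * 2 ^ Suc i))"
    using alpha unfolding card_n by (intro riesz_le) auto
  ultimately have "riesz \<alpha> \<phi> x \<le> ennreal C * ennpowr N (1 - \<theta>) * ennpowr (SUP L. fold (coord_max (side J) L) xs (near_part \<phi> J m) x) \<theta> +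
      ennreal (2 powr (n - \<alpha>) * side J powr (- (n / t2))) * far_sum \<phi> J m"
    using far_pointwise[OF \<phi> True] by (meson add_mono order_trans)
  then show ?thesis using True by simp
qed simp

text \<open>The \<theta>-th power converts the p2 norm into a p1 norm. There monotone convergence
  reduces the supremum over L to maximal functions with finitely many scales, bounded uniformly in
  L.\<close>

lemma pnorm_max_near_part:
  assumes CM: "\<And>\<delta> L g x. 0 < \<delta> \<Longrightarrow> g \<in> borel_measurable borel \<Longrightarrow>
      pnorm p1 xs (fold (coord_max \<delta> L) xs g) x \<le> ennreal CM * pnorm p1 xs g x"
    and \<phi> [measurable]: "\<phi> \<in> borel_measurable borel"
  shows "pnorm p2 xs (\<lambda>x. ennpowr (SUP L. fold (coord_max (side J) L) xs (near_part \<phi> J m) x) \<theta>) 0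
    \<le> ennpowr (ennreal CM * pnorm p1 xs (near_part \<phi> J m) 0) \<theta>"
proof -
  have "pnorm p2 xs (\<lambda>x. ennpowr (SUP L. fold (coord_max (side J) L) xs (near_part \<phi> J m) x) \<theta>) 0
      = ennpowr (pnorm p1 xs (\<lambda>x. SUP L. fold (coord_max (side J) L) xs (near_part \<phi> J m) x) 0) \<theta>"
    using p12 p_le exponents by (intro pnorm_ennpowr) (auto simp: \<theta>_def)
  also have "pnorm p1 xs (\<lambda>x. SUP L. fold (coord_max (side J) L) xs (near_part \<phi> J m) x) 0 =
      (SUP L. pnorm p1 xs (fold (coord_max (side J) L) xs (near_part \<phi> J m)) 0)"
    using p_le by (intro pnorm_SUP borel_measurable_fold_coord_max near_part_measurable \<phi>)
      (auto simp: incseq_def le_fun_def intro: fold_coord_max_mono)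
  also have "\<dots> \<le> ennreal CM * pnorm p1 xs (near_part \<phi> J m) 0"
    by (intro SUP_least CM near_part_measurable \<phi>) simp
  finally show ?thesis using exponents by (simp add: ennpowr_mono)
qed

text \<open>The weight exponents of the two spaces are in the ratio \<theta> as well: n / t2 - sum 1
  / p2 = \<theta> (n / t1 - sum 1 / p1).\<close>

lemma cube_coeff_powr:
  "ennreal (side J powr (n / t2 - (\<Sum>k\<in>UNIV. 1 / p2 $ k))) *
    ennpowr (pnorm p1 xs (\<lambda>y. \<phi> y * indicator (dcube J m) y) 0) \<theta> = ennpowr (cube_coeff xs p1 t1 \<phi> J m) \<theta>"
proof -
  have "1 / p2 $ k = \<theta> * (1 / p1 $ k)" for k
    using p12[of k] p_le[of k] t_pos by (simp add: \<theta>_def field_simps)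
  then have "(\<Sum>k\<in>UNIV. 1 / p2 $ k) = \<theta> * (\<Sum>k\<in>UNIV. 1 / p1 $ k)"
    unfolding sum_distrib_left by (intro sum.cong refl)
  moreover have "n / t2 = \<theta> * (n / t1)" using t_pos by (simp add: \<theta>_def)
  ultimately have e: "n / t2 - (\<Sum>k\<in>UNIV. 1 / p2 $ k) = (n / t1 - (\<Sum>k\<in>UNIV. 1 / p1 $ k)) * \<theta>"
    by (simp only: left_diff_distrib mult.commute[of \<theta>])
  show ?thesis
    unfolding cube_coeff_def card_n[symmetric] e using exponents
    by (simp add: ennpowr_mult ennpowr_ennreal powr_powr)
qed

text \<open>Only the near part needs the maximal theorem; the far part is a constant on the cube and
  needs just the norm of an indicator.\<close>

theorem cube_coeff_riesz_le:
  "\<exists>C\<ge>0. \<forall>\<phi> N J m. \<phi> \<in> borel_measurable borel \<longrightarrow> (\<forall>j m. cube_coeff xs p1 t1 \<phi> j m \<le> N) \<longrightarrow>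
    cube_coeff xs p2 t2 (riesz \<alpha> \<phi>) J m \<le>
      ennreal C * (ennpowr N (1 - \<theta>) * (\<Sum>e\<in>neighbours. ennpowr (cube_coeff xs p1 t1 \<phi> J (m + e)) \<theta>) + far_sum \<phi> J m)"
proof -
  obtain C1 where C1: "0 \<le> C1" and near: "\<forall>\<phi> N J m x L. \<phi> \<in> borel_measurable borel \<longrightarrow> (\<forall>j m. cube_coeff xs p1 t1 \<phi> j m \<le> N) \<longrightarrow> x \<in> dcube J m \<longrightarrow>
    (\<Sum>i\<le>L. ennreal ((2 ^ Suc i / side J) powr (n - \<alpha>)) * ball_integral \<phi> x (side J / 2 ^ i)) \<le>
      ennreal C1 * (ennpowr (fold (coord_max (side J) L) xs (near_part \<phi> J m) x) \<theta> * ennpowr N (1 - \<theta>))"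
    using near_pointwise by (elim exE conjE) (rule that)
  obtain C2 where C2: "0 \<le> C2" and "\<forall>\<delta> L g x. 0 < \<delta> \<longrightarrow> g \<in> borel_measurable borel \<longrightarrow>
      pnorm p1 xs (fold (coord_max \<delta> L) xs g) x \<le> ennreal C2 * pnorm p1 xs g x"
    using pnorm_strong_max[of xs p1 xs, OF p1 xs(1) order_refl] by (elim exE conjE) (rule that)
  then have smax: "\<And>\<delta> L g x. 0 < \<delta> \<Longrightarrow> g \<in> borel_measurable borel \<Longrightarrow>
      pnorm p1 xs (fold (coord_max \<delta> L) xs g) x \<le> ennreal C2 * pnorm p1 xs g x" by blast
  define c where "c = C2 powr \<theta> * real (card (neighbours :: (int ^ 'n) set)) powr \<theta>"
  have c: "0 \<le> c" by (simp add: c_def)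
  define K where "K = max (C1 * c) (2 powr (n - \<alpha>))"
  interpret function_norm borel "\<lambda>f. pnorm p2 xs f 0"
    by (rule function_norm_pnorm) (rule p_le)
  show ?thesis
  proof (intro exI conjI allI impI)
    show "0 \<le> K" using C1 c by (simp add: K_def le_max_iff_disj)
    fix \<phi> :: "real ^ 'n \<Rightarrow> ennreal" and N :: ennreal and J :: int and m :: "int ^ 'n"
    assume \<phi> [measurable]: "\<phi> \<in> borel_measurable borel" and N: "\<forall>j m. cube_coeff xs p1 t1 \<phi> j m \<le> N"
    let ?M = "\<lambda>x. SUP L. fold (coord_max (side J) L) xs (near_part \<phi> J m) x"
    let ?S = "\<Sum>e\<in>neighbours. ennpowr (cube_coeff xs p1 t1 \<phi> J (m + e)) \<theta>"
    let ?s = "\<Sum>k\<in>UNIV. 1 / p2 $ k"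
    let ?w = "ennreal (side J powr (n / t2 - ?s))"
    have M [measurable]: "?M \<in> borel_measurable borel"
      by (intro borel_measurable_SUP) (auto intro: borel_measurable_fold_coord_max near_part_measurable \<phi>)
    define F where "F = ennreal (2 powr (n - \<alpha>) * side J powr (- (n / t2))) * far_sum \<phi> J m"
    have "pnorm p2 xs (\<lambda>x. riesz \<alpha> \<phi> x * indicator (dcube J m) x) 0 \<le>
       pnorm p2 xs (\<lambda>x. (ennreal C1 * ennpowr N (1 - \<theta>)) * ennpowr (?M x) \<theta> + F * indicator (dcube J m) x) 0"
      unfolding F_def by (intro norm_mono riesz_pointwise[OF near \<phi> N])
    also have "\<dots> \<le> pnorm p2 xs (\<lambda>x. (ennreal C1 * ennpowr N (1 - \<theta>)) * ennpowr (?M x) \<theta>) 0 +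
        pnorm p2 xs (\<lambda>x. F * indicator (dcube J m) x) 0"
      by (intro norm_add) measurable
    also have "\<dots> = ennreal C1 * ennpowr N (1 - \<theta>) * pnorm p2 xs (\<lambda>x. ennpowr (?M x) \<theta>) 0 +
        F * pnorm p2 xs (indicator (dcube J m)) 0"
      by (intro arg_cong2[where f="(+)"] norm_cmult) measurable
    finally have "cube_coeff xs p2 t2 (riesz \<alpha> \<phi>) J m \<le> ?w * (ennreal C1 * ennpowr N (1 - \<theta>) * pnorm p2 xs (\<lambda>x. ennpowr (?M x) \<theta>) 0 +
        F * pnorm p2 xs (indicator (dcube J m)) 0)"
      unfolding cube_coeff_def card_n[symmetric] by (rule mult_left_mono) simp
    also have "\<dots> = ennreal C1 * ennpowr N (1 - \<theta>) * (?w * pnorm p2 xs (\<lambda>x. ennpowr (?M x) \<theta>) 0) +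
        ?w * F * pnorm p2 xs (indicator (dcube J m)) 0"
      by (simp only: distrib_left ac_simps)
    also have "\<dots> \<le> ennreal C1 * ennpowr N (1 - \<theta>) * (ennreal c * ?S) + ennreal (2 powr (n - \<alpha>)) * far_sum \<phi> J m"
    proof (intro add_mono mult_left_mono)
      have "?w * pnorm p2 xs (\<lambda>x. ennpowr (?M x) \<theta>) 0 \<le> ?w * ennpowr (ennreal C2 * pnorm p1 xs (near_part \<phi> J m) 0) \<theta>"
        by (intro mult_left_mono pnorm_max_near_part[OF smax \<phi>]) auto
      also have "\<dots> \<le> ?w * ennpowr (ennreal C2 * (\<Sum>e\<in>neighbours. pnorm p1 xs (\<lambda>y. \<phi> y * indicator (dcube J (m + e)) y) 0)) \<theta>"
        using exponents by (intro mult_left_mono ennpowr_mono pnorm_near_part_le \<phi>) auto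
      also have "\<dots> \<le> ?w * (ennpowr (ennreal C2) \<theta> * (ennpowr (of_nat (card (neighbours :: (int ^ 'n) set))) \<theta> *
          (\<Sum>e\<in>neighbours. ennpowr (pnorm p1 xs (\<lambda>y. \<phi> y * indicator (dcube J (m + e)) y) 0) \<theta>)))"
        unfolding ennpowr_mult[OF exponents(4)] by (intro mult_left_mono ennpowr_sum_le exponents) auto
      also have "\<dots> = ennpowr (ennreal C2) \<theta> * ennpowr (of_nat (card (neighbours :: (int ^ 'n) set))) \<theta> *
          (\<Sum>e\<in>neighbours. ?w * ennpowr (pnorm p1 xs (\<lambda>y. \<phi> y * indicator (dcube J (m + e)) y) 0) \<theta>)"
        by (simp only: sum_distrib_left[symmetric] ac_simps)
      also have "(\<Sum>e\<in>neighbours. ?w * ennpowr (pnorm p1 xs (\<lambda>y. \<phi> y * indicator (dcube J (m + e)) y) 0) \<theta>) = ?S"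
        by (simp only: cube_coeff_powr)
      also have "ennpowr (ennreal C2) \<theta> * ennpowr (of_nat (card (neighbours :: (int ^ 'n) set))) \<theta> = ennreal c"
        using C2 by (simp add: c_def ennpowr_ennreal ennreal_mult ennreal_of_nat_eq_real_of_nat)
      finally show "?w * pnorm p2 xs (\<lambda>x. ennpowr (?M x) \<theta>) 0 \<le> ennreal c * ?S" .
      have "?w * F * pnorm p2 xs (indicator (dcube J m)) 0 \<le> ?w * F * ennreal (\<Prod>k\<in>set xs. side J powr (1 / p2 $ k))"
        unfolding dcube_def using p_le xs by (intro mult_left_mono pnorm_indicator_cell_le) auto
      also have "(\<Prod>k\<in>set xs. side J powr (1 / p2 $ k)) = side J powr ?s"
        unfolding xs by (rule powr_sum[symmetric]) simp
      also have "?w * F * ennreal (side J powr ?s) = ennreal (2 powr (n - \<alpha>)) *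
         ennreal (side J powr (n / t2 - ?s) * side J powr (- (n / t2)) * side J powr ?s) * far_sum \<phi> J m"
        by (simp add: F_def ennreal_mult ac_simps)
      \<comment> \<open>The weight, the decay of the far part and the norm of the indicator cancel
        exactly, so the far part enters without any power of the side.\<close>
      also have "side J powr (n / t2 - ?s) * side J powr (- (n / t2)) * side J powr ?s = 1"
        by (simp add: powr_add[symmetric])
      finally show "?w * F * pnorm p2 xs (indicator (dcube J m)) 0 \<le> ennreal (2 powr (n - \<alpha>)) * far_sum \<phi> J m" by simp
    qed auto
    also have "\<dots> = ennreal (C1 * c) * (ennpowr N (1 - \<theta>) * ?S) + ennreal (2 powr (n - \<alpha>)) * far_sum \<phi> J m"
      using C1 c by (simp add: ennreal_mult ac_simps)
    also have "\<dots> \<le> ennreal K * (ennpowr N (1 - \<theta>) * ?S) + ennreal K * far_sum \<phi> J m"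
      by (intro add_mono mult_right_mono ennreal_leI) (auto simp: K_def)
    finally show "cube_coeff xs p2 t2 (riesz \<alpha> \<phi>) J m \<le> ennreal K * (ennpowr N (1 - \<theta>) * ?S + far_sum \<phi> J m)"
      by (simp only: distrib_left)
  qed
qed

end

section \<open>Summation over dyadic cubes\<close>

lemma sum_le_infsum_ennreal:
  fixes f :: "'a \<Rightarrow> ennreal"
  assumes "finite F"
  shows "sum f F \<le> infsum f UNIV"
  using assms by (subst nonneg_infsum_complete) (auto intro: SUP_upper)

lemma infsum_le_ennreal:
  fixes f :: "'a \<Rightarrow> ennreal"
  assumes "\<And>F. finite F \<Longrightarrow> sum f F \<le> c"
  shows "infsum f UNIV \<le> c"
  using assms by (subst nonneg_infsum_complete) (auto intro!: SUP_least)

definition residues_mod :: "nat \<Rightarrow> (int ^ 'n::finite) set" where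
  "residues_mod K = {r. \<forall>k. 0 \<le> r $ k \<and> r $ k < 2 ^ K}"

lemma residues_mod: "finite (residues_mod K :: (int ^ 'n::finite) set)"
  "card (residues_mod K :: (int ^ 'n::finite) set) \<le> (2 ^ K) ^ CARD('n)"
proof -
  let ?P = "\<Pi>\<^sub>E k\<in>(UNIV :: 'n set). {0..<2 ^ K :: int}"
  have sub: "(residues_mod K :: (int ^ 'n) set) \<subseteq> vec_lambda ` ?P"
  proof
    fix r :: "int ^ 'n" assume "r \<in> residues_mod K"
    then have "(\<lambda>k. r $ k) \<in> ?P" "r = vec_lambda (\<lambda>k. r $ k)"
      by (auto simp: residues_mod_def)
    then show "r \<in> vec_lambda ` ?P" by (metis imageI)
  qed
  have fin: "finite ?P" by (intro finite_PiE) auto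
  show "finite (residues_mod K :: (int ^ 'n) set)"
    using sub fin by (meson finite_imageI finite_subset)
  have "card (residues_mod K :: (int ^ 'n) set) \<le> card (vec_lambda ` ?P)"
    using sub fin by (intro card_mono) auto
  also have "\<dots> \<le> card ?P" by (rule card_image_le[OF fin])
  also have "\<dots> = (2 ^ K) ^ CARD('n)" by (simp add: card_PiE nat_power_eq)
  finally show "card (residues_mod K :: (int ^ 'n) set) \<le> (2 ^ K) ^ CARD('n)" .
qed

text \<open>Each cube has \<open>2\<^sup>n\<^sup>K\<close> descendants \<open>K\<close> levels below.\<close>

lemma sum_ancestor_le:
  fixes h :: "int \<Rightarrow> int ^ 'n::finite \<Rightarrow> ennreal"
  assumes F: "finite F"
  shows "(\<Sum>(J, m)\<in>F. h (J - int K) (ancestor K m + e)) \<le>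
    ennreal (2 powr (real K * real CARD('n))) * (\<Sum>\<^sub>\<infinity>(J, m)\<in>UNIV. h J m)"
proof -
  let ?q = "\<lambda>(J :: int, m :: int ^ 'n). (J - int K, ancestor K m + e)"
  let ?r = "\<lambda>(J :: int, m :: int ^ 'n). (\<chi> k. m $ k mod 2 ^ K) :: int ^ 'n"
  \<comment> \<open>A cube is determined by its ancestor together with the residues of its index
    modulo 2^K. The injection into ancestors times residues turns multiplicity into a count of
    residues.\<close>
  let ?g = "\<lambda>x. (?q x, ?r x)"
  have inj: "inj_on ?g F"
  proof (rule inj_onI)
    fix x y assume "?g x = ?g y"
    then obtain J m J' m' where xy: "x = (J, m)" "y = (J', m')" and J: "J = J'"
      and d: "ancestor K m = ancestor K m'" and md: "(\<chi> k. m $ k mod 2 ^ K) = (\<chi> k. m' $ k mod 2 ^ K)"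
      by (cases x; cases y) auto
    have "m $ k = m' $ k" for k
    proof -
      have "m $ k div 2 ^ K = m' $ k div 2 ^ K" using arg_cong[OF d, of "\<lambda>v. v $ k"] by (simp add: ancestor_def)
      moreover have "m $ k mod 2 ^ K = m' $ k mod 2 ^ K" using arg_cong[OF md, of "\<lambda>v. v $ k"] by simp
      ultimately show ?thesis by (metis div_mult_mod_eq)
    qed
    then show "x = y" using xy J by (simp add: vec_eq_iff)
  qed
  have sub: "?g ` F \<subseteq> ?q ` F \<times> residues_mod K"
    by (auto simp: residues_mod_def)
  let ?R = "residues_mod K :: (int ^ 'n) set"
  have "(\<Sum>(J, m)\<in>F. h (J - int K) (ancestor K m + e)) = (\<Sum>x\<in>F. case_prod h (fst (?g x)))"
    by (intro sum.cong) auto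
  also have "\<dots> = (\<Sum>z\<in>?g ` F. case_prod h (fst z))"
    by (rule sum.reindex[OF inj, unfolded comp_def, symmetric])
  also have "\<dots> \<le> (\<Sum>z\<in>?q ` F \<times> ?R. case_prod h (fst z))"
    using F residues_mod(1) sub by (intro sum_mono2) auto
  also have "\<dots> = (\<Sum>q\<in>?q ` F. \<Sum>r\<in>?R. case_prod h q)"
    unfolding sum.cartesian_product by (intro sum.cong) auto
  also have "\<dots> = of_nat (card ?R) * (\<Sum>q\<in>?q ` F. case_prod h q)"
    by (simp add: sum_distrib_left)
  also have "\<dots> \<le> ennreal (2 powr (real K * real CARD('n))) * infsum (case_prod h) UNIV"
  proof (intro mult_mono sum_le_infsum_ennreal finite_imageI F)
    have "of_nat (card ?R) \<le> (of_nat ((2 ^ K) ^ CARD('n)) :: ennreal)"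
      using residues_mod(2)[where 'n='n, of K] by (intro of_nat_mono)
    also have "\<dots> = ennreal (real ((2 ^ K) ^ CARD('n)))" by (rule ennreal_of_nat_eq_real_of_nat)
    also have "real ((2 ^ K) ^ CARD('n)) = 2 powr (real K * real CARD('n))"
      by (simp add: powr_realpow[symmetric] powr_powr)
    finally show "of_nat (card ?R) \<le> ennreal (2 powr (real K * real CARD('n)))" .
  qed auto
  finally show ?thesis .
qed

lemma suminf_geometric_powr:
  assumes "0 < d"
  shows "(\<Sum>i. ennreal (2 powr (- real (Suc i) * d))) = ennreal (2 powr (- d) / (1 - 2 powr (- d)))"
proof -
  have lt: "2 powr (- d) < (1 :: real)" using assms by (simp add: powr_less_one)
  have "2 powr (- real (Suc i) * d) = 2 powr (- d) * (2 powr (- d)) ^ i" for i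
  proof -
    have "2 powr (- real (Suc i) * d) = (2 powr (- d)) powr (real (Suc i))"
      unfolding powr_powr by (simp only: mult.commute mult_minus_left mult_minus_right)
    then show ?thesis by (subst (asm) powr_realpow) auto
  qed
  moreover have "(\<lambda>i. 2 powr (- d) * (2 powr (- d)) ^ i) sums (2 powr (- d) * (1 / (1 - 2 powr (- d))))"
    using lt by (intro sums_mult geometric_sums) auto
  ultimately have sums: "(\<lambda>i. 2 powr (- real (Suc i) * d)) sums (2 powr (- d) / (1 - 2 powr (- d)))" by simp
  have "(\<Sum>i. ennreal (2 powr (- real (Suc i) * d))) = ennreal (\<Sum>i. 2 powr (- real (Suc i) * d))"
    using sums by (intro suminf_ennreal2) (auto simp: sums_iff)
  then show ?thesis using sums by (simp add: sums_iff)
qed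

lemma ennpowr_suminf_le:
  assumes q: "1 \<le> q" and w: "(\<Sum>i. w i) \<noteq> top"
  shows "ennpowr (\<Sum>i. g i * w i) q \<le> ennpowr (\<Sum>i. w i) (q - 1) * (\<Sum>i. ennpowr (g i) q * w i)"
  using ennpowr_nn_integral_le_weighted[OF q, of g "count_space UNIV" w] w
  by (simp add: nn_integral_count_space_nat)

section \<open>Summation with exponent r2 and the supremum case\<close>

context riesz_exponents
begin

text \<open>A sum rather than a maximum: the r1-th power of the source norm. Its r1-th root bounds
  every single coefficient and serves as N.\<close>

definition max_cube_coeff :: "(real ^ 'n \<Rightarrow> ennreal) \<Rightarrow> real \<Rightarrow> ennreal" where
  "max_cube_coeff \<phi> r1 = (\<Sum>\<^sub>\<infinity>(J, m)\<in>UNIV. ennpowr (cube_coeff xs p1 t1 \<phi> J m) r1)"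

context
  fixes r1 r2 :: real
  assumes r: "0 < r1" "t2 < r2" "1 \<le> r2" "r1 = \<theta> * r2"
begin

lemma r_less: "r1 < r2" "0 < r2"
  using r exponents by (simp_all add: mult_less_cancel_right1)

lemma cube_coeff_le_max_cube_coeff: "cube_coeff xs p1 t1 \<phi> J m \<le> ennpowr (max_cube_coeff \<phi> r1) (1 / r1)"
proof -
  have "ennpowr (cube_coeff xs p1 t1 \<phi> J m) r1 \<le> max_cube_coeff \<phi> r1"
    unfolding max_cube_coeff_def using sum_le_infsum_ennreal[of "{(J, m)}" "\<lambda>(J, m). ennpowr (cube_coeff xs p1 t1 \<phi> J m) r1"] by simp
  then show ?thesis using r by (simp add: ennpowr_le_iff_le_root)
qed

text \<open>The embedding of l^r1 into l^r2: the surplus power r2 - r1 of each coefficient is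
  bounded by that of the l^r1 norm.\<close>

lemma infsum_cube_coeff_r2_le:
  "(\<Sum>\<^sub>\<infinity>(J, m)\<in>UNIV. ennpowr (cube_coeff xs p1 t1 \<phi> J m) r2) \<le> ennpowr (max_cube_coeff \<phi> r1) (r2 / r1)"
proof (rule infsum_le_ennreal)
  fix F :: "(int \<times> (int ^ 'n)) set" assume F: "finite F"
  let ?N = "ennpowr (max_cube_coeff \<phi> r1) (1 / r1)"
  have "ennpowr (cube_coeff xs p1 t1 \<phi> J m) r2 \<le> ennpowr (cube_coeff xs p1 t1 \<phi> J m) r1 * ennpowr ?N (r2 - r1)" for J m
  proof -
    have "ennpowr (cube_coeff xs p1 t1 \<phi> J m) r2 = ennpowr (cube_coeff xs p1 t1 \<phi> J m) r1 * ennpowr (cube_coeff xs p1 t1 \<phi> J m) (r2 - r1)"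
      using ennpowr_add[of r1 "r2 - r1"] r r_less by simp
    also have "\<dots> \<le> ennpowr (cube_coeff xs p1 t1 \<phi> J m) r1 * ennpowr ?N (r2 - r1)"
      using r_less by (intro mult_left_mono ennpowr_mono cube_coeff_le_max_cube_coeff) auto
    finally show ?thesis .
  qed
  then have "(\<Sum>(J, m)\<in>F. ennpowr (cube_coeff xs p1 t1 \<phi> J m) r2) \<le> (\<Sum>(J, m)\<in>F. ennpowr (cube_coeff xs p1 t1 \<phi> J m) r1 * ennpowr ?N (r2 - r1))"
    by (intro sum_mono) auto
  also have "\<dots> = (\<Sum>(J, m)\<in>F. ennpowr (cube_coeff xs p1 t1 \<phi> J m) r1) * ennpowr ?N (r2 - r1)"
    by (simp add: sum_distrib_right case_prod_beta)
  also have "\<dots> \<le> max_cube_coeff \<phi> r1 * ennpowr ?N (r2 - r1)"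
    unfolding max_cube_coeff_def by (intro mult_right_mono sum_le_infsum_ennreal F) auto
  also have "\<dots> = ennpowr (max_cube_coeff \<phi> r1) (1 + (r2 - r1) / r1)"
    using r r_less by (subst ennpowr_add) (auto simp: ennpowr_ennpowr)
  also have "1 + (r2 - r1) / r1 = r2 / r1" using r(1) by (simp add: field_simps)
  finally show "(\<Sum>(J, m)\<in>F. ennpowr (cube_coeff xs p1 t1 \<phi> J m) r2) \<le> ennpowr (max_cube_coeff \<phi> r1) (r2 / r1)" .
qed

text \<open>Because \<theta> r2 = r1, the r2-th powers of the near terms are r1-th powers of
  coefficients, and N contributes the surplus power r2 - r1. Passing to a neighbour is the case K =
  0 of \<open>sum_ancestor_le\<close>.\<close>

lemma near_sum_le:
  assumes F: "finite F"
  shows "(\<Sum>(J, m)\<in>F. ennpowr (ennpowr (ennpowr (max_cube_coeff \<phi> r1) (1 / r1)) (1 - \<theta>) *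
       (\<Sum>e\<in>neighbours. ennpowr (cube_coeff xs p1 t1 \<phi> J (m + e)) \<theta>)) r2) \<le>
     ennpowr (of_nat (card (neighbours :: (int ^ 'n) set))) r2 * of_nat (card (neighbours :: (int ^ 'n) set)) * ennpowr (max_cube_coeff \<phi> r1) (r2 / r1)"
proof -
  let ?nb = "of_nat (card (neighbours :: (int ^ 'n) set)) :: ennreal"
  let ?a = "cube_coeff xs p1 t1 \<phi>" and ?S = "max_cube_coeff \<phi> r1"
  let ?c = "ennpowr ?S ((r2 - r1) / r1)"
  have c: "ennpowr (ennpowr (ennpowr ?S (1 / r1)) (1 - \<theta>)) r2 = ?c"
    using r by (simp add: ennpowr_ennpowr algebra_simps)
  have shift: "(\<Sum>(J, m)\<in>F. ennpowr (?a J (m + e)) r1) \<le> ?S" for e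
  proof -
    have "(\<Sum>(J, m)\<in>F. ennpowr (?a J (m + e)) r1) \<le> ennreal (2 powr (real 0 * real CARD('n))) * ?S"
      using sum_ancestor_le[OF F, of "\<lambda>J m. ennpowr (?a J m) r1" 0 e]
      by (simp add: max_cube_coeff_def ancestor_def)
    then show ?thesis by simp
  qed
  have "ennpowr (ennpowr (ennpowr ?S (1 / r1)) (1 - \<theta>) * (\<Sum>e\<in>neighbours. ennpowr (?a J (m + e)) \<theta>)) r2
     \<le> ?c * ennpowr ?nb r2 * (\<Sum>e\<in>neighbours. ennpowr (?a J (m + e)) r1)" for J m
  proof -
    have "ennpowr (ennpowr (ennpowr ?S (1 / r1)) (1 - \<theta>) * (\<Sum>e\<in>neighbours. ennpowr (?a J (m + e)) \<theta>)) r2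
      = ?c * ennpowr (\<Sum>e\<in>neighbours. ennpowr (?a J (m + e)) \<theta>) r2"
      using r_less by (simp only: ennpowr_mult c)
    also have "\<dots> \<le> ?c * (ennpowr ?nb r2 * (\<Sum>e\<in>neighbours. ennpowr (ennpowr (?a J (m + e)) \<theta>) r2))"
      using r_less by (intro mult_left_mono ennpowr_sum_le) auto
    finally show ?thesis by (simp add: ennpowr_ennpowr r(4) mult.assoc)
  qed
  then have "(\<Sum>(J, m)\<in>F. ennpowr (ennpowr (ennpowr ?S (1 / r1)) (1 - \<theta>) * (\<Sum>e\<in>neighbours. ennpowr (?a J (m + e)) \<theta>)) r2)
     \<le> (\<Sum>(J, m)\<in>F. ?c * ennpowr ?nb r2 * (\<Sum>e\<in>neighbours. ennpowr (?a J (m + e)) r1))"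
    by (intro sum_mono) auto
  also have "\<dots> = ?c * ennpowr ?nb r2 * (\<Sum>(J, m)\<in>F. (\<Sum>e\<in>neighbours. ennpowr (?a J (m + e)) r1))"
    unfolding case_prod_unfold by (rule sum_distrib_left[symmetric])
  also have "(\<Sum>(J, m)\<in>F. (\<Sum>e\<in>neighbours. ennpowr (?a J (m + e)) r1)) = (\<Sum>e\<in>neighbours. (\<Sum>(J, m)\<in>F. ennpowr (?a J (m + e)) r1))"
    unfolding case_prod_unfold by (rule sum.swap)
  also have "?c * ennpowr ?nb r2 * \<dots> \<le> ?c * ennpowr ?nb r2 * (\<Sum>e\<in>(neighbours :: (int ^ 'n) set). ?S)"
    by (intro mult_left_mono sum_mono shift) auto
  also have "\<dots> = ennpowr ?nb r2 * ?nb * (?S * ?c)" by (simp add: ac_simps)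
  also have "?S * ?c = ennpowr ?S (1 + (r2 - r1) / r1)"
    using r r_less by (subst ennpowr_add) auto
  also have "1 + (r2 - r1) / r1 = r2 / r1" using r(1) by (simp add: field_simps)
  finally show ?thesis .
qed

text \<open>With b = n / t2, term K of the far sum has weight 2^(-K b), while summing over all cubes
  repeats each ancestor 2^(n K) times. The condition t2 < r2 is b r2 > n. Part of the decay pays for
  Hoelder's inequality in K, the rest for the repetition.\<close>

lemma far_sum_le:
  "\<exists>C\<ge>0. \<forall>\<phi> F. finite F \<longrightarrow> (\<Sum>(J, m)\<in>F. ennpowr (far_sum \<phi> J m) r2) \<le> ennreal C * ennpowr (max_cube_coeff \<phi> r1) (r2 / r1)"
proof -
  let ?nb = "of_nat (card (neighbours :: (int ^ 'n) set)) :: ennreal"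
  define b where "b = n / t2"
  have b: "0 < b" using n_pos t_pos by (simp add: b_def)
  have br: "n < b * r2" using r(2) t_pos n_pos by (simp add: b_def field_simps)
  \<comment> \<open>Half of the available surplus: after 2^(-K \<epsilon>) is set aside as the
    Hoelder weight, the exponent (b - \<epsilon>) r2 - n equals \<open>(b * r2 - n) / 2\<close> and
    is still positive.\<close>
  define \<epsilon> where "\<epsilon> = (b * r2 - n) / (2 * r2)"
  have e: "0 < \<epsilon>" "(b - \<epsilon>) * r2 = (b * r2 + n) / 2"
    using br r_less by (simp_all add: \<epsilon>_def field_simps)
  define d where "d = (b * r2 - n) / 2"
  have d: "0 < d" using br by (simp add: d_def)
  define v where "v i = ennreal (2 powr (- real (Suc i) * \<epsilon>))" for i
  define V where "V = (\<Sum>i. v i)"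
  have V: "V = ennreal (2 powr (- \<epsilon>) / (1 - 2 powr (- \<epsilon>)))"
    unfolding V_def v_def by (rule suminf_geometric_powr[OF e(1)])
  define W where "W = (\<Sum>i. ennreal (2 powr (- real (Suc i) * d)))"
  have W: "W = ennreal (2 powr (- d) / (1 - 2 powr (- d)))"
    unfolding W_def by (rule suminf_geometric_powr[OF d])
  have fin: "ennpowr V (r2 - 1) * (ennpowr ?nb r2 * ?nb * W) < top"
    unfolding V W by (simp add: ennreal_mult_less_top of_nat_less_top)
  then obtain C where C: "0 \<le> C" "ennpowr V (r2 - 1) * (ennpowr ?nb r2 * ?nb * W) = ennreal C"
    by (cases "ennpowr V (r2 - 1) * (ennpowr ?nb r2 * ?nb * W)") auto
  show ?thesis
  proof (intro exI conjI allI impI)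
    show "0 \<le> C" by fact
    fix \<phi> :: "real ^ 'n \<Rightarrow> ennreal" and F :: "(int \<times> (int ^ 'n)) set"
    assume F: "finite F"
    let ?a = "cube_coeff xs p1 t1 \<phi>" and ?S = "max_cube_coeff \<phi> r1"
    let ?c = "\<lambda>i J m. \<Sum>e\<in>neighbours. ?a (J - int (Suc i)) (ancestor (Suc i) m + e)"
    let ?g = "\<lambda>i. ennreal (2 powr (- real (Suc i) * (b - \<epsilon>)))"
    have one: "ennpowr (far_sum \<phi> J m) r2 \<le> ennpowr V (r2 - 1) * (\<Sum>i. ennpowr (?g i * ?c i J m) r2 * v i)" for J m
    proof -
      have "ennreal (2 powr (- real (Suc i) * b)) = ?g i * v i" for i
        unfolding v_def by (simp add: ennreal_mult[symmetric] powr_add[symmetric] algebra_simps)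
      then have "far_sum \<phi> J m = (\<Sum>i. (?g i * ?c i J m) * v i)"
        unfolding far_sum_def b_def[symmetric] by (simp only: ac_simps)
      then show ?thesis
        unfolding V_def using V by (simp only:) (rule ennpowr_suminf_le[OF r(3)], simp add: V_def[symmetric])
    qed
    have two: "(\<Sum>(J, m)\<in>F. ennpowr (?g i * ?c i J m) r2 * v i) \<le>
       ennreal (2 powr (- real (Suc i) * d)) * (ennpowr ?nb r2 * ?nb * ennpowr ?S (r2 / r1))" for i
    proof -
      have "ennpowr (?g i * ?c i J m) r2 * v i \<le> ennreal (2 powr (- real (Suc i) * ((b - \<epsilon>) * r2))) * ennpowr ?nb r2 *
          (\<Sum>e\<in>neighbours. ennpowr (?a (J - int (Suc i)) (ancestor (Suc i) m + e)) r2)" for J m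
      proof -
        \<comment> \<open>Hoelder's inequality leaves a factor \<open>v i\<close>, which is at most
          1 and is dropped.\<close>
        have "- real (Suc i) * \<epsilon> \<le> 0" using e by (intro mult_nonpos_nonneg) auto
        then have "2 powr (- real (Suc i) * \<epsilon>) \<le> 2 powr 0" by (intro powr_mono) auto
        then have "v i \<le> 1" unfolding v_def using ennreal_leI[of _ 1] by simp
        then have "ennpowr (?g i * ?c i J m) r2 * v i \<le> ennpowr (?g i * ?c i J m) r2 * 1"
          by (rule mult_left_mono) simp
        also have "\<dots> = ennpowr (?g i) r2 * ennpowr (?c i J m) r2"
          using r_less by (simp add: ennpowr_mult)
        also have "ennpowr (?g i) r2 = ennreal (2 powr (- real (Suc i) * ((b - \<epsilon>) * r2)))"
          by (simp only: ennpowr_ennreal powr_ge_zero powr_powr mult.assoc)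
        also have "ennreal (2 powr (- real (Suc i) * ((b - \<epsilon>) * r2))) * ennpowr (?c i J m) r2 \<le>
            ennreal (2 powr (- real (Suc i) * ((b - \<epsilon>) * r2))) * (ennpowr ?nb r2 *
          (\<Sum>e\<in>neighbours. ennpowr (?a (J - int (Suc i)) (ancestor (Suc i) m + e)) r2))"
          using r_less by (intro mult_left_mono ennpowr_sum_le) auto
        finally show ?thesis by (simp only: mult.assoc)
      qed
      then have "(\<Sum>(J, m)\<in>F. ennpowr (?g i * ?c i J m) r2 * v i) \<le>
          (\<Sum>(J, m)\<in>F. ennreal (2 powr (- real (Suc i) * ((b - \<epsilon>) * r2))) * ennpowr ?nb r2 *
          (\<Sum>e\<in>neighbours. ennpowr (?a (J - int (Suc i)) (ancestor (Suc i) m + e)) r2))"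
        by (intro sum_mono) (auto simp del: of_nat_Suc)
      also have "\<dots> = ennreal (2 powr (- real (Suc i) * ((b - \<epsilon>) * r2))) * ennpowr ?nb r2 *
          (\<Sum>e\<in>neighbours. \<Sum>(J, m)\<in>F. ennpowr (?a (J - int (Suc i)) (ancestor (Suc i) m + e)) r2)"
        unfolding case_prod_unfold by (subst sum.swap) (rule sum_distrib_left[symmetric])
      also have "\<dots> \<le> ennreal (2 powr (- real (Suc i) * ((b - \<epsilon>) * r2))) * ennpowr ?nb r2 *
          (\<Sum>e\<in>(neighbours :: (int ^ 'n) set). ennreal (2 powr (real (Suc i) * n)) * ennpowr ?S (r2 / r1))"
      proof (intro mult_left_mono sum_mono)
        fix e :: "int ^ 'n"
        have "(\<Sum>(J, m)\<in>F. ennpowr (?a (J - int (Suc i)) (ancestor (Suc i) m + e)) r2) \<le>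
           ennreal (2 powr (real (Suc i) * n)) * (\<Sum>\<^sub>\<infinity>(J, m)\<in>UNIV. ennpowr (?a J m) r2)"
          unfolding card_n by (rule sum_ancestor_le[OF F])
        also have "\<dots> \<le> ennreal (2 powr (real (Suc i) * n)) * ennpowr ?S (r2 / r1)"
          by (intro mult_left_mono infsum_cube_coeff_r2_le) simp
        finally show "(\<Sum>(J, m)\<in>F. ennpowr (?a (J - int (Suc i)) (ancestor (Suc i) m + e)) r2) \<le>
           ennreal (2 powr (real (Suc i) * n)) * ennpowr ?S (r2 / r1)" .
      qed simp
      also have "\<dots> = (ennreal (2 powr (- real (Suc i) * ((b - \<epsilon>) * r2))) * ennreal (2 powr (real (Suc i) * n))) *
          (ennpowr ?nb r2 * ?nb * ennpowr ?S (r2 / r1))"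
        by (simp add: ac_simps)
      also have "ennreal (2 powr (- real (Suc i) * ((b - \<epsilon>) * r2))) * ennreal (2 powr (real (Suc i) * n)) =
          ennreal (2 powr (- real (Suc i) * d))"
      proof -
        have "- real (Suc i) * ((b - \<epsilon>) * r2) + real (Suc i) * n = - real (Suc i) * d"
          unfolding e d_def by (simp add: field_simps)
        then show ?thesis by (simp only: ennreal_mult[symmetric] powr_ge_zero powr_add[symmetric])
      qed
      finally show ?thesis .
    qed
    have "(\<Sum>(J, m)\<in>F. ennpowr (far_sum \<phi> J m) r2) \<le> (\<Sum>(J, m)\<in>F. ennpowr V (r2 - 1) * (\<Sum>i. ennpowr (?g i * ?c i J m) r2 * v i))"
      unfolding case_prod_unfold by (intro sum_mono one)
    also have "\<dots> = ennpowr V (r2 - 1) * (\<Sum>x\<in>F. \<Sum>i. ennpowr (?g i * ?c i (fst x) (snd x)) r2 * v i)"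
      unfolding case_prod_unfold by (rule sum_distrib_left[symmetric])
    also have "(\<Sum>x\<in>F. \<Sum>i. ennpowr (?g i * ?c i (fst x) (snd x)) r2 * v i) =
        (\<Sum>i. \<Sum>x\<in>F. ennpowr (?g i * ?c i (fst x) (snd x)) r2 * v i)"
      by (rule suminf_sum[symmetric]) auto
    also have "ennpowr V (r2 - 1) * \<dots> \<le> ennpowr V (r2 - 1) * (\<Sum>i. ennreal (2 powr (- real (Suc i) * d)) * (ennpowr ?nb r2 * ?nb * ennpowr ?S (r2 / r1)))"
      using two unfolding case_prod_unfold by (intro mult_left_mono suminf_le) auto
    also have "\<dots> = ennpowr V (r2 - 1) * (ennpowr ?nb r2 * ?nb * W) * ennpowr ?S (r2 / r1)"
      unfolding W_def ennreal_suminf_multc by (simp only: ac_simps)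
    finally show "(\<Sum>(J, m)\<in>F. ennpowr (far_sum \<phi> J m) r2) \<le> ennreal C * ennpowr ?S (r2 / r1)"
      unfolding C .
  qed
qed

text \<open>The per-cube estimate is used with N equal to the l^r1 norm, which makes near and far
  sums homogeneous of the same degree r2 in that norm.\<close>

theorem infsum_cube_coeff_riesz_le:
  "\<exists>C\<ge>0. \<forall>\<phi>. \<phi> \<in> borel_measurable borel \<longrightarrow>
    (\<Sum>\<^sub>\<infinity>(J, m)\<in>UNIV. ennpowr (cube_coeff xs p2 t2 (riesz \<alpha> \<phi>) J m) r2) \<le> ennreal C * ennpowr (max_cube_coeff \<phi> r1) (r2 / r1)"
proof -
  let ?nb = "of_nat (card (neighbours :: (int ^ 'n) set)) :: ennreal"
  obtain C1 where C1: "0 \<le> C1" and b1: "\<forall>\<phi> N J m. \<phi> \<in> borel_measurable borel \<longrightarrow> (\<forall>j m. cube_coeff xs p1 t1 \<phi> j m \<le> N) \<longrightarrow>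
    cube_coeff xs p2 t2 (riesz \<alpha> \<phi>) J m \<le>
      ennreal C1 * (ennpowr N (1 - \<theta>) * (\<Sum>e\<in>neighbours. ennpowr (cube_coeff xs p1 t1 \<phi> J (m + e)) \<theta>) + far_sum \<phi> J m)"
    using cube_coeff_riesz_le by (elim exE conjE) (rule that)
  obtain C2 where C2: "0 \<le> C2" and b2: "\<forall>\<phi> F. finite F \<longrightarrow> (\<Sum>(J, m)\<in>F. ennpowr (far_sum \<phi> J m) r2) \<le> ennreal C2 * ennpowr (max_cube_coeff \<phi> r1) (r2 / r1)"
    using far_sum_le by (elim exE conjE) (rule that)
  have "ennpowr (ennreal C1) r2 * (ennpowr 2 r2 * (ennpowr ?nb r2 * ?nb + ennreal C2)) < top"
    by (simp add: ennreal_mult_less_top of_nat_less_top)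
  then obtain C where C: "0 \<le> C" "ennpowr (ennreal C1) r2 * (ennpowr 2 r2 * (ennpowr ?nb r2 * ?nb + ennreal C2)) = ennreal C"
    by (cases "ennpowr (ennreal C1) r2 * (ennpowr 2 r2 * (ennpowr ?nb r2 * ?nb + ennreal C2))") auto
  show ?thesis
  proof (intro exI conjI allI impI)
    show "0 \<le> C" by fact
    fix \<phi> :: "real ^ 'n \<Rightarrow> ennreal" assume \<phi>: "\<phi> \<in> borel_measurable borel"
    let ?S = "max_cube_coeff \<phi> r1"
    let ?A = "\<lambda>J m. ennpowr (ennpowr ?S (1 / r1)) (1 - \<theta>) * (\<Sum>e\<in>neighbours. ennpowr (cube_coeff xs p1 t1 \<phi> J (m + e)) \<theta>)"
    show "(\<Sum>\<^sub>\<infinity>(J, m)\<in>UNIV. ennpowr (cube_coeff xs p2 t2 (riesz \<alpha> \<phi>) J m) r2) \<le> ennreal C * ennpowr ?S (r2 / r1)"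
    proof (rule infsum_le_ennreal)
      fix F :: "(int \<times> (int ^ 'n)) set" assume F: "finite F"
      let ?K = "ennpowr (ennreal C1) r2 * ennpowr 2 r2"
      have "ennpowr (cube_coeff xs p2 t2 (riesz \<alpha> \<phi>) J m) r2 \<le> ?K * (ennpowr (?A J m) r2 + ennpowr (far_sum \<phi> J m) r2)" for J m
      proof -
        have "cube_coeff xs p2 t2 (riesz \<alpha> \<phi>) J m \<le> ennreal C1 * (?A J m + far_sum \<phi> J m)"
          using b1 \<phi> cube_coeff_le_max_cube_coeff[of \<phi>] by blast
        then have "ennpowr (cube_coeff xs p2 t2 (riesz \<alpha> \<phi>) J m) r2 \<le> ennpowr (ennreal C1 * (?A J m + far_sum \<phi> J m)) r2"
          using r_less by (intro ennpowr_mono) auto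
        also have "\<dots> = ennpowr (ennreal C1) r2 * ennpowr (?A J m + far_sum \<phi> J m) r2"
          by (rule ennpowr_mult[OF r_less(2)])
        also have "\<dots> \<le> ennpowr (ennreal C1) r2 * (ennpowr 2 r2 * (ennpowr (?A J m) r2 + ennpowr (far_sum \<phi> J m) r2))"
          by (intro mult_left_mono ennpowr_add_le r_less) auto
        finally show ?thesis by (simp only: mult.assoc)
      qed
      then have "(\<Sum>(J, m)\<in>F. ennpowr (cube_coeff xs p2 t2 (riesz \<alpha> \<phi>) J m) r2) \<le>
          (\<Sum>(J, m)\<in>F. ?K * (ennpowr (?A J m) r2 + ennpowr (far_sum \<phi> J m) r2))"
        by (intro sum_mono) auto
      also have "\<dots> = ?K * ((\<Sum>(J, m)\<in>F. ennpowr (?A J m) r2) + (\<Sum>(J, m)\<in>F. ennpowr (far_sum \<phi> J m) r2))"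
        unfolding case_prod_unfold sum.distrib[symmetric] by (rule sum_distrib_left[symmetric])
      also have "\<dots> \<le> ?K * (ennpowr ?nb r2 * ?nb * ennpowr ?S (r2 / r1) + ennreal C2 * ennpowr ?S (r2 / r1))"
        using b2 F by (intro mult_left_mono add_mono near_sum_le) auto
      also have "\<dots> = ennreal C * ennpowr ?S (r2 / r1)"
        unfolding C(2)[symmetric] by (simp only: distrib_right mult.assoc distrib_left)
      finally show "(\<Sum>(J, m)\<in>F. ennpowr (cube_coeff xs p2 t2 (riesz \<alpha> \<phi>) J m) r2) \<le> ennreal C * ennpowr ?S (r2 / r1)" .
    qed
  qed
qed

end

text \<open>For r = \<infinity> the powers recombine as N^(1-\<theta>) N^\<theta> = N, and the far
  sum is a plain geometric series, since no cube is counted repeatedly.\<close>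

theorem SUP_cube_coeff_riesz_le:
  "\<exists>C\<ge>0. \<forall>\<phi> N J m. \<phi> \<in> borel_measurable borel \<longrightarrow> (\<forall>j m. cube_coeff xs p1 t1 \<phi> j m \<le> N) \<longrightarrow>
    cube_coeff xs p2 t2 (riesz \<alpha> \<phi>) J m \<le> ennreal C * N"
proof -
  obtain C1 where C1: "0 \<le> C1" and b1: "\<forall>\<phi> N J m. \<phi> \<in> borel_measurable borel \<longrightarrow> (\<forall>j m. cube_coeff xs p1 t1 \<phi> j m \<le> N) \<longrightarrow>
    cube_coeff xs p2 t2 (riesz \<alpha> \<phi>) J m \<le>
      ennreal C1 * (ennpowr N (1 - \<theta>) * (\<Sum>e\<in>neighbours. ennpowr (cube_coeff xs p1 t1 \<phi> J (m + e)) \<theta>) + far_sum \<phi> J m)"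
    using cube_coeff_riesz_le by (elim exE conjE) (rule that)
  let ?nb = "of_nat (card (neighbours :: (int ^ 'n) set)) :: ennreal"
  define W where "W = (\<Sum>i. ennreal (2 powr (- real (Suc i) * (n / t2))))"
  have W: "W = ennreal (2 powr (- (n / t2)) / (1 - 2 powr (- (n / t2))))"
    unfolding W_def using n_pos t_pos by (intro suminf_geometric_powr) auto
  have "ennreal C1 * (?nb + W * ?nb) < top"
    unfolding W by (simp add: ennreal_mult_less_top of_nat_less_top)
  then obtain C where C: "0 \<le> C" "ennreal C1 * (?nb + W * ?nb) = ennreal C"
    by (cases "ennreal C1 * (?nb + W * ?nb)") auto
  show ?thesis
  proof (intro exI conjI allI impI)
    show "0 \<le> C" by fact
    fix \<phi> :: "real ^ 'n \<Rightarrow> ennreal" and N :: ennreal and J :: int and m :: "int ^ 'n"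
    assume \<phi>: "\<phi> \<in> borel_measurable borel" and N: "\<forall>j m. cube_coeff xs p1 t1 \<phi> j m \<le> N"
    have "(\<Sum>e\<in>neighbours. ennpowr (cube_coeff xs p1 t1 \<phi> J (m + e)) \<theta>) \<le> (\<Sum>e\<in>(neighbours :: (int ^ 'n) set). ennpowr N \<theta>)"
      using N exponents by (intro sum_mono ennpowr_mono) auto
    then have 1: "ennpowr N (1 - \<theta>) * (\<Sum>e\<in>neighbours. ennpowr (cube_coeff xs p1 t1 \<phi> J (m + e)) \<theta>) \<le> ennpowr N (1 - \<theta>) * (?nb * ennpowr N \<theta>)"
      by (intro mult_left_mono) auto
    have 2: "ennpowr N (1 - \<theta>) * (?nb * ennpowr N \<theta>) = ?nb * N"
      using ennpowr_add[of "1 - \<theta>" \<theta> N] exponents by (simp add: ac_simps)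
    have "far_sum \<phi> J m \<le> (\<Sum>i. ennreal (2 powr (- real (Suc i) * (n / t2))) * (?nb * N))"
      unfolding far_sum_def
    proof (intro suminf_le mult_left_mono)
      fix i
      have "(\<Sum>e\<in>neighbours. cube_coeff xs p1 t1 \<phi> (J - int (Suc i)) (ancestor (Suc i) m + e)) \<le> (\<Sum>e\<in>(neighbours :: (int ^ 'n) set). N)"
        using N by (intro sum_mono) auto
      then show "(\<Sum>e\<in>neighbours. cube_coeff xs p1 t1 \<phi> (J - int (Suc i)) (ancestor (Suc i) m + e)) \<le> ?nb * N" by simp
    qed auto
    also have "\<dots> = W * (?nb * N)" unfolding W_def by (rule ennreal_suminf_multc)
    finally have 3: "far_sum \<phi> J m \<le> W * (?nb * N)" .
    have "cube_coeff xs p2 t2 (riesz \<alpha> \<phi>) J m \<le> ennreal C1 * (ennpowr N (1 - \<theta>) * (\<Sum>e\<in>neighbours. ennpowr (cube_coeff xs p1 t1 \<phi> J (m + e)) \<theta>) + far_sum \<phi> J m)"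
      using b1 \<phi> N by blast
    also have "\<dots> \<le> ennreal C1 * (?nb * N + W * (?nb * N))"
      using 1 3 unfolding 2 by (intro mult_left_mono add_mono) auto
    also have "\<dots> = ennreal C * N"
      unfolding C(2)[symmetric] by (simp only: distrib_right mult.assoc distrib_left)
    finally show "cube_coeff xs p2 t2 (riesz \<alpha> \<phi>) J m \<le> ennreal C * N" .
  qed
qed

end

section \<open>The Bourgain-Morrey norm in terms of cube coefficients\<close>

lemma measure_dcube: "measure lebesgue (dcube j m :: (real ^ 'n::finite) set) = side j powr (real CARD('n))"
proof -
  let ?a = "\<chi> k. side j * of_int (m $ k) :: real ^ 'n"
  let ?b = "\<chi> k. side j * of_int (m $ k) + side j :: real ^ 'n"
  have prod: "(\<Prod>b\<in>Basis. (?b - ?a) \<bullet> b) = side j powr (real CARD('n))"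
    by (simp add: prod_Basis_vec powr_realpow)
  have le: "?a \<bullet> b \<le> ?b \<bullet> b" if "b \<in> Basis" for b
    using that less_imp_le[OF side_pos(1)] by (auto simp: Basis_vec_real inner_axis)
  have "emeasure lborel (box ?a ?b) = ennreal (side j powr (real CARD('n)))"
    using emeasure_lborel_box[of ?a ?b] le prod by simp
  moreover have "emeasure lborel (cbox ?a ?b) = ennreal (side j powr (real CARD('n)))"
    using emeasure_lborel_cbox[of ?a ?b] le prod by simp
  moreover have "box ?a ?b \<subseteq> dcube j m" "dcube j m \<subseteq> cbox ?a ?b"
    by (auto simp: dcube_def cell_def mem_box_cart less_imp_le)
  then have "emeasure lborel (box ?a ?b) \<le> emeasure lborel (dcube j m)"
    "emeasure lborel (dcube j m) \<le> emeasure lborel (cbox ?a ?b)"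
    by (auto intro!: emeasure_mono)
  ultimately have "emeasure lborel (dcube j m :: (real ^ 'n) set) = ennreal (side j powr (real CARD('n)))"
    by (simp add: antisym)
  then show ?thesis by (simp add: measure_def)
qed

lemma measure_dcube_powr:
  "measure lebesgue (dcube j m :: (real ^ 'n::finite) set) powr (c / t - c / real CARD('n) * s) =
    side j powr ((real CARD('n) / t - s) * c)"
  unfolding measure_dcube powr_powr by (intro arg_cong[of _ _ "(powr) (side j)"]) (simp add: algebra_simps)

text \<open>The measure of a cube determines its level, and its lower corner then determines the
  index. Thus a sum over the set of cubes can be reindexed by levels and indices without
  repetition.\<close>

lemma inj_dcube: "inj (\<lambda>(j, m). dcube j m :: (real ^ 'n::finite) set)"
proof (rule injI)
  fix x y :: "int \<times> (int ^ 'n)"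
  assume eq: "(case x of (j, m) \<Rightarrow> dcube j m) = (case y of (j, m) \<Rightarrow> dcube j m)"
  obtain j m j' m' where xy: "x = (j, m)" "y = (j', m')" by (cases x; cases y)
  have d: "dcube j m = dcube j' m'" using eq xy by simp
  then have "side j powr (real CARD('n)) = side j' powr (real CARD('n))"
    using measure_dcube[of j m] measure_dcube[of j' m'] by simp
  then have "2 powr (- real_of_int j * real CARD('n)) = 2 powr (- real_of_int j' * real CARD('n))"
    by (simp add: side_def powr_powr)
  then have j: "j = j'" by (simp add: powr_inj)
  have "(\<chi> k. side j * of_int (m $ k)) \<in> dcube j m"
    by (simp add: dcube_def cell_def)
  then have "cube_index j (\<chi> k. side j * of_int (m $ k)) = m" "cube_index j (\<chi> k. side j * of_int (m $ k)) = m'"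
    using d j by (auto simp flip: mem_dcube_iff)
  then show "x = y" using xy j by simp
qed

lemma dyadic_cubes_eq: "dyadic_cubes = range (\<lambda>(j, m). dcube j m :: (real ^ 'n::finite) set)"
  by (auto simp: dyadic_cubes_def dyadic_cube_eq image_iff)

abbreviation coords :: "'n::{finite,linorder} list" where
  "coords \<equiv> sorted_list_of_set UNIV"

lemma mixed_norm_eq:
  fixes f :: "real ^ 'n::{finite,linorder} \<Rightarrow> complex"
  assumes "AE x in lborel. ennreal (norm (f x)) = \<phi> x"
  shows "mixed_norm p (\<lambda>x. f x * indicator Q x) = pnorm p coords (\<lambda>x. \<phi> x * indicator Q x) 0"
proof -
  have "mixed_norm p (\<lambda>x. f x * indicator Q x) = pnorm p coords (\<lambda>x. ennreal (norm (f x * indicator Q x))) 0"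
    by (simp add: mixed_norm_def pnorm_def)
  also have "\<dots> = pnorm p coords (\<lambda>x. \<phi> x * indicator Q x) 0"
  proof (rule pnorm_cong_AE)
    show "AE x in lborel. ennreal (norm (f x * indicator Q x)) = \<phi> x * indicator Q x"
      using assms by eventually_elim (auto simp: indicator_def)
  qed simp
  finally show ?thesis .
qed

text \<open>Almost everywhere equality suffices, so a Lebesgue measurable f may be represented by
  the absolute value of a Borel function.\<close>

lemma bourgain_morrey_norm_eq:
  fixes f :: "real ^ 'n::{finite,linorder} \<Rightarrow> complex"
  assumes f: "AE x in lborel. ennreal (norm (f x)) = \<phi> x"
  shows "bourgain_morrey_norm p t \<infinity> f = (SUP (j, m)\<in>UNIV. cube_coeff coords p t \<phi> j m)"
    and "0 < r \<Longrightarrow> bourgain_morrey_norm p t (ereal r) f =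
      ennpowr (\<Sum>\<^sub>\<infinity>(j, m)\<in>UNIV. ennpowr (cube_coeff coords p t \<phi> j m) r) (1 / r)"
proof -
  let ?s = "\<Sum>i\<in>UNIV. 1 / p $ i"
  have 1: "ennreal (measure lebesgue (dcube j m) powr (1 / t - 1 / real CARD('n) * ?s)) *
      mixed_norm p (\<lambda>x. f x * indicator (dcube j m) x) = cube_coeff coords p t \<phi> j m" for j m
    unfolding measure_dcube_powr cube_coeff_def mixed_norm_eq[OF f] by simp
  show "bourgain_morrey_norm p t \<infinity> f = (SUP (j, m)\<in>UNIV. cube_coeff coords p t \<phi> j m)"
    unfolding bourgain_morrey_norm_def dyadic_cubes_eq image_image case_prod_unfold 1
    by (simp only: if_True refl)
  assume r: "0 < r"
  have 2: "ennreal (measure lebesgue (dcube j m) powr (r / t - r / real CARD('n) * ?s)) *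
      ennpowr (mixed_norm p (\<lambda>x. f x * indicator (dcube j m) x)) r = ennpowr (cube_coeff coords p t \<phi> j m) r" for j m
    unfolding measure_dcube_powr cube_coeff_def mixed_norm_eq[OF f]
    using r by (simp add: ennpowr_mult ennpowr_ennreal powr_powr)
  have "(\<Sum>\<^sub>\<infinity>Q\<in>dyadic_cubes. ennreal (measure lebesgue Q powr (r / t - r / real CARD('n) * ?s)) *
      ennpowr (mixed_norm p (\<lambda>x. f x * indicator Q x)) r) = (\<Sum>\<^sub>\<infinity>(j, m)\<in>UNIV. ennpowr (cube_coeff coords p t \<phi> j m) r)"
    unfolding dyadic_cubes_eq by (subst infsum_reindex[OF inj_dcube]) (simp only: comp_def case_prod_unfold 2)
  then show "bourgain_morrey_norm p t (ereal r) f = ennpowr (\<Sum>\<^sub>\<infinity>(j, m)\<in>UNIV. ennpowr (cube_coeff coords p t \<phi> j m) r) (1 / r)"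
    by (simp add: bourgain_morrey_norm_def)
qed

section \<open>Borel representatives and integrability almost everywhere\<close>

lemma lebesgue_measurable_complex_AE_borel:
  fixes f :: "'a::euclidean_space \<Rightarrow> complex"
  assumes f: "f \<in> borel_measurable lebesgue"
  obtains g where "g \<in> borel_measurable borel" "AE x in lborel. f x = g x"
proof -
  have "(\<lambda>x. Re (f x)) \<in> borel_measurable (completion lborel)" "(\<lambda>x. Im (f x)) \<in> borel_measurable (completion lborel)"
    using f by measurable
  from this[THEN completion_ex_borel_measurable_real]
  obtain u v where uv: "u \<in> borel_measurable lborel" "AE x in lborel. Re (f x) = u x"
    "v \<in> borel_measurable lborel" "AE x in lborel. Im (f x) = v x" by blast
  show ?thesis
  proof
    show "(\<lambda>x. Complex (u x) (v x)) \<in> borel_measurable borel"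
      using uv by (subst borel_measurable_complex_iff) auto
    show "AE x in lborel. f x = Complex (u x) (v x)"
      using uv(2,4) by eventually_elim (simp add: complex_eq_iff)
  qed
qed

lemma kernel_mult_norm:
  "ennreal (norm (frac_integrand \<alpha> f x y)) = ennreal (norm (f y)) * kernel \<alpha> x y"
  by (simp add: frac_integrand_def kernel_def norm_divide ennreal_mult[symmetric])

lemma frac_integrand_measurable [measurable]:
  fixes g :: "real ^ 'n::finite \<Rightarrow> complex"
  assumes [measurable]: "g \<in> borel_measurable borel"
  shows "(\<lambda>(x, y). frac_integrand \<alpha> g x y) \<in> borel_measurable (borel \<Otimes>\<^sub>M borel)"
  unfolding frac_integrand_def by measurable

context riesz_exponents
begin

text \<open>A finite coefficient on a unit cube makes the potential integrable there, by Hoelder's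
  inequality, hence finite almost everywhere on it. Countably many unit cubes cover the
  space.\<close>

lemma riesz_finite_AE:
  assumes [measurable]: "\<phi> \<in> borel_measurable borel" and fin: "\<And>j m. cube_coeff xs p2 t2 (riesz \<alpha> \<phi>) j m < top"
  shows "AE x in lborel. riesz \<alpha> \<phi> x < top"
proof -
  have m: "AE x in lborel. x \<in> dcube 0 m \<longrightarrow> riesz \<alpha> \<phi> x < top" for m
  proof -
    have "pnorm p2 xs (\<lambda>y. riesz \<alpha> \<phi> y * indicator (dcube 0 m) y) 0 < top"
      using fin[of 0 m] by (simp add: cube_coeff_def side_def)
    moreover have "(\<integral>\<^sup>+y. riesz \<alpha> \<phi> y * indicator (dcube 0 m) y \<partial>lborel) \<le>
        ennreal (side 0 powr (real CARD('n) - (\<Sum>k\<in>UNIV. 1 / p2 $ k))) * pnorm p2 xs (\<lambda>y. riesz \<alpha> \<phi> y * indicator (dcube 0 m) y) 0"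
      unfolding dcube_def by (intro nn_integral_cell_le_pnorm p_le xs) auto
    ultimately have "(\<integral>\<^sup>+y. riesz \<alpha> \<phi> y * indicator (dcube 0 m) y \<partial>lborel) \<noteq> top"
      by (auto simp: ennreal_mult_less_top top_unique side_def)
    then have "AE y in lborel. riesz \<alpha> \<phi> y * indicator (dcube 0 m) y \<noteq> \<infinity>"
      by (intro nn_integral_PInf_AE) auto
    then show ?thesis by eventually_elim (auto simp: less_top)
  qed
  have "countable (UNIV :: (int ^ 'n) set)"
  proof -
    have "(UNIV :: (int ^ 'n) set) = vec_lambda ` (\<Pi>\<^sub>E k\<in>UNIV. UNIV)"
      by (auto simp: image_iff) (metis vec_lambda_eta)
    then show ?thesis by (metis countableI_type countable_PiE countable_image finite)
  qed
  then have "AE x in lborel. \<forall>m\<in>UNIV. x \<in> dcube 0 m \<longrightarrow> riesz \<alpha> \<phi> x < top"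
    using m by (subst AE_ball_countable) auto
  then show ?thesis
    by eventually_elim (simp add: mem_dcube_iff)
qed

end

text \<open>For every x the integrands of f and of its Borel representative g differ only on the
  null set where f and g differ. So the two fractional integrals agree at every point, and joint
  measurability is needed for g alone.\<close>

lemma
  fixes f :: "real ^ 'n::finite \<Rightarrow> complex"
  assumes f: "f \<in> borel_measurable lebesgue" and g [measurable]: "g \<in> borel_measurable borel"
    and fg: "AE x in lborel. f x = g x"
  shows borel_measurable_frac_integral: "frac_integral \<alpha> f \<in> borel_measurable borel"
    and norm_frac_integral_le: "ennreal (norm (frac_integral \<alpha> f x)) \<le> riesz \<alpha> (\<lambda>y. ennreal (norm (g y))) x"
    and integrable_frac_integrand:
      "riesz \<alpha> (\<lambda>y. ennreal (norm (g y))) x < top \<Longrightarrow> integrable lebesgue (frac_integrand \<alpha> f x)"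
proof -
  have gx [measurable]: "frac_integrand \<alpha> g x \<in> borel_measurable borel" for x
    unfolding frac_integrand_def[abs_def] by measurable
  have AEx: "AE y in lebesgue. frac_integrand \<alpha> f x y = frac_integrand \<alpha> g x y" for x
    using AE_completion[OF fg] by eventually_elim (simp add: frac_integrand_def)
  have meas_g: "frac_integrand \<alpha> g x \<in> borel_measurable lebesgue" for x
    using gx[of x] by (intro measurable_completion) simp
  have meas_f: "frac_integrand \<alpha> f x \<in> borel_measurable lebesgue" for x
  proof -
    have "(\<lambda>y. of_real (norm (x - y) powr (real CARD('n) - \<alpha>)) :: complex) \<in> borel_measurable lebesgue"
      by (intro measurable_completion) measurable
    then show ?thesis unfolding frac_integrand_def[abs_def] by (intro borel_measurable_divide f)
  qed
  have int_eq: "frac_integral \<alpha> f x = (\<integral>y. frac_integrand \<alpha> g x y \<partial>lborel)" for x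
  proof -
    have "frac_integral \<alpha> f x = (\<integral>y. frac_integrand \<alpha> g x y \<partial>lebesgue)"
      unfolding frac_integral_def by (intro integral_cong_AE meas_f meas_g AEx)
    also have "\<dots> = (\<integral>y. frac_integrand \<alpha> g x y \<partial>lborel)"
      by (rule integral_completion) simp
    finally show ?thesis .
  qed
  then have "frac_integral \<alpha> f = (\<lambda>x. \<integral>y. frac_integrand \<alpha> g x y \<partial>lborel)" by auto
  moreover have "(\<lambda>x. \<integral>y. frac_integrand \<alpha> g x y \<partial>lborel) \<in> borel_measurable borel"
    by (rule lborel.borel_measurable_lebesgue_integral) measurable
  ultimately show "frac_integral \<alpha> f \<in> borel_measurable borel" by simp
  have riesz_eq: "riesz \<alpha> (\<lambda>y. ennreal (norm (g y))) x = (\<integral>\<^sup>+y. ennreal (norm (frac_integrand \<alpha> g x y)) \<partial>lborel)" for x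
    by (simp add: riesz_def kernel_mult_norm)
  show "ennreal (norm (frac_integral \<alpha> f x)) \<le> riesz \<alpha> (\<lambda>y. ennreal (norm (g y))) x"
  proof (cases "integrable lborel (frac_integrand \<alpha> g x)")
    case True
    then show ?thesis unfolding int_eq riesz_eq by (rule integral_norm_bound_ennreal)
  next
    \<comment> \<open>Here the Bochner integral has its default value 0, and the bound holds
      trivially.\<close>
    case False
    then show ?thesis unfolding int_eq by (simp add: not_integrable_integral_eq)
  qed
  assume "riesz \<alpha> (\<lambda>y. ennreal (norm (g y))) x < top"
  then have "integrable lborel (frac_integrand \<alpha> g x)"
    unfolding riesz_eq by (intro integrableI_bounded) auto
  then have "integrable lebesgue (frac_integrand \<alpha> g x)"
    by (subst integrable_completion) auto
  then show "integrable lebesgue (frac_integrand \<alpha> f x)"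
    using integrable_cong_AE[OF meas_f meas_g AEx] by blast
qed

lemma pnorm_cube_coeff_mono:
  assumes "\<And>i. 0 < p $ i" "\<And>x. \<psi> x \<le> \<phi> x"
  shows "cube_coeff xs p t \<psi> j m \<le> cube_coeff xs p t \<phi> j m"
  unfolding cube_coeff_def using assms by (intro mult_left_mono pnorm_mono mult_right_mono) auto

theorem theorem6p23:
  fixes p1 p2 :: "real ^ 'n::{finite,linorder}"
    and t1 t2 \<alpha> :: real and r1 r2 :: ereal
  assumes p1: "\<forall>i. 1 < p1 $ i" and p2: "\<forall>i. 1 < p2 $ i"
    and j1: "(1 < real CARD('n) / (\<Sum>i\<in>UNIV. 1 / p1 $ i) \<and>
              real CARD('n) / (\<Sum>i\<in>UNIV. 1 / p1 $ i) < t1 \<and> ereal t1 < r1 \<and> r1 < \<infinity>) \<or>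
             (1 < real CARD('n) / (\<Sum>i\<in>UNIV. 1 / p1 $ i) \<and>
              real CARD('n) / (\<Sum>i\<in>UNIV. 1 / p1 $ i) \<le> t1 \<and> ereal t1 < r1 \<and> r1 = \<infinity>)"
    and j2: "(1 < real CARD('n) / (\<Sum>i\<in>UNIV. 1 / p2 $ i) \<and>
              real CARD('n) / (\<Sum>i\<in>UNIV. 1 / p2 $ i) < t2 \<and> ereal t2 < r2 \<and> r2 < \<infinity>) \<or>
             (1 < real CARD('n) / (\<Sum>i\<in>UNIV. 1 / p2 $ i) \<and>
              real CARD('n) / (\<Sum>i\<in>UNIV. 1 / p2 $ i) \<le> t2 \<and> ereal t2 < r2 \<and> r2 = \<infinity>)"
    and alpha: "0 < \<alpha>" "\<alpha> < real CARD('n)"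
    and t: "1 / t2 = 1 / t1 - \<alpha> / real CARD('n)"
    and tp: "t1 *\<^sub>R p2 = t2 *\<^sub>R p1"
    and tr: "ereal t1 * r2 = ereal t2 * r1"
  shows "\<exists>C>0. \<forall>f\<in>bourgain_morrey p1 t1 r1.
           (AE x in lebesgue. integrable lebesgue (frac_integrand \<alpha> f x)) \<and>
           frac_integral \<alpha> f \<in> bourgain_morrey p2 t2 r2 \<and>
           bourgain_morrey_norm p2 t2 r2 (frac_integral \<alpha> f)
             \<le> ennreal C * bourgain_morrey_norm p1 t1 r1 f"
proof -
  have tgt: "1 < t1" "1 < t2" using j1 j2 by auto
  interpret R: riesz_exponents p1 p2 t1 t2 \<alpha> "real CARD('n)" "coords :: 'n list"
  proof
    fix i
    have "t1 * p2 $ i = t2 * p1 $ i" using arg_cong[OF tp, of "\<lambda>v. v $ i"] by simp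
    then show "p1 $ i = t1 / t2 * p2 $ i" using tgt by (simp add: field_simps)
  qed (use p1 p2 tgt alpha t in auto)
  have pos: "0 < p2 $ i" for i using p2[rule_format, of i] by simp
  \<comment> \<open>The finite and the infinite case share this part. N1 and N2 stand for the two
    norms as functionals of the absolute value; monotonicity of N2 passes from the potential of the
    absolute value to the fractional integral, and finiteness of its coefficients gives
    integrability almost everywhere.\<close>
  have main: "\<exists>C>0. \<forall>f\<in>bourgain_morrey p1 t1 r1.
           (AE x in lebesgue. integrable lebesgue (frac_integrand \<alpha> f x)) \<and>
           frac_integral \<alpha> f \<in> bourgain_morrey p2 t2 r2 \<and>
           bourgain_morrey_norm p2 t2 r2 (frac_integral \<alpha> f)
             \<le> ennreal C * bourgain_morrey_norm p1 t1 r1 f"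
    if N1: "\<And>f \<phi>. AE x in lborel. ennreal (norm (f x)) = \<phi> x \<Longrightarrow> bourgain_morrey_norm p1 t1 r1 f = N1 \<phi>"
      and N2: "\<And>f \<phi>. AE x in lborel. ennreal (norm (f x)) = \<phi> x \<Longrightarrow> bourgain_morrey_norm p2 t2 r2 f = N2 \<phi>"
      and mono: "\<And>\<phi> \<psi>. (\<And>x. \<psi> x \<le> \<phi> x) \<Longrightarrow> N2 \<psi> \<le> N2 \<phi>"
      and fin: "\<And>\<phi> j m. N2 \<phi> < top \<Longrightarrow> cube_coeff coords p2 t2 \<phi> j m < top"
      and C: "0 \<le> C" "\<And>\<phi>. \<phi> \<in> borel_measurable borel \<Longrightarrow> N2 (riesz \<alpha> \<phi>) \<le> ennreal C * N1 \<phi>" for N1 N2 C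
  proof (intro exI[of _ "C + 1"] conjI ballI)
    \<comment> \<open>Adding 1 makes the constant positive even if C = 0.\<close>
    show "0 < C + 1" using C by simp
    fix f assume "f \<in> bourgain_morrey p1 t1 r1"
    then have f: "f \<in> borel_measurable lebesgue" and f_fin: "bourgain_morrey_norm p1 t1 r1 f < top"
      by (auto simp: bourgain_morrey_def)
    obtain g where g [measurable]: "g \<in> borel_measurable borel" and fg: "AE x in lborel. f x = g x"
      using lebesgue_measurable_complex_AE_borel[OF f] by blast
    define \<phi> where "\<phi> = (\<lambda>y. ennreal (norm (g y)))"
    have [measurable]: "\<phi> \<in> borel_measurable borel" unfolding \<phi>_def by measurable
    have f_norm: "bourgain_morrey_norm p1 t1 r1 f = N1 \<phi>"
      using fg by (intro N1) (auto simp: \<phi>_def elim: eventually_mono)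
    have bound: "N2 (riesz \<alpha> \<phi>) \<le> ennreal C * N1 \<phi>" by (intro C) measurable
    also have "\<dots> < top" using f_fin unfolding f_norm by (simp add: ennreal_mult_less_top)
    finally have fin2: "N2 (riesz \<alpha> \<phi>) < top" .
    have "AE x in lborel. riesz \<alpha> \<phi> x < top"
      using fin[OF fin2] by (intro R.riesz_finite_AE) auto
    then have "AE x in lborel. integrable lebesgue (frac_integrand \<alpha> f x)"
      by (rule eventually_mono) (unfold \<phi>_def, rule integrable_frac_integrand[OF f g fg])
    then show "AE x in lebesgue. integrable lebesgue (frac_integrand \<alpha> f x)" by (rule AE_completion)
    have "bourgain_morrey_norm p2 t2 r2 (frac_integral \<alpha> f) = N2 (\<lambda>x. ennreal (norm (frac_integral \<alpha> f x)))"
      by (intro N2) simp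
    also have "\<dots> \<le> N2 (riesz \<alpha> \<phi>)"
      unfolding \<phi>_def by (intro mono norm_frac_integral_le[OF f g fg])
    finally have le: "bourgain_morrey_norm p2 t2 r2 (frac_integral \<alpha> f) \<le> N2 (riesz \<alpha> \<phi>)" .
    have "frac_integral \<alpha> f \<in> borel_measurable lebesgue"
      using borel_measurable_frac_integral[OF f g fg] by (intro measurable_completion) simp
    then show "frac_integral \<alpha> f \<in> bourgain_morrey p2 t2 r2"
      using le fin2 by (simp add: bourgain_morrey_def order_le_less_trans)
    have "ennreal C * N1 \<phi> \<le> ennreal (C + 1) * N1 \<phi>"
      by (intro mult_right_mono ennreal_leI) auto
    then show "bourgain_morrey_norm p2 t2 r2 (frac_integral \<alpha> f) \<le> ennreal (C + 1) * bourgain_morrey_norm p1 t1 r1 f"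
      unfolding f_norm using le bound by (meson order_trans)
  qed
  show ?thesis
  proof (cases "r1 = \<infinity>")
    case True
    \<comment> \<open>From t1 r2 = t2 r1 with t1 and t2 positive.\<close>
    then have r2: "r2 = \<infinity>" using tr tgt by (cases r2) auto
    obtain C where C: "0 \<le> C" and bound: "\<forall>\<phi> N J m. \<phi> \<in> borel_measurable borel \<longrightarrow> (\<forall>j m. cube_coeff coords p1 t1 \<phi> j m \<le> N) \<longrightarrow>
        cube_coeff coords p2 t2 (riesz \<alpha> \<phi>) J m \<le> ennreal C * N"
      using R.SUP_cube_coeff_riesz_le by (elim exE conjE) (rule that)
    show ?thesis
    proof (rule main[OF _ _ _ _ C])
      show "bourgain_morrey_norm p1 t1 r1 f = (SUP (j, m)\<in>UNIV. cube_coeff coords p1 t1 \<phi> j m)"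
        if "AE x in lborel. ennreal (norm (f x)) = \<phi> x" for f \<phi>
        unfolding True by (rule bourgain_morrey_norm_eq(1)[OF that])
      show "bourgain_morrey_norm p2 t2 r2 f = (SUP (j, m)\<in>UNIV. cube_coeff coords p2 t2 \<phi> j m)"
        if "AE x in lborel. ennreal (norm (f x)) = \<phi> x" for f \<phi>
        unfolding r2 by (rule bourgain_morrey_norm_eq(1)[OF that])
      show "(SUP (j, m)\<in>UNIV. cube_coeff coords p2 t2 \<psi> j m) \<le> (SUP (j, m)\<in>UNIV. cube_coeff coords p2 t2 \<phi> j m)"
        if "\<And>x. \<psi> x \<le> \<phi> x" for \<phi> \<psi>
        using pos that by (intro SUP_mono) (auto intro!: exI pnorm_cube_coeff_mono)
      show "cube_coeff coords p2 t2 \<phi> j m < top" if "(SUP (j, m)\<in>UNIV. cube_coeff coords p2 t2 \<phi> j m) < top" for \<phi> j m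
        using SUP_upper[of "(j, m)" UNIV "\<lambda>(j, m). cube_coeff coords p2 t2 \<phi> j m"] that by (simp add: order_le_less_trans)
      show "(SUP (j, m)\<in>UNIV. cube_coeff coords p2 t2 (riesz \<alpha> \<phi>) j m) \<le> ennreal C * (SUP (j, m)\<in>UNIV. cube_coeff coords p1 t1 \<phi> j m)"
        if "\<phi> \<in> borel_measurable borel" for \<phi>
      proof (rule SUP_least)
        fix x :: "int \<times> (int ^ 'n::{finite,linorder})"
        have "\<forall>j m. cube_coeff coords p1 t1 \<phi> j m \<le> (SUP (j, m)\<in>UNIV. cube_coeff coords p1 t1 \<phi> j m)"
          using SUP_upper[of "(j, m)" UNIV "\<lambda>(j, m). cube_coeff coords p1 t1 \<phi> j m" for j m] by simp
        then show "(case x of (j, m) \<Rightarrow> cube_coeff coords p2 t2 (riesz \<alpha> \<phi>) j m) \<le> ennreal C * (SUP (j, m)\<in>UNIV. cube_coeff coords p1 t1 \<phi> j m)"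
          using bound that unfolding case_prod_unfold by blast
      qed
    qed
  next
    case False
    then obtain s1 where s1: "r1 = ereal s1" "t1 < s1"
      using j1 by (cases r1) auto
    obtain s2 where s2: "r2 = ereal s2" using tr tgt s1 by (cases r2) auto
    have s2t: "t2 < s2" using j2 s2 by auto
    \<comment> \<open>The hypothesis t1 r2 = t2 r1 in the form in which r1 and r2 share the ratio
      \<theta>.\<close>
    have s12: "s1 = R.\<theta> * s2"
      using tr s1 s2 tgt by (simp add: R.\<theta>_def field_simps)
    have s_pos: "0 < s1" "0 < s2" "1 \<le> s2" using s1 s2t tgt by auto
    obtain C where C: "0 \<le> C" and bound: "\<forall>\<phi>. \<phi> \<in> borel_measurable borel \<longrightarrow>
        (\<Sum>\<^sub>\<infinity>(J, m)\<in>UNIV. ennpowr (cube_coeff coords p2 t2 (riesz \<alpha> \<phi>) J m) s2) \<le> ennreal C * ennpowr (R.max_cube_coeff \<phi> s1) (s2 / s1)"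
      using R.infsum_cube_coeff_riesz_le[OF s_pos(1) s2t s_pos(3) s12] by (elim exE conjE) (rule that)
    show ?thesis
    proof (rule main[of "\<lambda>\<phi>. ennpowr (R.max_cube_coeff \<phi> s1) (1 / s1)"
          "\<lambda>\<phi>. ennpowr (\<Sum>\<^sub>\<infinity>(j, m)\<in>UNIV. ennpowr (cube_coeff coords p2 t2 \<phi> j m) s2) (1 / s2)" "C powr (1 / s2)"])
      show "bourgain_morrey_norm p1 t1 r1 f = ennpowr (R.max_cube_coeff \<phi> s1) (1 / s1)"
        if "AE x in lborel. ennreal (norm (f x)) = \<phi> x" for f \<phi>
        unfolding s1 R.max_cube_coeff_def by (rule bourgain_morrey_norm_eq(2)[OF that s_pos(1)])
      show "bourgain_morrey_norm p2 t2 r2 f = ennpowr (\<Sum>\<^sub>\<infinity>(j, m)\<in>UNIV. ennpowr (cube_coeff coords p2 t2 \<phi> j m) s2) (1 / s2)"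
        if "AE x in lborel. ennreal (norm (f x)) = \<phi> x" for f \<phi>
        unfolding s2 by (rule bourgain_morrey_norm_eq(2)[OF that s_pos(2)])
      show "ennpowr (\<Sum>\<^sub>\<infinity>(j, m)\<in>UNIV. ennpowr (cube_coeff coords p2 t2 \<psi> j m) s2) (1 / s2)
          \<le> ennpowr (\<Sum>\<^sub>\<infinity>(j, m)\<in>UNIV. ennpowr (cube_coeff coords p2 t2 \<phi> j m) s2) (1 / s2)"
        if "\<And>x. \<psi> x \<le> \<phi> x" for \<phi> \<psi>
      proof (intro ennpowr_mono infsum_le_ennreal)
        fix F :: "(int \<times> (int ^ 'n::{finite,linorder})) set" assume "finite F"
        have "(\<Sum>(j, m)\<in>F. ennpowr (cube_coeff coords p2 t2 \<psi> j m) s2) \<le> (\<Sum>(j, m)\<in>F. ennpowr (cube_coeff coords p2 t2 \<phi> j m) s2)"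
          using s_pos pos that unfolding case_prod_unfold by (intro sum_mono ennpowr_mono pnorm_cube_coeff_mono) auto
        also have "\<dots> \<le> (\<Sum>\<^sub>\<infinity>(j, m)\<in>UNIV. ennpowr (cube_coeff coords p2 t2 \<phi> j m) s2)"
          by (rule sum_le_infsum_ennreal) fact
        finally show "(\<Sum>(j, m)\<in>F. ennpowr (cube_coeff coords p2 t2 \<psi> j m) s2) \<le> (\<Sum>\<^sub>\<infinity>(j, m)\<in>UNIV. ennpowr (cube_coeff coords p2 t2 \<phi> j m) s2)" .
      qed (use s_pos in simp)
      show "cube_coeff coords p2 t2 \<phi> j m < top"
        if "ennpowr (\<Sum>\<^sub>\<infinity>(j, m)\<in>UNIV. ennpowr (cube_coeff coords p2 t2 \<phi> j m) s2) (1 / s2) < top" for \<phi> j m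
      proof -
        have "ennpowr (cube_coeff coords p2 t2 \<phi> j m) s2 \<le> (\<Sum>\<^sub>\<infinity>(j, m)\<in>UNIV. ennpowr (cube_coeff coords p2 t2 \<phi> j m) s2)"
          using sum_le_infsum_ennreal[of "{(j, m)}" "\<lambda>(j, m). ennpowr (cube_coeff coords p2 t2 \<phi> j m) s2"] by simp
        also have "\<dots> < top" using that by simp
        finally show ?thesis by simp
      qed
      show "0 \<le> C powr (1 / s2)" by simp
      show "ennpowr (\<Sum>\<^sub>\<infinity>(j, m)\<in>UNIV. ennpowr (cube_coeff coords p2 t2 (riesz \<alpha> \<phi>) j m) s2) (1 / s2)
          \<le> ennreal (C powr (1 / s2)) * ennpowr (R.max_cube_coeff \<phi> s1) (1 / s1)"
        if "\<phi> \<in> borel_measurable borel" for \<phi>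
      proof -
        have "ennpowr (\<Sum>\<^sub>\<infinity>(j, m)\<in>UNIV. ennpowr (cube_coeff coords p2 t2 (riesz \<alpha> \<phi>) j m) s2) (1 / s2)
          \<le> ennpowr (ennreal C * ennpowr (R.max_cube_coeff \<phi> s1) (s2 / s1)) (1 / s2)"
          using bound that s_pos by (intro ennpowr_mono) auto
        also have "\<dots> = ennreal (C powr (1 / s2)) * ennpowr (R.max_cube_coeff \<phi> s1) (1 / s1)"
          using C s_pos by (simp add: ennpowr_mult ennpowr_ennreal ennpowr_ennpowr)
        finally show ?thesis .
      qed
    qed
  qed
qed

end
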